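(* Let $p=p(n)\in(0,1)$, let $G\sim G_{n,p}$ be an Erdős–Rényi random graph, let $K_{n,p}$ be the number of edges of any unimodular triangulation of the symmetric edge polytope $P_G$, and let $N\sim\mathcal{N}(0,1)$. If $p\gg n^{-2}$ and $\limsup_{n\to\infty}p<1$, then $$d_K\left(\frac{K_{n,p}-\mathbb{E}[K_{n,p}]}{\sqrt{\mathbb{V}(K_{n,p})}},\,N\right)\lesssim\frac{1}{n\sqrt p}.$$ In particular, $K_{n,p}$ satisfies a central limit theorem as $n\to\infty$, that is, $\bigl(K_{n,p}-\mathbb{E}[K_{n,p}]\bigr)/\sqrt{\mathbb{V}(K_{n,p})}$ converges in distribution to $\mathcal{N}(0,1)$.
   Context: For a finite simple graph $G=(V,E)$ (elements of $V$ are nodes, elements of $E\subseteq\binom V2$ are arcs), with $(\mathbf{e}_i)_{i\in V}$ the standard basis of $\mathbb{R}^V$, the symmetric edge polytope is $P_G:=\operatorname{conv}\{\pm(\mathbf{e}_i-\mathbf{e}_j):\{i,j\}\in E\}\subset\mathbb{R}^V$ (empty if $E=\emptyset$, in which case the number of edges of a triangulation is $0$). A (lattice) triangulation of a $d$-dimensional lattice polytope $P$ is a subdivision of $P$ into $d$-dimensional lattice simplices with union $P$, any two of which meet in a (possibly empty) common face. It is unimodular if every $d$-simplex in it is lattice equivalent (with respect to the lattice $\mathbb{Z}^V\cap\operatorname{aff}(P)$) to the standard simplex spanned by the origin and the standard unit vectors, i.e. has normalized minimal volume. The edges of a triangulation are the $1$-dimensional elements of the simplicial complex consisting of its simplices and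 all their faces. It is known that every $P_G$ has a unimodular triangulation, and that all unimodular triangulations of a given lattice polytope have the same number of edges, so $K_{n,p}$ is well defined. It is also known that for any total order $\prec$ on the arcs of $G$ there is a unimodular triangulation of $P_G$, with vertices the origin and the vertices of $P_G$, in which two vertices $\mathbf{x},\mathbf{y}$ form an edge if and only if: one of them is the origin; or (identifying $\mathbf{e}_i-\mathbf{e}_j$ with the directed arc $i\to j$) they are not antipodal, no directed $3$-cycle in $G$ contains both corresponding directed arcs, and for every directed $4$-cycle of $G$ containing both, the $\prec$-minimal arc of that cycle is one of the arcs corresponding to $\mathbf{x}$ or $\mathbf{y}$. $G_{n,p}$ is the Erdős–Rényi random graph on node set $[n]$, each arc of the complete graph being retained independently with probability $p=p(n)\in(0,1)$. $\mathbb{V}$ denotes variance. The Kolmogorov distance is $d_K(X,Y):=\sup_{z\in\mathbb{R}}|\mathbb{P}(X\le z)-\mathbb{P}(Y\le z)|$. Asymptotic notation for sequences (as $n\to\infty$): $a_n\gg b_n$ means $\liminf|a_n/b_n|=\infty$; $a_n\lesssim b_n$ means $\limsup|a_n/b_n|<\infty$. *)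

theory Defs
  imports "HOL-Analysis.Finite_Function_Topology" "HOL-Probability.Probability"
begin

section \<open>Lattice polytopes in real coordinate spaces\<close>

text \<open>
  Since the node set of the graph varies inside the theorem, the coordinate space of functions
  from a finite set \<open>I\<close> to the reals is rendered as the subspace of those elements of the real vector
  space \<open>('i, real) poly_mapping\<close> of finitely supported functions whose support lies in \<open>I\<close>.
\<close>

type_synonym 'i coords = "('i, real) poly_mapping"

definition coord_space :: "'i set \<Rightarrow> 'i coords set" where
  "coord_space I = {x. Poly_Mapping.keys x \<subseteq> I}"

definition int_lattice :: "'i set \<Rightarrow> 'i coords set" where
  "int_lattice I = {x \<in> coord_space I. \<forall>i. Poly_Mapping.lookup x i \<in> \<int>}"

definition unit_vec :: "'i \<Rightarrow> 'i coords" where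
  "unit_vec i = Poly_Mapping.single i 1"

text \<open>
  The library's \<^const>\<open>aff_dim\<close>, \<^const>\<open>simplex\<close> and \<^const>\<open>triangulation\<close> are restricted to
  Euclidean spaces, whose dimension is fixed by the type; the versions below live in an arbitrary
  real vector space. As in the library, the empty set has dimension \<open>-1\<close>. The value of
  \<open>affdim\<close> is meaningful for sets with a finite-dimensional affine hull.
\<close>

definition affdim :: "'a::real_vector set \<Rightarrow> int" where
  "affdim S = (SOME d. \<exists>B. finite B \<and> \<not> affine_dependent B \<and>
                 affine hull B = affine hull S \<and> int (card B) = d + 1)"

definition lattice_simplex :: "'a::real_vector set \<Rightarrow> int \<Rightarrow> 'a set \<Rightarrow> bool" where
  "lattice_simplex L d S \<longleftrightarrow>
     (\<exists>C \<subseteq> L. finite C \<and> \<not> affine_dependent C \<and> int (card C) = d + 1 \<and> S = convex hull C)"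

definition lattice_triangulation :: "'a::real_vector set \<Rightarrow> 'a set \<Rightarrow> 'a set set \<Rightarrow> bool" where
  "lattice_triangulation L P \<T> \<longleftrightarrow>
     finite \<T> \<and>
     (\<forall>S\<in>\<T>. lattice_simplex L (affdim P) S) \<and>
     \<Union>\<T> = P \<and>
     (\<forall>S\<in>\<T>. \<forall>S'\<in>\<T>. (S \<inter> S') face_of S \<and> (S \<inter> S') face_of S')"

definition affine_map_on :: "'a::real_vector set \<Rightarrow> ('a \<Rightarrow> 'b::real_vector) \<Rightarrow> bool" where
  "affine_map_on A f \<longleftrightarrow>
     (\<forall>x\<in>A. \<forall>y\<in>A. \<forall>u::real. f ((1 - u) *\<^sub>R x + u *\<^sub>R y) = (1 - u) *\<^sub>R f x + u *\<^sub>R f y)"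

definition standard_simplex :: "nat \<Rightarrow> nat coords set" where
  "standard_simplex d = convex hull (insert 0 (unit_vec ` {..<d}))"

text \<open>
  Lattice equivalence of a full-dimensional simplex \<open>S\<close> in \<open>P\<close> to the standard simplex: an affine
  isomorphism from the affine hull of \<open>P\<close> onto \<open>d\<close>-dimensional coordinate space that identifies the
  lattice \<open>L \<inter> affine hull P\<close> with the integer lattice and \<open>S\<close> with the standard simplex.
\<close>

definition unimodular_simplex ::
  "'i coords set \<Rightarrow> 'i coords set \<Rightarrow> nat \<Rightarrow> 'i coords set \<Rightarrow> bool" where
  "unimodular_simplex L P d S \<longleftrightarrow>
     (\<exists>f :: 'i coords \<Rightarrow> nat coords.
        affine_map_on (affine hull P) f \<and>
        bij_betw f (affine hull P) (coord_space {..<d}) \<and>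
        f ` (L \<inter> affine hull P) = int_lattice {..<d} \<and>
        f ` S = standard_simplex d)"

text \<open>
  If \<open>P\<close> is empty, so that \<open>affdim P = -1\<close>, the conditions admit exactly the empty collection of
  simplices, which has no edges (the empty simplex is not equivalent to \<open>standard_simplex 0\<close>).
\<close>

definition unimodular_triangulation ::
  "'i coords set \<Rightarrow> 'i coords set \<Rightarrow> 'i coords set set \<Rightarrow> bool" where
  "unimodular_triangulation L P \<T> \<longleftrightarrow>
     lattice_triangulation L P \<T> \<and> (\<forall>S\<in>\<T>. unimodular_simplex L P (nat (affdim P)) S)"

definition triangulation_edges :: "'a::real_vector set set \<Rightarrow> 'a set set" where
  "triangulation_edges \<T> = {F. \<exists>S\<in>\<T>. F face_of S \<and> affdim F = 1}"

section \<open>Graphs and symmetric edge polytopes\<close>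

text \<open>A finite simple graph on the node set \<open>V\<close> is given by its arc set \<open>E \<subseteq> all_arcs V\<close>.\<close>

definition all_arcs :: "'v set \<Rightarrow> 'v set set" where
  "all_arcs V = {e. e \<subseteq> V \<and> card e = 2}"

definition symmetric_edge_polytope :: "'v set set \<Rightarrow> 'v coords set" where
  "symmetric_edge_polytope E =
     convex hull {x. \<exists>i j. {i, j} \<in> E \<and>
                       (x = unit_vec i - unit_vec j \<or> x = - (unit_vec i - unit_vec j))}"

definition erdos_renyi :: "nat \<Rightarrow> real \<Rightarrow> nat set set pmf" where
  "erdos_renyi n p =
     map_pmf (\<lambda>f. {e \<in> all_arcs {1..n}. f e})
       (Pi_pmf (all_arcs {1..n}) False (\<lambda>_. bernoulli_pmf p))"

section \<open>Probability and asymptotics\<close>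

definition standardized :: "'a pmf \<Rightarrow> ('a \<Rightarrow> real) \<Rightarrow> 'a \<Rightarrow> real" where
  "standardized M X \<omega> =
     (X \<omega> - measure_pmf.expectation M X) / sqrt (measure_pmf.variance M X)"

definition standardized_law :: "'a pmf \<Rightarrow> ('a \<Rightarrow> real) \<Rightarrow> real measure" where
  "standardized_law M X = distr (measure_pmf M) borel (standardized M X)"

text \<open>
  The Kolmogorov distance of two random variables depends only on their laws, which are the
  arguments here. The supremum is taken over a bounded set if both laws are probability measures.
\<close>

definition kolmogorov_dist :: "real measure \<Rightarrow> real measure \<Rightarrow> real" where
  "kolmogorov_dist \<mu> \<nu> = (SUP z. \<bar>cdf \<mu> z - cdf \<nu> z\<bar>)"

text \<open>
  \<open>asymp_dominates a b\<close> is \<open>a\<^sub>n \<ggreater> b\<^sub>n\<close> and \<open>asymp_bounded a b\<close> is \<open>a\<^sub>n \<lesssim> b\<^sub>n\<close>.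
\<close>

definition asymp_dominates :: "(nat \<Rightarrow> real) \<Rightarrow> (nat \<Rightarrow> real) \<Rightarrow> bool" where
  "asymp_dominates a b \<longleftrightarrow> liminf (\<lambda>n. ereal \<bar>a n / b n\<bar>) = \<infinity>"

definition asymp_bounded :: "(nat \<Rightarrow> real) \<Rightarrow> (nat \<Rightarrow> real) \<Rightarrow> bool" where
  "asymp_bounded a b \<longleftrightarrow> limsup (\<lambda>n. ereal \<bar>a n / b n\<bar>) < \<infinity>"

end

theory Submission
  imports Defs "HOL-Real_Asymp.Real_Asymp"
begin

text \<open>
  In a unimodular triangulation the edges correspond to those lattice points of \<open>2P\<close> that are not
  twice a lattice point of \<open>P\<close>. For a symmetric edge polytope these lattice points are found by
  testing against potentials that are 1-Lipschitz along the arcs, and counting them gives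
  \<open>K = 2m\<^sup>2 - T/4 + Z\<close>, where \<open>m\<close> is the number of arcs, \<open>T\<close> counts the ordered 4-cycles, and \<open>Z\<close>
  is a correction of lower order.

  The normal approximation uses Stein's method for functions \<open>W\<close> of independent Bernoulli variables
  \<open>x\<^sub>e\<close> with centred versions \<open>y\<^sub>e = x\<^sub>e - p\<close>. If \<open>W\<close> is close in \<open>L\<^sup>2\<close> to \<open>\<Sum>\<^sub>e y\<^sub>e h\<^sub>e\<close> with \<open>h\<^sub>e\<close> bounded and
  independent of \<open>x\<^sub>e\<close>, then monotonicity of \<open>w \<mapsto> w f(w)\<close> for the Stein solution \<open>f\<close> turns the discrete
  remainder into \<open>E \<bar>\<Sum>\<^sub>e y\<^sub>e D\<^sub>e W\<bar>\<close>, so that no smoothing of the indicator function is needed and the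
  optimal rate is kept. The \<open>h\<^sub>e\<close> come from the first chaos of \<open>2m\<^sup>2 - T/4\<close> and from the pairs of adjacent
  arcs in its second chaos. These pairs are too large to be treated as an error; everything else is of
  relative order \<open>1/(n \<surd>p)\<close> by iterated Efron-Stein inequalities.
\<close>

section \<open>Stein's equation\<close>

text \<open>Write \<open>r = n * sqrt p\<close> and \<open>s = n^2 p = r^2\<close>. The standard
  deviation of the count is at least of order \<open>r^3\<close> and the \<open>h_e\<close> are at
  most of order \<open>r^2\<close>; every error has to be smaller than the main term by a factor
  \<open>r\<close>. The lower bound on the variance is where p being bounded away from 1 enters: one
  more arc raises \<open>2 m^2\<close> by about \<open>2 n^2 p\<close> in the mean and
  \<open>T / 4\<close> by about \<open>2 n^2 p^3\<close>, so that the first chaos degenerates as p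
  tends to 1. Two adjacent arcs lie on order n common 4-cycles and have a second order coefficient
  of order \<open>n p^2\<close>; the order \<open>n^3\<close> such pairs contribute
  \<open>n^5 p^6\<close> to the variance, which for constant p exceeds the admissible error
  \<open>s^2 = n^4 p^2\<close>. Disjoint pairs have bounded coefficients and contribute order
  \<open>n^4 p^2\<close>; third derivatives contribute at most \<open>p^3\<close> times the number
  of 4-cycles, again within \<open>s^2\<close>. The derivative of \<open>Z\<close> in an arc is
  controlled by the degrees of its two ends, so that one step of Efron-Stein is enough for
  it.\<close>

abbreviation Phi :: "real \<Rightarrow> real" where "Phi \<equiv> cdf std_normal_distribution"

lemma Phi_ge_0: "0 \<le> Phi x"
  by (simp add: cdf_def)

lemma Phi_le_1: "Phi x \<le> 1"
proof -
  interpret real_distribution std_normal_distribution by (rule real_dist_normal_dist)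
  show ?thesis by (simp add: cdf_def)
qed

lemma Phi_mono: "x \<le> y \<Longrightarrow> Phi x \<le> Phi y"
proof -
  interpret real_distribution std_normal_distribution by (rule real_dist_normal_dist)
  show "x \<le> y \<Longrightarrow> Phi x \<le> Phi y" by (rule cdf_nondecreasing)
qed

lemma Phi_at_top: "(Phi \<longlongrightarrow> 1) at_top"
proof -
  interpret real_distribution std_normal_distribution by (rule real_dist_normal_dist)
  show ?thesis by (rule cdf_lim_at_top_prob)
qed

lemma Phi_at_bot: "(Phi \<longlongrightarrow> 0) at_bot"
proof -
  interpret real_distribution std_normal_distribution by (rule real_dist_normal_dist)
  show ?thesis by (rule cdf_lim_at_bot)
qed

lemma continuous_std_normal_density: "continuous_on A std_normal_density"
  unfolding std_normal_density_def by (intro continuous_intros) auto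

lemma Phi_diff_eq_integral:
  assumes "a < b"
  shows "Phi b - Phi a = integral {a..b} std_normal_density"
proof -
  interpret real_distribution std_normal_distribution by (rule real_dist_normal_dist)
  have "Phi b - Phi a = measure std_normal_distribution {a<..b}"
    using assms by (rule cdf_diff_eq)
  also have "\<dots> = (\<integral>x. indicator {a<..b} x \<partial>std_normal_distribution)"
    by simp
  also have "\<dots> = (\<integral>x. std_normal_density x * indicator {a<..b} x \<partial>lborel)"
    by (subst integral_density) (auto intro!: normal_density_nonneg)
  also have "\<dots> = (\<integral>x. std_normal_density x * indicator {a..b} x \<partial>lborel)"
  proof (rule integral_cong_AE)
    show "AE x in lborel. std_normal_density x * indicator {a<..b} x = std_normal_density x * indicator {a..b} x"
      using AE_lborel_singleton[of a] by eventually_elim (auto simp: indicator_def)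
  qed auto
  also have "\<dots> = (LINT x:{a..b}|lborel. std_normal_density x)"
    by (simp add: set_lebesgue_integral_def mult.commute)
  also have "\<dots> = integral {a..b} std_normal_density"
    by (intro set_borel_integral_eq_integral borel_integrable_atLeastAtMost')
       (rule continuous_std_normal_density)
  finally show ?thesis .
qed

lemma Phi_has_derivative [derivative_intros]:
  assumes "(g has_real_derivative g') (at x within S)"
  shows "((\<lambda>x. Phi (g x)) has_real_derivative std_normal_density (g x) * g') (at x within S)"
proof -
  have *: "(Phi has_real_derivative std_normal_density y) (at y)" for y
  proof -
    have "((\<lambda>t. integral {y - 1..t} std_normal_density) has_real_derivative std_normal_density y)
            (at y within {y - 1..y + 1})"
      unfolding has_real_derivative_iff_has_vector_derivative
      by (rule integral_has_vector_derivative) (auto intro: continuous_std_normal_density)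
    then have "((\<lambda>t. integral {y - 1..t} std_normal_density) has_real_derivative std_normal_density y) (at y)"
      by (subst (asm) at_within_interior) (auto simp: interior_atLeastAtMost_real)
    then have "((\<lambda>t. Phi (y - 1) + integral {y - 1..t} std_normal_density)
                 has_real_derivative std_normal_density y) (at y)"
      by (auto intro!: derivative_eq_intros)
    then show ?thesis
    proof (rule has_field_derivative_transform_within_open)
      fix t assume "t \<in> {y - 1<..}"
      then show "Phi (y - 1) + integral {y - 1..t} std_normal_density = Phi t"
        using Phi_diff_eq_integral[of "y - 1" t] by simp
    qed auto
  qed
  show ?thesis
    using DERIV_chain2[OF *[of "g x"] assms] by simp
qed

lemma std_normal_density_has_derivative [derivative_intros]:
  assumes "(g has_real_derivative g') (at x within S)"
  shows "((\<lambda>x. std_normal_density (g x)) has_real_derivative - g x * std_normal_density (g x) * g') (at x within S)"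
  unfolding std_normal_density_def
  by (rule derivative_eq_intros assms refl | simp)+

lemma std_normal_density_at_top: "(std_normal_density \<longlongrightarrow> 0) at_top"
  unfolding std_normal_density_def[abs_def] by real_asymp

lemma std_normal_density_minus: "std_normal_density (- x) = std_normal_density x"
  by (simp add: std_normal_density_def)

lemma std_normal_density_gt_0: "0 < std_normal_density x"
  by (rule normal_density_pos) simp

lemma Phi_minus: "Phi (- x) = 1 - Phi x"
proof -
  have "\<exists>c. \<forall>x. Phi x + Phi (- x) = c"
  proof -
    have "((\<lambda>x. Phi x + Phi (- x)) has_real_derivative 0) (at y)" for y
      by (rule derivative_eq_intros refl | simp add: std_normal_density_minus)+
    then show ?thesis
      using DERIV_isconst_all[of "\<lambda>x. Phi x + Phi (- x)"] by blast
  qed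
  then obtain c where c: "\<And>x. Phi x + Phi (- x) = c" by blast
  have "((\<lambda>x. Phi x + Phi (- x)) \<longlongrightarrow> 1 + 0) at_top"
    by (intro tendsto_add Phi_at_top filterlim_compose[OF Phi_at_bot] filterlim_uminus_at_bot_at_top)
  then have "((\<lambda>x::real. c) \<longlongrightarrow> 1) at_top" using c by simp
  then have "c = 1" by (simp add: tendsto_const_iff)
  then show ?thesis using c[of x] by simp
qed

section \<open>Bounds for the Mills ratio of the normal law\<close>

lemma nonneg_if_antimono_to_0:
  fixes g :: "real \<Rightarrow> real"
  assumes "\<And>x. x \<ge> a \<Longrightarrow> (g has_real_derivative g' x) (at x)" "\<And>x. x \<ge> a \<Longrightarrow> g' x \<le> 0"
    and lim: "(g \<longlongrightarrow> 0) at_top"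
  shows "0 \<le> g a"
proof (rule tendsto_upperbound[OF lim])
  show "eventually (\<lambda>x. g x \<le> g a) at_top"
    using eventually_ge_at_top[of a]
  proof eventually_elim
    case (elim x)
    then show ?case
      by (intro DERIV_nonpos_imp_nonincreasing[of a x g]) (use assms in auto)
  qed
qed simp

text \<open>The difference, divided by \<open>1 + w^2\<close>, decreases to 0 at infinity. Validity
  for negative \<open>w\<close> matters as well: it makes \<open>mills\<close> monotone on the whole
  line, since the two sides differ by the derivative of \<open>mills\<close> times the
  density.\<close>

lemma mills_lower: "w * std_normal_density w \<le> (1 + w\<^sup>2) * (1 - Phi w)"
proof -
  let ?g = "\<lambda>w. 1 - Phi w - w / (1 + w\<^sup>2) * std_normal_density w"
  have pos: "1 + x\<^sup>2 > 0" for x :: real by (simp add: add_pos_nonneg)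
  have "0 \<le> ?g w"
  proof (rule nonneg_if_antimono_to_0[where g = ?g and a = w and
        g' = "\<lambda>x. - 2 * std_normal_density x / (1 + x\<^sup>2)\<^sup>2"])
    fix x
    show "(?g has_real_derivative - 2 * std_normal_density x / (1 + x\<^sup>2)\<^sup>2) (at x)"
      apply (rule derivative_eq_intros refl | use pos[of x] in force)+
      using pos[of x] by (simp add: divide_simps power2_eq_square) (simp add: algebra_simps)
    show "- 2 * std_normal_density x / (1 + x\<^sup>2)\<^sup>2 \<le> 0"
      using std_normal_density_gt_0[of x] by (simp add: divide_simps)
  next
    have "(?g \<longlongrightarrow> 1 - 1 - 0 * 0) at_top"
    proof (intro tendsto_intros Phi_at_top std_normal_density_at_top)
      show "((\<lambda>x::real. x / (1 + x\<^sup>2)) \<longlongrightarrow> 0) at_top" by real_asymp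
    qed
    then show "(?g \<longlongrightarrow> 0) at_top" by simp
  qed
  then show ?thesis using pos[of w] by (simp add: field_simps)
qed

lemma mills_upper:
  assumes "0 < w"
  shows "w * (1 - Phi w) \<le> std_normal_density w"
proof -
  let ?g = "\<lambda>w. std_normal_density w / w - (1 - Phi w)"
  have "0 \<le> ?g w"
  proof (rule nonneg_if_antimono_to_0[where g = ?g and a = w and
        g' = "\<lambda>x. - std_normal_density x / x\<^sup>2"])
    fix x assume "x \<ge> w"
    then have "x > 0" using assms by simp
    show "(?g has_real_derivative - std_normal_density x / x\<^sup>2) (at x)"
      apply (rule derivative_eq_intros refl | use \<open>x > 0\<close> in force)+
      using \<open>x > 0\<close> by (simp add: divide_simps power2_eq_square)
    show "- std_normal_density x / x\<^sup>2 \<le> 0"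
      using std_normal_density_gt_0[of x] by (simp add: divide_simps)
  next
    have "((\<lambda>x. std_normal_density x * (1 / x) - (1 - Phi x)) \<longlongrightarrow> 0 * 0 - (1 - 1)) at_top"
    proof (intro tendsto_intros Phi_at_top std_normal_density_at_top)
      show "((\<lambda>x::real. 1 / x) \<longlongrightarrow> 0) at_top" by real_asymp
    qed
    then show "(?g \<longlongrightarrow> 0) at_top" by simp
  qed
  then show ?thesis using assms by (simp add: field_simps)
qed

text \<open>This is \<open>w\<close> times the Mills ratio; up to a constant factor and a
  reflection, \<open>w * stein_sol z w\<close> coincides with it on each side of
  \<open>z\<close>.\<close>

definition mills :: "real \<Rightarrow> real" where
  "mills w = w * (1 - Phi w) / std_normal_density w"

lemma mills_mono: "x \<le> y \<Longrightarrow> mills x \<le> mills y"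
proof (rule DERIV_nonneg_imp_nondecreasing[of x y mills])
  fix t :: real
  have "(mills has_real_derivative ((1 + t\<^sup>2) * (1 - Phi t) - t * std_normal_density t) / std_normal_density t) (at t)"
    unfolding mills_def[abs_def]
    apply (rule derivative_eq_intros refl | use std_normal_density_gt_0[of t] in force)+
    using std_normal_density_gt_0[of t] apply (simp add: divide_simps power2_eq_square)
    apply (simp add: algebra_simps)
    done
  moreover have "((1 + t\<^sup>2) * (1 - Phi t) - t * std_normal_density t) / std_normal_density t \<ge> 0"
    using mills_lower[of t] std_normal_density_gt_0[of t] by simp
  ultimately show "\<exists>y. (mills has_real_derivative y) (at t) \<and> 0 \<le> y" by blast
qed

lemma mills_bounds: "0 \<le> w \<Longrightarrow> 0 \<le> mills w \<and> mills w \<le> 1"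
proof -
  assume "0 \<le> w"
  then show ?thesis
    using mills_upper[of w] std_normal_density_gt_0[of w] Phi_le_1[of w]
    by (cases "w = 0") (auto simp: mills_def divide_simps)
qed

text \<open>The bounded solution of Stein's equation
  \<open>f' w - w * f w = of_bool (w \<le> z) - Phi z\<close>; \<open>min\<close> and
  \<open>max\<close> fold the two branches \<open>w \<le> z\<close> and \<open>w \<ge> z\<close>
  into one formula.\<close>

definition stein_sol :: "real \<Rightarrow> real \<Rightarrow> real" where
  "stein_sol z w = Phi (min w z) * (1 - Phi (max w z)) / std_normal_density w"

lemma stein_sol_ge: "w \<ge> z \<Longrightarrow> w * stein_sol z w = Phi z * mills w"
  by (simp add: stein_sol_def mills_def)

lemma stein_sol_le: "w \<le> z \<Longrightarrow> w * stein_sol z w = (Phi z - 1) * mills (- w)"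
  by (simp add: stein_sol_def mills_def Phi_minus std_normal_density_minus algebra_simps)
     (simp add: divide_simps algebra_simps)

text \<open>To the right of \<open>z\<close> the function is \<open>mills\<close> times a
  nonnegative constant, to the left it is the reflected \<open>mills\<close> times a nonpositive
  one; the branches agree at \<open>z\<close>, so points on different sides are compared through
  \<open>z\<close>.\<close>

lemma mono_stein_sol: "x \<le> y \<Longrightarrow> x * stein_sol z x \<le> y * stein_sol z y"
proof -
  have ge: "z \<le> x \<Longrightarrow> x \<le> y \<Longrightarrow> x * stein_sol z x \<le> y * stein_sol z y" for x y
    by (simp add: stein_sol_ge mult_left_mono mills_mono Phi_ge_0)
  have le: "y \<le> z \<Longrightarrow> x \<le> y \<Longrightarrow> x * stein_sol z x \<le> y * stein_sol z y" for x y
    by (simp add: stein_sol_le mult_left_mono_neg mills_mono Phi_le_1)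
  show "x \<le> y \<Longrightarrow> x * stein_sol z x \<le> y * stein_sol z y"
    using ge[of x y] le[of y x] ge[of z y] le[of z x] by linarith
qed

lemma abs_mult_stein_sol: "\<bar>w * stein_sol z w\<bar> \<le> 1"
proof -
  have *: "\<bar>Phi z * mills w\<bar> \<le> 1" if "w \<ge> z" for z w
  proof (cases "w \<ge> 0")
    case True
    then show ?thesis using mills_bounds[of w] Phi_ge_0[of z] Phi_le_1[of z]
      by (simp add: abs_mult mult_le_one)
  next
    case False
    \<comment> \<open>On the negative axis \<open>mills\<close> is unbounded; the factor
      \<open>Phi z \<le> Phi w\<close> compensates for this and leaves
      \<open>mills (- w)\<close>.\<close>
    have "\<bar>Phi z * mills w\<bar> \<le> Phi w * \<bar>mills w\<bar>"
      using Phi_mono[OF that] Phi_ge_0[of z] by (simp add: abs_mult mult_right_mono)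
    also have "\<dots> = \<bar>w\<bar> * Phi w / std_normal_density w * (1 - Phi w)"
      using Phi_le_1[of w] Phi_ge_0[of w] std_normal_density_gt_0[of w] by (simp add: mills_def abs_mult)
    also have "\<dots> \<le> \<bar>w\<bar> * Phi w / std_normal_density w * 1"
      using Phi_le_1[of w] Phi_ge_0[of w] std_normal_density_gt_0[of w]
      by (intro mult_left_mono) auto
    also have "\<dots> = mills (- w)" using False
      by (simp add: mills_def Phi_minus std_normal_density_minus)
    also have "\<dots> \<le> 1" using mills_bounds[of "- w"] False by simp
    finally show ?thesis .
  qed
  show ?thesis
  proof (cases "w \<ge> z")
    case True then show ?thesis using * by (simp add: stein_sol_ge)
  next
    case False
    then show ?thesis using *[of "- z" "- w"]
      by (simp add: stein_sol_le Phi_minus abs_mult abs_minus_commute)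
  qed
qed

text \<open>For \<open>\<bar>w\<bar> \<ge> 1\<close> the bound on \<open>w * stein_sol z w\<close>
  is stronger. Otherwise 5 is \<open>sqrt (2 * 4 * 3)\<close> rounded up, a bound on the reciprocal
  density from \<open>pi < 4\<close> and \<open>exp 1 \<le> 3\<close>.\<close>

lemma abs_stein_sol: "\<bar>stein_sol z w\<bar> \<le> 5"
proof (cases "\<bar>w\<bar> \<ge> 1")
  case True
  have "\<bar>stein_sol z w\<bar> \<le> \<bar>w\<bar> * \<bar>stein_sol z w\<bar>"
    using True mult_right_mono[of 1 "\<bar>w\<bar>" "\<bar>stein_sol z w\<bar>"] by simp
  then show ?thesis using abs_mult_stein_sol[of w z] by (simp add: abs_mult)
next
  case False
  have "w\<^sup>2 \<le> 1" using False by (simp add: abs_square_le_1)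
  have "(1 / std_normal_density w)\<^sup>2 = 2 * pi * exp (w\<^sup>2)"
    by (simp add: std_normal_density_def power_divide power_mult_distrib exp_minus field_simps
        flip: exp_double)
  also have "\<dots> \<le> 2 * 4 * 3"
  proof (intro mult_mono)
    have "exp (w\<^sup>2) \<le> exp 1" using \<open>w\<^sup>2 \<le> 1\<close> by simp
    then show "exp (w\<^sup>2) \<le> 3" using exp_le by linarith
  qed (use pi_less_4 in auto)
  also have "\<dots> \<le> 5\<^sup>2" by simp
  finally have "1 / std_normal_density w \<le> 5" by (rule power2_le_imp_le) simp
  moreover have "\<bar>stein_sol z w\<bar> \<le> 1 / std_normal_density w"
    unfolding stein_sol_def abs_divide
    using Phi_le_1[of "min w z"] Phi_ge_0[of "min w z"] Phi_le_1[of "max w z"] Phi_ge_0[of "max w z"]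
      std_normal_density_gt_0[of w]
    by (intro divide_mono) (auto simp: abs_mult intro!: mult_le_one)
  ultimately show ?thesis by linarith
qed

text \<open>Read off from Stein's equation instead of being a derivative by definition, so that it
  also has a value at the kink \<open>w = z\<close>, namely the left derivative.\<close>

definition stein_deriv :: "real \<Rightarrow> real \<Rightarrow> real" where
  "stein_deriv z w = w * stein_sol z w + of_bool (w \<le> z) - Phi z"

lemma abs_stein_deriv: "\<bar>stein_deriv z w\<bar> \<le> 2"
  using abs_mult_stein_sol[of w z] Phi_ge_0[of z] Phi_le_1[of z]
  unfolding stein_deriv_def by (cases "w \<le> z") (simp_all; linarith)+

lemma isCont_Phi: "isCont Phi x"
  using DERIV_isCont[OF Phi_has_derivative[OF DERIV_ident]] by blast

lemma continuous_on_stein_sol: "continuous_on A (stein_sol z)"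
proof -
  have 1: "continuous_on A (\<lambda>w. Phi (g w))" if "continuous_on A g" for g :: "real \<Rightarrow> real"
    by (rule continuous_on_compose2[OF continuous_at_imp_continuous_on[of UNIV] that])
       (auto intro: isCont_Phi)
  have "std_normal_density w \<noteq> 0" for w using std_normal_density_gt_0[of w] by simp
  then show ?thesis
    unfolding stein_sol_def[abs_def]
    by (intro continuous_intros 1 continuous_std_normal_density) auto
qed

lemma stein_sol_has_derivative:
  assumes "w \<noteq> z"
  shows "(stein_sol z has_real_derivative stein_deriv z w) (at w)"
proof (cases "w < z")
  case True
  have "((\<lambda>w. Phi w * (1 - Phi z) / std_normal_density w) has_real_derivative stein_deriv z w) (at w)"
    apply (rule derivative_eq_intros refl | use std_normal_density_gt_0[of w] in force)+
    using std_normal_density_gt_0[of w] True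
    apply (simp add: stein_deriv_def stein_sol_def divide_simps)
    apply (simp add: algebra_simps)
    done
  then show ?thesis
    by (rule has_field_derivative_transform_within_open[where S = "{..<z}"])
       (use True in \<open>auto simp: stein_sol_def\<close>)
next
  case False
  then have "z < w" using assms by simp
  have "((\<lambda>w. Phi z * (1 - Phi w) / std_normal_density w) has_real_derivative stein_deriv z w) (at w)"
    apply (rule derivative_eq_intros refl | use std_normal_density_gt_0[of w] in force)+
    using std_normal_density_gt_0[of w] \<open>z < w\<close>
    apply (simp add: stein_deriv_def stein_sol_def divide_simps)
    apply (simp add: algebra_simps)
    done
  then show ?thesis
    by (rule has_field_derivative_transform_within_open[where S = "{z<..}"])
       (use \<open>z < w\<close> in \<open>auto simp: stein_sol_def\<close>)
qed

text \<open>The left side is the integral of \<open>stein_deriv z t - stein_deriv z s\<close>. Up to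
  a constant \<open>stein_deriv z\<close> is a nondecreasing function plus a nonincreasing
  indicator, so its oscillation on \<open>{x..y}\<close> is at most the sum of the two variations,
  which is the increment of \<open>w * stein_sol z w - of_bool (w \<le> z)\<close>.\<close>

lemma stein_sol_increment_aux:
  assumes "x < y" "s = x \<or> s = y"
  shows "\<bar>stein_sol z y - stein_sol z x - (y - x) * stein_deriv z s\<bar>
         \<le> (y - x) * ((y * stein_sol z y - of_bool (y \<le> z)) - (x * stein_sol z x - of_bool (x \<le> z)))"
    (is "_ \<le> _ * ?B")
proof -
  have s: "x \<le> s" "s \<le> y" using assms by auto
  have "(stein_deriv z has_integral (stein_sol z y - stein_sol z x)) {x..y}"
    by (rule fundamental_theorem_of_calculus_interior_strong[of "{z}"])
       (use assms stein_sol_has_derivative in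
         \<open>auto simp: has_real_derivative_iff_has_vector_derivative[symmetric] continuous_on_stein_sol\<close>)
  then have "((\<lambda>t. stein_deriv z t - stein_deriv z s) has_integral
      (stein_sol z y - stein_sol z x - (y - x) * stein_deriv z s)) {x..y}"
    using assms has_integral_diff[OF _ has_integral_const_real[of "stein_deriv z s" x y]] by simp
  then have "norm (stein_sol z y - stein_sol z x - (y - x) * stein_deriv z s)
      \<le> ?B * measure lborel (cbox x y)"
    unfolding box_real(2)[symmetric]
  proof (rule has_integral_bound[rotated])
    fix t assume "t \<in> cbox x y"
    then have t: "t \<in> {x..y}" by simp
    have "x * stein_sol z x \<le> t * stein_sol z t" "t * stein_sol z t \<le> y * stein_sol z y"
      "x * stein_sol z x \<le> s * stein_sol z s" "s * stein_sol z s \<le> y * stein_sol z y"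
      using t s by (auto intro!: mono_stein_sol)
    then show "norm (stein_deriv z t - stein_deriv z s) \<le> ?B"
      using t s by (auto simp: stein_deriv_def of_bool_def split: if_splits)
  next
    show "0 \<le> ?B" using mono_stein_sol[of x y z] assms by (auto simp: of_bool_def)
  qed
  then show ?thesis using assms by (simp add: mult.commute)
qed

text \<open>Exchanging \<open>x\<close> and \<open>y\<close> flips both factors on the right. In the
  application \<open>y - x\<close> is a discrete derivative of either sign.\<close>

lemma stein_sol_increment:
  assumes "s = x \<or> s = y"
  shows "\<bar>stein_sol z y - stein_sol z x - (y - x) * stein_deriv z s\<bar>
         \<le> (y - x) * ((y * stein_sol z y - of_bool (y \<le> z)) - (x * stein_sol z x - of_bool (x \<le> z)))"
proof -
  consider "x < y" | "x = y" | "y < x" by linarith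
  then show ?thesis
  proof cases
    case 1 then show ?thesis using stein_sol_increment_aux assms by blast
  next
    case 2 then show ?thesis by simp
  next
    case 3 then show ?thesis
      using stein_sol_increment_aux[of y x s z] assms
        minus_mult_minus[of "x - y" "x * stein_sol z x - of_bool (x \<le> z) - (y * stein_sol z y - of_bool (y \<le> z))"]
        mult_minus_left[of "x - y" "stein_deriv z s"]
      unfolding minus_diff_eq by (smt (verit))
  qed
qed

section \<open>Random subsets and discrete derivatives\<close>

definition random_subset :: "'a set \<Rightarrow> real \<Rightarrow> 'a set pmf" where
  "random_subset I p = map_pmf (\<lambda>f. {e \<in> I. f e}) (Pi_pmf I False (\<lambda>_. bernoulli_pmf p))"

definition dd :: "'a \<Rightarrow> ('a set \<Rightarrow> real) \<Rightarrow> 'a set \<Rightarrow> real" where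
  "dd e f A = f (insert e A) - f (A - {e})"

lemma dd_add: "dd e (\<lambda>A. f A + g A) A = dd e f A + dd e g A"
  by (simp add: dd_def)

lemma dd_diff: "dd e (\<lambda>A. f A - g A) A = dd e f A - dd e g A"
  by (simp add: dd_def)

lemma dd_cmult: "dd e (\<lambda>A. c * f A) A = c * dd e f A"
  by (simp add: dd_def algebra_simps)

lemma dd_divide: "dd e (\<lambda>A. f A / c) A = dd e f A / c"
  by (simp add: dd_def diff_divide_distrib)

lemma dd_const: "dd e (\<lambda>A. c) A = 0"
  by (simp add: dd_def)

lemma dd_sum: "dd e (\<lambda>A. \<Sum>i\<in>S. f i A) A = (\<Sum>i\<in>S. dd e (f i) A)"
  by (simp add: dd_def sum_subtractf)

lemma dd_mult: "dd e (\<lambda>A. f A * g A) A = dd e f A * g (insert e A) + f (A - {e}) * dd e g A"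
  by (simp add: dd_def algebra_simps)

lemma dd_dd_same: "dd e (dd e f) A = 0"
  by (simp add: dd_def)

lemma insert_remove_commute: "e \<noteq> f \<Longrightarrow> insert e (A - {f}) = insert e A - {f}"
  by auto

lemma dd_commute: "dd e (dd f g) A = dd f (dd e g) A"
proof (cases "e = f")
  case False
  then have "insert e (A - {f}) = insert e A - {f}" "insert f (A - {e}) = insert f A - {e}"
    "A - {e} - {f} = A - {f} - {e}" "insert e (insert f A) = insert f (insert e A)"
    by auto
  then show ?thesis by (simp add: dd_def)
qed simp

text \<open>A deterministic form of independence: \<open>f\<close> ignores whether \<open>e\<close>
  belongs to its argument, so under a product measure its value is independent of the coordinate
  \<open>e\<close>.\<close>

definition indep_of :: "'a \<Rightarrow> ('a set \<Rightarrow> real) \<Rightarrow> bool" where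
  "indep_of e f \<longleftrightarrow> (\<forall>A. dd e f A = 0)"

lemma indep_of_dd: "indep_of e (dd e f)"
  by (simp add: indep_of_def dd_dd_same)

lemma indep_of_dd_other: "indep_of e f \<Longrightarrow> indep_of e (dd g f)"
  by (simp add: indep_of_def) (metis dd_commute dd_def diff_self)

lemma indep_of_insert: "indep_of e f \<Longrightarrow> f (insert e A) = f A"
  and indep_of_remove: "indep_of e f \<Longrightarrow> f (A - {e}) = f A"
proof -
  assume *: "indep_of e f"
  show "f (insert e A) = f A"
    using * by (cases "e \<in> A") (auto simp: indep_of_def dd_def insert_absorb)
  show "f (A - {e}) = f A"
    using *[unfolded indep_of_def dd_def, rule_format, of A]
    by (cases "e \<in> A") (auto simp: insert_absorb)
qed

lemma dd_mult_indep: "indep_of e f \<Longrightarrow> dd e (\<lambda>A. f A * g A) A = f A * dd e g A"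
  by (simp add: dd_def indep_of_insert indep_of_remove algebra_simps)

lemma indep_of_member: "e \<noteq> f \<Longrightarrow> indep_of e (\<lambda>A. of_bool (f \<in> A) - p)"
  by (auto simp: indep_of_def dd_def)

section \<open>Expectations over random subsets\<close>

lemma set_pmf_random_subset: "finite I \<Longrightarrow> set_pmf (random_subset I p) \<subseteq> Pow I"
  by (auto simp: random_subset_def)

lemma finite_set_pmf_random_subset: "finite I \<Longrightarrow> finite (set_pmf (random_subset I p))"
  using finite_subset[OF set_pmf_random_subset] by blast

lemma integrable_random_subset:
  fixes f :: "'a set \<Rightarrow> real"
  shows "finite I \<Longrightarrow> integrable (measure_pmf (random_subset I p)) f"
  by (intro integrable_measure_pmf_finite finite_set_pmf_random_subset)

abbreviation expect :: "'a set \<Rightarrow> real \<Rightarrow> ('a set \<Rightarrow> real) \<Rightarrow> real" where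
  "expect I p f \<equiv> measure_pmf.expectation (random_subset I p) f"

lemma expect_cong:
  assumes "finite I" "\<And>A. A \<subseteq> I \<Longrightarrow> f A = g A"
  shows "expect I p f = expect I p g"
  using assms set_pmf_random_subset[of I p]
  by (intro integral_cong_AE) (auto simp: AE_measure_pmf_iff)

lemma expect_mono:
  assumes "finite I" "\<And>A. A \<subseteq> I \<Longrightarrow> f A \<le> g A"
  shows "expect I p f \<le> expect I p g"
  using assms set_pmf_random_subset[of I p]
  by (intro integral_mono_AE integrable_random_subset) (auto simp: AE_measure_pmf_iff)

lemma expect_insert:
  assumes "finite I" "e \<notin> I" "0 \<le> p" "p \<le> 1"
  shows "expect (insert e I) p f = p * expect I p (\<lambda>A. f (insert e A)) + (1 - p) * expect I p f"
proof -
  have "random_subset (insert e I) p =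
        bernoulli_pmf p \<bind> (\<lambda>b. map_pmf (\<lambda>A. if b then insert e A else A) (random_subset I p))"
    unfolding random_subset_def
    apply (subst Pi_pmf_insert'[OF assms(1,2)])
    apply (simp add: map_bind_pmf pmf.map_comp o_def flip: map_pmf_def)
    apply (intro bind_pmf_cong refl map_pmf_cong)
    using assms(2) apply auto
    done
  then have "expect (insert e I) p f = measure_pmf.expectation
      (bernoulli_pmf p \<bind> (\<lambda>b. map_pmf (\<lambda>A. if b then insert e A else A) (random_subset I p))) f"
    by simp
  also have "\<dots> = measure_pmf.expectation (bernoulli_pmf p)
      (\<lambda>b. expect I p (\<lambda>A. f (if b then insert e A else A)))"
    by (subst pmf_expectation_bind[where A = UNIV])
       (auto simp: finite_set_pmf_random_subset assms integral_measure_pmf_real[where A = UNIV] mult.commute)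
  also have "\<dots> = p * expect I p (\<lambda>A. f (insert e A)) + (1 - p) * expect I p f"
    using assms by (simp add: integral_bernoulli_pmf)
  finally show ?thesis .
qed

lemma expect_split:
  assumes "finite I" "e \<in> I" "0 \<le> p" "p \<le> 1"
  shows "expect I p f = p * expect I p (\<lambda>A. f (insert e A)) + (1 - p) * expect I p (\<lambda>A. f (A - {e}))"
proof -
  define J where "J = I - {e}"
  have J: "I = insert e J" "e \<notin> J" "finite J" using assms by (auto simp: J_def)
  have 1: "expect J p (\<lambda>A. f (A - {e})) = expect J p f"
    using J by (intro expect_cong) (auto intro!: arg_cong[where f = f])
  show ?thesis
    unfolding J(1)
    by (subst (1 2 3) expect_insert[OF J(3,2) assms(3,4)]) (use 1 in \<open>simp add: expect_insert[OF J(3,2) assms(3,4)] algebra_simps\<close>)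
qed

locale random_subsets =
  fixes I :: "'a set" and p :: real
  assumes fin: "finite I" and p: "0 < p" "p < 1"
begin

abbreviation E :: "('a set \<Rightarrow> real) \<Rightarrow> real" where "E \<equiv> expect I p"

definition y :: "'a \<Rightarrow> 'a set \<Rightarrow> real" where "y e A = of_bool (e \<in> A) - p"

lemmas integrable_any [simp] = integrable_random_subset[OF fin]

lemma E_add: "E (\<lambda>A. f A + g A) = E f + E g" by simp
lemma E_diff: "E (\<lambda>A. f A - g A) = E f - E g" by simp
lemma E_cmult: "E (\<lambda>A. c * f A) = c * E f" by simp
lemma E_const: "E (\<lambda>A. c) = c" by simp
lemma E_sum: "E (\<lambda>A. \<Sum>i\<in>S. f i A) = (\<Sum>i\<in>S. E (f i))" by (simp add: Bochner_Integration.integral_sum)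

lemmas E_cong = expect_cong[OF fin]
lemmas E_mono = expect_mono[OF fin]

lemma E_nonneg: "(\<And>A. A \<subseteq> I \<Longrightarrow> 0 \<le> f A) \<Longrightarrow> 0 \<le> E f"
  using E_mono[of "\<lambda>_. 0" f] by simp

lemma abs_E_le: "\<bar>E f\<bar> \<le> E (\<lambda>A. \<bar>f A\<bar>)"
  using integral_abs_bound[of "random_subset I p" f] by simp

lemma E_le_const: "(\<And>A. A \<subseteq> I \<Longrightarrow> f A \<le> c) \<Longrightarrow> E f \<le> c"
  using E_mono[of f "\<lambda>_. c"] by simp

lemma E_split: "e \<in> I \<Longrightarrow> E f = p * E (\<lambda>A. f (insert e A)) + (1 - p) * E (\<lambda>A. f (A - {e}))"
  using expect_split[OF fin, of e p f] p by simp

text \<open>Integration by parts in one Bernoulli coordinate: with the others fixed, the covariance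
  of the indicator with \<open>f\<close> is the variance \<open>p * (1 - p)\<close> times the
  increment of \<open>f\<close>.\<close>

lemma E_y_mult: "e \<in> I \<Longrightarrow> E (\<lambda>A. y e A * f A) = p * (1 - p) * E (dd e f)"
  unfolding dd_def[abs_def] E_diff by (subst E_split[of e]) (simp_all add: y_def algebra_simps)

lemma E_y: "e \<in> I \<Longrightarrow> E (y e) = 0"
  using E_y_mult[of e "\<lambda>_. 1"] by (simp add: dd_const[abs_def])

lemma dd_y_same: "dd e (y e) A = 1"
  by (simp add: dd_def y_def)

lemma indep_of_y: "e \<noteq> f \<Longrightarrow> indep_of e (y f)"
  unfolding y_def[abs_def] by (rule indep_of_member)

lemma dd_y_other: "e \<noteq> f \<Longrightarrow> dd e (y f) A = 0"
  using indep_of_y by (auto simp: indep_of_def)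

lemma abs_y_le: "\<bar>y e A\<bar> \<le> 1"
  using p by (simp add: y_def)

lemma E_abs_y_mult:
  assumes "e \<in> I" "indep_of e f"
  shows "E (\<lambda>A. \<bar>y e A\<bar> * f A) = 2 * p * (1 - p) * E f"
  using p assms by (subst E_split[of e]) (simp_all add: y_def indep_of_insert indep_of_remove)

lemma E_Cauchy_Schwarz: "(E (\<lambda>A. f A * g A))\<^sup>2 \<le> E (\<lambda>A. (f A)\<^sup>2) * E (\<lambda>A. (g A)\<^sup>2)"
proof -
  let ?a = "E (\<lambda>A. (f A)\<^sup>2)" and ?b = "E (\<lambda>A. (g A)\<^sup>2)" and ?c = "E (\<lambda>A. f A * g A)"
  have *: "0 \<le> ?a - 2 * t * ?c + t\<^sup>2 * ?b" for t
  proof -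
    have "0 \<le> E (\<lambda>A. (f A - t * g A)\<^sup>2)" by (intro E_nonneg) simp
    also have "(\<lambda>A. (f A - t * g A)\<^sup>2) = (\<lambda>A. (f A)\<^sup>2 - 2 * t * (f A * g A) + t\<^sup>2 * (g A)\<^sup>2)"
      by (auto simp: power2_eq_square algebra_simps)
    finally show ?thesis by simp
  qed
  have "0 \<le> ?b" by (intro E_nonneg) simp
  show ?thesis
  proof (cases "?b = 0")
    case True
    have "?c = 0"
    proof (rule ccontr)
      assume "?c \<noteq> 0"
      \<comment> \<open>This \<open>t\<close> would turn the linear expression
        \<open>?a - 2 * t * ?c\<close> into \<open>- 1\<close>.\<close>
      then show False using *[of "(?a + 1) / (2 * ?c)"] True by (simp add: field_simps)
    qed
    then show ?thesis using True by simp
  next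
    case False
    then have "0 < ?b" using \<open>0 \<le> ?b\<close> by (metis less_eq_real_def)
    then have "?a - 2 * (?c / ?b) * ?c + (?c / ?b)\<^sup>2 * ?b = (?a * ?b - ?c\<^sup>2) / ?b"
      by (simp add: field_simps power2_eq_square)
    then have "0 \<le> (?a * ?b - ?c\<^sup>2) / ?b" using *[of "?c / ?b"] by simp
    then show ?thesis using \<open>0 < ?b\<close> by (simp add: zero_le_divide_iff)
  qed
qed

lemma E_abs_le_sqrt: "E (\<lambda>A. \<bar>f A\<bar>) \<le> sqrt (E (\<lambda>A. (f A)\<^sup>2))"
  using E_Cauchy_Schwarz[of "\<lambda>A. \<bar>f A\<bar>" "\<lambda>_. 1"] by (intro real_le_rsqrt) simp

end

text \<open>Induction over the coordinates. Averaging \<open>f\<close> over the new coordinate gives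
  \<open>h\<close>, and the variance splits into the mean conditional variance, which equals
  \<open>p * (1 - p)\<close> times the mean squared derivative in direction \<open>e\<close>, and
  the variance of \<open>h\<close>.\<close>

theorem efron_stein:
  assumes "finite I" "0 \<le> p" "p \<le> 1"
  shows "expect I p (\<lambda>A. (f A)\<^sup>2) - (expect I p f)\<^sup>2 \<le> p * (1 - p) * (\<Sum>e\<in>I. expect I p (\<lambda>A. (dd e f A)\<^sup>2))"
  using assms(1)
proof (induction I arbitrary: f rule: finite_induct)
  case empty
  then show ?case by (simp add: random_subset_def)
next
  case (insert e I)
  note ins = expect_insert[OF insert(1,2) assms(2,3)]
  note [simp] = integrable_random_subset[OF insert(1)]
  note pq = assms(2,3)
  define f1 where "f1 A = f (insert e A)" for A
  define h where "h A = p * f1 A + (1 - p) * f A" for A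
  have e1: "expect I p h = p * expect I p f1 + (1 - p) * expect I p f"
    unfolding h_def by simp
  have "expect I p (\<lambda>A. (h A)\<^sup>2 + p * (1 - p) * (f1 A - f A)\<^sup>2)
      = expect I p (\<lambda>A. p * (f1 A)\<^sup>2 + (1 - p) * (f A)\<^sup>2)"
    by (intro arg_cong[where f = "expect I p"]) (auto simp: h_def power2_eq_square algebra_simps)
  then have e2: "expect I p (\<lambda>A. (h A)\<^sup>2) + p * (1 - p) * expect I p (\<lambda>A. (f1 A - f A)\<^sup>2)
      = p * expect I p (\<lambda>A. (f1 A)\<^sup>2) + (1 - p) * expect I p (\<lambda>A. (f A)\<^sup>2)"
    by simp
  have rem: "A - {e} = A" if "A \<subseteq> I" for A using insert(2) that by auto
  have e3: "expect (insert e I) p (\<lambda>A. (dd e f A)\<^sup>2) = expect I p (\<lambda>A. (f1 A - f A)\<^sup>2)"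
  proof -
    have "expect I p (\<lambda>A. (dd e f A)\<^sup>2) = expect I p (\<lambda>A. (f1 A - f A)\<^sup>2)"
      "expect I p (\<lambda>A. (dd e f (insert e A))\<^sup>2) = expect I p (\<lambda>A. (f1 A - f A)\<^sup>2)"
      using rem by (auto intro!: expect_cong insert simp: dd_def f1_def)
    then show ?thesis by (simp add: ins algebra_simps)
  qed
  \<comment> \<open>Jensen: a derivative of the average \<open>h\<close> is the average of the
    derivatives; the defect in the inequality is the variance of the two averaged values.\<close>
  have e4: "expect I p (\<lambda>A. (dd g h A)\<^sup>2) \<le> expect (insert e I) p (\<lambda>A. (dd g f A)\<^sup>2)" if "g \<in> I" for g
  proof -
    have "g \<noteq> e" using that insert(2) by auto
    then have *: "dd g f (insert e A) = dd g f1 A" for A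
      by (simp add: dd_def f1_def insert_commute insert_remove_commute)
    have "(dd g h A)\<^sup>2 \<le> p * (dd g f1 A)\<^sup>2 + (1 - p) * (dd g f A)\<^sup>2" for A
    proof -
      have "p * (dd g f1 A)\<^sup>2 + (1 - p) * (dd g f A)\<^sup>2 - (dd g h A)\<^sup>2
          = p * (1 - p) * (dd g f1 A - dd g f A)\<^sup>2"
        unfolding h_def dd_def by (simp add: power2_eq_square algebra_simps)
      also have "\<dots> \<ge> 0" using pq by simp
      finally show ?thesis by simp
    qed
    then have "expect I p (\<lambda>A. (dd g h A)\<^sup>2)
        \<le> expect I p (\<lambda>A. p * (dd g f1 A)\<^sup>2 + (1 - p) * (dd g f A)\<^sup>2)"
      by (intro expect_mono insert(1))
    then show ?thesis by (simp add: ins *)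
  qed
  have "expect (insert e I) p (\<lambda>A. (f A)\<^sup>2) - (expect (insert e I) p f)\<^sup>2
      = p * (1 - p) * expect I p (\<lambda>A. (f1 A - f A)\<^sup>2) + (expect I p (\<lambda>A. (h A)\<^sup>2) - (expect I p h)\<^sup>2)"
    using e2 by (simp add: ins e1 flip: f1_def)
  also have "\<dots> \<le> p * (1 - p) * expect I p (\<lambda>A. (f1 A - f A)\<^sup>2)
      + p * (1 - p) * (\<Sum>g\<in>I. expect I p (\<lambda>A. (dd g h A)\<^sup>2))"
    using insert(3)[of h] by simp
  also have "\<dots> \<le> p * (1 - p) * expect I p (\<lambda>A. (f1 A - f A)\<^sup>2)
      + p * (1 - p) * (\<Sum>g\<in>I. expect (insert e I) p (\<lambda>A. (dd g f A)\<^sup>2))"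
    using e4 pq by (intro add_left_mono mult_left_mono sum_mono) auto
  finally show ?case using insert(1,2) by (simp add: e3 algebra_simps)
qed

section \<open>Variance and normal approximation for functions of random subsets\<close>

context random_subsets
begin

definition Var :: "('a set \<Rightarrow> real) \<Rightarrow> real" where
  "Var f = E (\<lambda>A. (f A)\<^sup>2) - (E f)\<^sup>2"

lemma Var_eq: "Var f = E (\<lambda>A. (f A - E f)\<^sup>2)"
proof -
  have "(\<lambda>A. (f A - E f)\<^sup>2) = (\<lambda>A. (f A)\<^sup>2 - 2 * E f * f A + (E f)\<^sup>2)"
    by (auto simp: power2_eq_square algebra_simps)
  then show ?thesis by (simp add: Var_def power2_eq_square)
qed

lemma Var_le: "Var f \<le> p * (1 - p) * (\<Sum>e\<in>I. E (\<lambda>A. (dd e f A)\<^sup>2))"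
  unfolding Var_def using efron_stein[OF fin, of p f] p by simp

lemma E_square_le:
  "E (\<lambda>A. (f A)\<^sup>2) \<le> (E f)\<^sup>2 + p * (1 - p) * (\<Sum>e\<in>I. E (\<lambda>A. (dd e f A)\<^sup>2))"
  using Var_le[of f] by (simp add: Var_def)

text \<open>A discrete isometry for divergences. An off-diagonal term is integrated by parts in
  \<open>e\<close> and then in \<open>f\<close>; each time the factor that is independent of the
  coordinate passes through the derivative, which leaves the product of crossed derivatives.\<close>

lemma E_square_sum_y:
  assumes "\<And>e. e \<in> I \<Longrightarrow> indep_of e (g e)"
  shows "E (\<lambda>A. (\<Sum>e\<in>I. y e A * g e A)\<^sup>2)
       = p * (1 - p) * (\<Sum>e\<in>I. E (\<lambda>A. (g e A)\<^sup>2))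
         + (p * (1 - p))\<^sup>2 * (\<Sum>e\<in>I. \<Sum>f\<in>I - {e}. E (\<lambda>A. dd f (g e) A * dd e (g f) A))"
proof -
  have diag: "E (\<lambda>A. y e A * g e A * (y e A * g e A)) = p * (1 - p) * E (\<lambda>A. (g e A)\<^sup>2)" if "e \<in> I" for e
    using p that assms[OF that]
    by (subst (1 2) E_split[of e])
       (simp_all add: y_def indep_of_insert indep_of_remove algebra_simps power2_eq_square)
  have off: "E (\<lambda>A. y e A * g e A * (y f A * g f A))
      = (p * (1 - p))\<^sup>2 * E (\<lambda>A. dd f (g e) A * dd e (g f) A)" if "e \<in> I" "f \<in> I - {e}" for e f
  proof -
    have "e \<noteq> f" "f \<in> I" using that by auto
    have "E (\<lambda>A. y e A * g e A * (y f A * g f A)) = E (\<lambda>A. y e A * (g e A * (y f A * g f A)))"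
      by (simp add: mult.assoc)
    also have "\<dots> = p * (1 - p) * E (dd e (\<lambda>A. g e A * (y f A * g f A)))"
      using that by (subst E_y_mult) auto
    also have "dd e (\<lambda>A. g e A * (y f A * g f A)) = (\<lambda>A. y f A * (g e A * dd e (g f) A))"
      using assms[OF that(1)] indep_of_y[OF \<open>e \<noteq> f\<close>] by (auto simp: dd_mult_indep)
    also have "E \<dots> = p * (1 - p) * E (dd f (\<lambda>A. g e A * dd e (g f) A))"
      using \<open>f \<in> I\<close> by (subst E_y_mult) auto
    also have "dd f (\<lambda>A. g e A * dd e (g f) A) = (\<lambda>A. dd f (g e) A * dd e (g f) A)"
      using dd_mult_indep[OF indep_of_dd_other[OF assms[OF \<open>f \<in> I\<close>]], of e "g e"]
      by (auto simp: mult.commute)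
    finally show ?thesis by (simp add: power2_eq_square)
  qed
  have "E (\<lambda>A. (\<Sum>e\<in>I. y e A * g e A)\<^sup>2)
      = (\<Sum>e\<in>I. \<Sum>f\<in>I. E (\<lambda>A. y e A * g e A * (y f A * g f A)))"
    by (simp only: power2_eq_square sum_product E_sum)
  also have "\<dots> = (\<Sum>e\<in>I. p * (1 - p) * E (\<lambda>A. (g e A)\<^sup>2)
       + (\<Sum>f\<in>I - {e}. (p * (1 - p))\<^sup>2 * E (\<lambda>A. dd f (g e) A * dd e (g f) A)))"
    using fin diag off by (intro sum.cong refl) (simp add: sum.remove)
  finally show ?thesis by (simp add: sum.distrib sum_distrib_left)
qed

text \<open>The three terms measure how far the kernel \<open>\<Sum> h_e D_e W\<close> is from being
  1 after scaling, the failure of the chain rule for discrete derivatives of \<open>f(W)\<close>,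
  and the distance of \<open>W\<close> from a divergence. The chain rule remainder is bounded by
  \<open>D_e W * D_e U\<close> with \<open>U = w f(w) - 1{w \<le> z}\<close>, a quantity that can be
  integrated by parts backwards; this produces \<open>\<Sum> y_e D_e W\<close> against the bounded
  function \<open>U\<close>.\<close>

theorem normal_approximation:
  assumes h: "\<And>e. e \<in> I \<Longrightarrow> indep_of e (h e)" "\<And>e A. e \<in> I \<Longrightarrow> A \<subseteq> I \<Longrightarrow> \<bar>h e A\<bar> \<le> H" and "0 \<le> H"
  shows "\<bar>E (\<lambda>A. of_bool (W A \<le> z)) - Phi z\<bar>
    \<le> 2 * E (\<lambda>A. \<bar>1 - p * (1 - p) * (\<Sum>e\<in>I. h e A * dd e W A)\<bar>)
      + 2 * H * E (\<lambda>A. \<bar>\<Sum>e\<in>I. y e A * dd e W A\<bar>)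
      + 5 * E (\<lambda>A. \<bar>(\<Sum>e\<in>I. y e A * h e A) - W A\<bar>)"
proof -
  let ?f = "\<lambda>A. stein_sol z (W A)" and ?d = "\<lambda>A. stein_deriv z (W A)"
  let ?U = "\<lambda>A. W A * stein_sol z (W A) - of_bool (W A \<le> z)"
  let ?G = "\<lambda>A. \<Sum>e\<in>I. y e A * h e A" and ?L = "\<lambda>A. p * (1 - p) * (\<Sum>e\<in>I. h e A * dd e W A)"
  let ?r = "\<lambda>e A. h e A * (dd e W A * ?d A - dd e ?f A)"
  have EG: "E (\<lambda>A. ?G A * ?f A) = (\<Sum>e\<in>I. p * (1 - p) * E (\<lambda>A. h e A * dd e ?f A))"
  proof -
    have "E (\<lambda>A. ?G A * ?f A) = (\<Sum>e\<in>I. E (\<lambda>A. y e A * (h e A * ?f A)))"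
      by (simp only: sum_distrib_right E_sum mult.assoc)
    also have "\<dots> = (\<Sum>e\<in>I. p * (1 - p) * E (\<lambda>A. h e A * dd e ?f A))"
      by (intro sum.cong refl, subst E_y_mult) (auto simp: dd_mult_indep[OF h(1)] cong: Bochner_Integration.integral_cong)
    finally show ?thesis .
  qed
  have EL: "E (\<lambda>A. ?d A * ?L A) = (\<Sum>e\<in>I. p * (1 - p) * E (\<lambda>A. h e A * (dd e W A * ?d A)))"
  proof -
    have "(\<lambda>A. ?d A * ?L A) = (\<lambda>A. \<Sum>e\<in>I. p * (1 - p) * (h e A * (dd e W A * ?d A)))"
      by (auto simp: sum_distrib_left mult_ac)
    then show ?thesis by (simp only: E_sum E_cmult)
  qed
  have "E (\<lambda>A. of_bool (W A \<le> z)) - Phi z = E (\<lambda>A. of_bool (W A \<le> z) - Phi z)"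
    by simp
  \<comment> \<open>The terms with \<open>?L\<close> and \<open>?G\<close> cancel, and what remains,
    \<open>?d - W * ?f\<close>, is given by Stein's equation.\<close>
  also have "\<dots> = E (\<lambda>A. ?d A * (1 - ?L A) + (?d A * ?L A - ?G A * ?f A) + (?G A - W A) * ?f A)"
    by (intro E_cong) (simp add: stein_deriv_def algebra_simps)
  also have "\<dots> = E (\<lambda>A. ?d A * (1 - ?L A)) + (E (\<lambda>A. ?d A * ?L A) - E (\<lambda>A. ?G A * ?f A))
      + E (\<lambda>A. (?G A - W A) * ?f A)"
    by (simp only: E_add E_diff)
  finally have eq: "E (\<lambda>A. of_bool (W A \<le> z)) - Phi z = \<dots>" .
  have b1: "\<bar>E (\<lambda>A. ?d A * (1 - ?L A))\<bar> \<le> 2 * E (\<lambda>A. \<bar>1 - ?L A\<bar>)"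
  proof -
    have "\<bar>E (\<lambda>A. ?d A * (1 - ?L A))\<bar> \<le> E (\<lambda>A. \<bar>?d A * (1 - ?L A)\<bar>)" by (rule abs_E_le)
    also have "\<dots> \<le> E (\<lambda>A. 2 * \<bar>1 - ?L A\<bar>)"
      unfolding abs_mult by (intro E_mono mult_right_mono abs_stein_deriv) simp
    finally show ?thesis by (simp only: E_cmult)
  qed
  have b3: "\<bar>E (\<lambda>A. (?G A - W A) * ?f A)\<bar> \<le> 5 * E (\<lambda>A. \<bar>?G A - W A\<bar>)"
  proof -
    have "\<bar>E (\<lambda>A. (?G A - W A) * ?f A)\<bar> \<le> E (\<lambda>A. \<bar>(?G A - W A) * ?f A\<bar>)" by (rule abs_E_le)
    also have "\<dots> \<le> E (\<lambda>A. \<bar>?G A - W A\<bar> * 5)"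
      unfolding abs_mult by (intro E_mono mult_left_mono abs_stein_sol) simp
    finally show ?thesis by (simp add: mult.commute)
  qed
  have b2: "\<bar>E (\<lambda>A. ?d A * ?L A) - E (\<lambda>A. ?G A * ?f A)\<bar> \<le> 2 * H * E (\<lambda>A. \<bar>\<Sum>e\<in>I. y e A * dd e W A\<bar>)"
  proof -
    have "\<bar>E (\<lambda>A. ?d A * ?L A) - E (\<lambda>A. ?G A * ?f A)\<bar> = \<bar>\<Sum>e\<in>I. p * (1 - p) * E (?r e)\<bar>"
      unfolding EG EL sum_subtractf[symmetric]
      by (intro arg_cong[where f = abs] sum.cong refl) (simp add: right_diff_distrib[of "h _ _"] right_diff_distrib[of "p * (1 - p)"])
    also have "\<dots> \<le> (\<Sum>e\<in>I. p * (1 - p) * E (\<lambda>A. H * (dd e W A * dd e ?U A)))"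
    proof (rule order.trans[OF sum_abs sum_mono])
      fix e assume e: "e \<in> I"
      have "\<bar>E (?r e)\<bar> \<le> E (\<lambda>A. \<bar>?r e A\<bar>)" by (rule abs_E_le)
      also have "\<dots> \<le> E (\<lambda>A. H * (dd e W A * dd e ?U A))"
      proof (rule E_mono)
        fix A assume "A \<subseteq> I"
        \<comment> \<open>The current value of \<open>W\<close> is one of the two ends of the
          increment, whichever holds for \<open>e\<close>; this is why
          \<open>stein_sol_increment\<close> allows \<open>s\<close> to be either end.\<close>
        have "W A = W (A - {e}) \<or> W A = W (insert e A)"
          by (cases "e \<in> A") (auto simp: insert_absorb)
        from stein_sol_increment[OF this, of z]
        have "\<bar>dd e W A * ?d A - dd e ?f A\<bar> \<le> dd e W A * dd e ?U A"
          by (simp add: dd_def abs_minus_commute)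
        with h(2)[OF e \<open>A \<subseteq> I\<close>] \<open>0 \<le> H\<close> show "\<bar>?r e A\<bar> \<le> H * (dd e W A * dd e ?U A)"
          unfolding abs_mult by (intro mult_mono) auto
      qed
      finally show "\<bar>p * (1 - p) * E (?r e)\<bar> \<le> p * (1 - p) * E (\<lambda>A. H * (dd e W A * dd e ?U A))"
        using p by (simp only: abs_mult abs_of_pos) (simp add: mult_left_mono)
    qed
    \<comment> \<open>Integration by parts in reverse: since \<open>dd e W\<close> is independent of
      \<open>e\<close>, its product with \<open>dd e ?U\<close> is the derivative of the product
      with \<open>?U\<close>.\<close>
    also have "\<dots> = H * (\<Sum>e\<in>I. E (\<lambda>A. y e A * (dd e W A * ?U A)))"
      unfolding sum_distrib_left
      by (intro sum.cong refl, subst E_y_mult) (auto simp: dd_mult_indep[OF indep_of_dd] cong: Bochner_Integration.integral_cong)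
    also have "\<dots> = H * E (\<lambda>A. (\<Sum>e\<in>I. y e A * dd e W A) * ?U A)"
      by (simp only: E_sum[symmetric] sum_distrib_right mult.assoc)
    also have "\<dots> \<le> H * E (\<lambda>A. \<bar>\<Sum>e\<in>I. y e A * dd e W A\<bar> * 2)"
    proof (intro mult_left_mono E_mono \<open>0 \<le> H\<close>)
      fix A
      have "\<bar>?U A\<bar> \<le> 2" using abs_mult_stein_sol[of "W A" z] by (auto simp: of_bool_def)
      then show "(\<Sum>e\<in>I. y e A * dd e W A) * ?U A \<le> \<bar>\<Sum>e\<in>I. y e A * dd e W A\<bar> * 2"
        using abs_le_D1[OF order.refl, of "(\<Sum>e\<in>I. y e A * dd e W A) * ?U A"]
        unfolding abs_mult by (meson abs_ge_zero mult_left_mono order.trans)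
    qed
    finally show ?thesis by (simp add: mult_ac)
  qed
  show ?thesis using b1 b2 b3 eq by linarith
qed

end

context random_subsets
begin

text \<open>Adapted to a statistic whose standard deviation is at least of order
  \<open>r ^ 3\<close>: every hypothesis has the order for which its contribution becomes
  \<open>1 / r\<close>. The statistic is split because only \<open>U\<close> has a kernel whose
  variance is controlled; for the smaller \<open>Z\<close> absolute first moments of the derivatives
  are used.\<close>

theorem normal_approximation_split:
  fixes K U Z :: "'a set \<Rightarrow> real" and \<eta> :: "'a \<Rightarrow> 'a set \<Rightarrow> real" and c C r :: real
  defines "\<mu> \<equiv> E K" and "\<sigma> \<equiv> sqrt (Var K)"
  assumes K: "\<And>A. K A = U A + Z A"
    and \<eta>: "\<And>e. e \<in> I \<Longrightarrow> indep_of e (\<eta> e)" "\<And>e A. e \<in> I \<Longrightarrow> A \<subseteq> I \<Longrightarrow> \<bar>\<eta> e A\<bar> \<le> C * r\<^sup>2"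
    and pos: "0 < c" "0 < C" "0 < r"
    and var: "c * r ^ 6 \<le> Var K"
    and quad: "Var (\<lambda>A. p * (1 - p) * (\<Sum>e\<in>I. \<eta> e A * dd e U A)) \<le> (C * r ^ 5)\<^sup>2"
    and lin: "E (\<lambda>A. (\<Sum>e\<in>I. y e A * dd e U A)\<^sup>2) \<le> (C * r ^ 3)\<^sup>2"
    and res: "E (\<lambda>A. ((\<Sum>e\<in>I. y e A * \<eta> e A) - (K A - \<mu>))\<^sup>2) \<le> (C * r\<^sup>2)\<^sup>2"
    and small: "p * (\<Sum>e\<in>I. E (\<lambda>A. \<bar>dd e Z A\<bar>)) \<le> C * r ^ 3"
  shows "\<bar>E (\<lambda>A. of_bool ((K A - \<mu>) / \<sigma> \<le> z)) - Phi z\<bar>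
         \<le> ((2 * C + 10 * C\<^sup>2) / c + 7 * C / sqrt c) / r"
proof -
  let ?R = "\<lambda>A. (\<Sum>e\<in>I. y e A * \<eta> e A) - (K A - \<mu>)"
  let ?\<Gamma>U = "\<lambda>A. p * (1 - p) * (\<Sum>e\<in>I. \<eta> e A * dd e U A)"
  let ?\<Gamma>Z = "\<lambda>A. p * (1 - p) * (\<Sum>e\<in>I. \<eta> e A * dd e Z A)"
  let ?D = "\<Sum>e\<in>I. E (\<lambda>A. \<bar>dd e Z A\<bar>)"
  have \<sigma>2: "\<sigma>\<^sup>2 = Var K" using var pos unfolding \<sigma>_def
    by (intro real_sqrt_pow2) (smt (verit) mult_pos_pos zero_less_power)
  have \<sigma>ge: "sqrt c * r ^ 3 \<le> \<sigma>"
    unfolding \<sigma>_def using var pos by (intro real_le_rsqrt) (simp add: power_mult_distrib)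
  then have \<sigma>0: "0 < \<sigma>" using pos by (smt (verit) mult_pos_pos real_sqrt_gt_zero zero_less_power)
  have \<sigma>2ge: "c * r ^ 6 \<le> \<sigma>\<^sup>2" using var \<sigma>2 by simp
  have ddK: "dd e K A = dd e U A + dd e Z A" for e A
    by (simp add: dd_def K)
  have ddW: "dd e (\<lambda>A. (K A - \<mu>) / \<sigma>) A = dd e K A / \<sigma>" for e A
    by (simp add: dd_def diff_divide_distrib)
  have D0: "0 \<le> ?D" by (intro sum_nonneg E_nonneg) simp
  have ER: "E (\<lambda>A. \<bar>?R A\<bar>) \<le> C * r\<^sup>2"
    using E_abs_le_sqrt[of ?R] real_sqrt_le_mono[OF res] pos by simp

  have first: "E (\<lambda>A. \<bar>\<sigma>\<^sup>2 - (?\<Gamma>U A + ?\<Gamma>Z A)\<bar>) \<le> \<sigma> * (C * r\<^sup>2) + C * r ^ 5 + 2 * C\<^sup>2 * r ^ 5"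
  proof -
    have EZ: "E (\<lambda>A. \<bar>?\<Gamma>Z A\<bar>) \<le> C\<^sup>2 * r ^ 5"
    proof -
      have "E (\<lambda>A. \<bar>?\<Gamma>Z A\<bar>) \<le> E (\<lambda>A. p * (C * r\<^sup>2 * (\<Sum>e\<in>I. \<bar>dd e Z A\<bar>)))"
      proof (rule E_mono)
        fix A assume "A \<subseteq> I"
        have "\<bar>?\<Gamma>Z A\<bar> = p * (1 - p) * \<bar>\<Sum>e\<in>I. \<eta> e A * dd e Z A\<bar>"
          using p by (simp add: abs_mult)
        also have "\<dots> \<le> p * \<bar>\<Sum>e\<in>I. \<eta> e A * dd e Z A\<bar>"
          using p by (intro mult_right_mono) (auto simp: mult_le_cancel_left1)
        also have "\<dots> \<le> p * (\<Sum>e\<in>I. C * r\<^sup>2 * \<bar>dd e Z A\<bar>)"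
          using p \<eta>(2) \<open>A \<subseteq> I\<close>
          by (intro mult_left_mono order.trans[OF sum_abs] sum_mono) (auto simp: abs_mult intro!: mult_right_mono)
        finally show "\<bar>?\<Gamma>Z A\<bar> \<le> p * (C * r\<^sup>2 * (\<Sum>e\<in>I. \<bar>dd e Z A\<bar>))"
          by (simp add: sum_distrib_left)
      qed
      also have "\<dots> = C * r\<^sup>2 * (p * ?D)" by (simp only: E_cmult E_sum mult_ac)
      also have "\<dots> \<le> C * r\<^sup>2 * (C * r ^ 3)" using pos by (intro mult_left_mono small) auto
      also have "\<dots> = C\<^sup>2 * r ^ 5" by (simp add: power2_eq_square power_numeral_reduce)
      finally show ?thesis .
    qed
    \<comment> \<open>Integration by parts shows that the mean of the kernel is the covariance of
      the divergence with \<open>K\<close>, hence the variance of \<open>K\<close> plus the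
      covariance of the residual \<open>?R\<close> with \<open>K\<close>; the latter is bounded by
      Cauchy-Schwarz.\<close>
    have mean: "\<bar>\<sigma>\<^sup>2 - (E ?\<Gamma>U + E ?\<Gamma>Z)\<bar> \<le> \<sigma> * (C * r\<^sup>2)"
    proof -
      have "E ?\<Gamma>U + E ?\<Gamma>Z = E (\<lambda>A. \<Sum>e\<in>I. p * (1 - p) * (\<eta> e A * dd e K A))"
        unfolding E_add[symmetric]
        by (intro E_cong) (simp add: ddK sum.distrib sum_distrib_left distrib_left)
      also have "\<dots> = (\<Sum>e\<in>I. p * (1 - p) * E (\<lambda>A. \<eta> e A * dd e K A))"
        by (simp only: E_sum E_cmult)
      also have "\<dots> = (\<Sum>e\<in>I. E (\<lambda>A. y e A * (\<eta> e A * (K A - \<mu>))))"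
      proof (intro sum.cong refl)
        fix e assume e: "e \<in> I"
        have "dd e (\<lambda>A. \<eta> e A * (K A - \<mu>)) = (\<lambda>A. \<eta> e A * dd e K A)"
          using dd_mult_indep[OF \<eta>(1)[OF e], of "\<lambda>A. K A - \<mu>"] by (auto simp: dd_diff dd_const)
        then show "p * (1 - p) * E (\<lambda>A. \<eta> e A * dd e K A) = E (\<lambda>A. y e A * (\<eta> e A * (K A - \<mu>)))"
          using e by (simp add: E_y_mult)
      qed
      also have "\<dots> = E (\<lambda>A. (\<Sum>e\<in>I. y e A * \<eta> e A) * (K A - \<mu>))"
        by (simp only: E_sum[symmetric] sum_distrib_right mult.assoc)
      also have "\<dots> = E (\<lambda>A. (K A - \<mu>)\<^sup>2 + ?R A * (K A - \<mu>))"
        by (intro E_cong) (simp add: power2_eq_square algebra_simps)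
      also have "\<dots> = \<sigma>\<^sup>2 + E (\<lambda>A. ?R A * (K A - \<mu>))"
        by (simp only: E_add \<sigma>2 Var_eq \<mu>_def)
      finally have "\<bar>\<sigma>\<^sup>2 - (E ?\<Gamma>U + E ?\<Gamma>Z)\<bar> = \<bar>E (\<lambda>A. ?R A * (K A - \<mu>))\<bar>" by simp
      also have "\<dots> \<le> \<sigma> * (C * r\<^sup>2)"
      proof (rule power2_le_imp_le)
        have "(E (\<lambda>A. ?R A * (K A - \<mu>)))\<^sup>2 \<le> E (\<lambda>A. (?R A)\<^sup>2) * E (\<lambda>A. (K A - \<mu>)\<^sup>2)"
          by (rule E_Cauchy_Schwarz)
        also have "\<dots> \<le> (C * r\<^sup>2)\<^sup>2 * \<sigma>\<^sup>2"
          using res by (simp only: \<sigma>2 Var_eq \<mu>_def) (intro mult_right_mono E_nonneg, auto)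
        finally show "\<bar>E (\<lambda>A. ?R A * (K A - \<mu>))\<bar>\<^sup>2 \<le> (\<sigma> * (C * r\<^sup>2))\<^sup>2"
          by (simp add: power_mult_distrib mult.commute)
      qed (use pos \<sigma>0 in auto)
      finally show ?thesis .
    qed
    have cU: "E (\<lambda>A. \<bar>?\<Gamma>U A - E ?\<Gamma>U\<bar>) \<le> C * r ^ 5"
      using E_abs_le_sqrt[of "\<lambda>A. ?\<Gamma>U A - E ?\<Gamma>U"] real_sqrt_le_mono[OF quad[unfolded Var_eq]] pos
      by simp
    have "E (\<lambda>A. \<bar>\<sigma>\<^sup>2 - (?\<Gamma>U A + ?\<Gamma>Z A)\<bar>)
        \<le> E (\<lambda>A. \<bar>\<sigma>\<^sup>2 - (E ?\<Gamma>U + E ?\<Gamma>Z)\<bar> + \<bar>?\<Gamma>U A - E ?\<Gamma>U\<bar> + (\<bar>?\<Gamma>Z A\<bar> + \<bar>E ?\<Gamma>Z\<bar>))"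
      by (intro E_mono) linarith
    also have "\<dots> = \<bar>\<sigma>\<^sup>2 - (E ?\<Gamma>U + E ?\<Gamma>Z)\<bar> + E (\<lambda>A. \<bar>?\<Gamma>U A - E ?\<Gamma>U\<bar>) + (E (\<lambda>A. \<bar>?\<Gamma>Z A\<bar>) + \<bar>E ?\<Gamma>Z\<bar>)"
      by (simp only: E_add E_const)
    also have "\<dots> \<le> \<sigma> * (C * r\<^sup>2) + C * r ^ 5 + (C\<^sup>2 * r ^ 5 + C\<^sup>2 * r ^ 5)"
      using mean cU EZ order.trans[OF abs_E_le EZ] by (intro add_mono)
    finally show ?thesis by simp
  qed
  have second: "E (\<lambda>A. \<bar>\<Sum>e\<in>I. y e A * dd e K A\<bar>) \<le> 3 * C * r ^ 3"
  proof -
    have "E (\<lambda>A. \<bar>\<Sum>e\<in>I. y e A * dd e K A\<bar>)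
        \<le> E (\<lambda>A. \<bar>\<Sum>e\<in>I. y e A * dd e U A\<bar> + (\<Sum>e\<in>I. \<bar>y e A\<bar> * \<bar>dd e Z A\<bar>))"
    proof (rule E_mono)
      fix A
      have "\<bar>\<Sum>e\<in>I. y e A * dd e K A\<bar> \<le> \<bar>\<Sum>e\<in>I. y e A * dd e U A\<bar> + \<bar>\<Sum>e\<in>I. y e A * dd e Z A\<bar>"
        by (simp add: ddK distrib_left sum.distrib abs_triangle_ineq)
      also have "\<bar>\<Sum>e\<in>I. y e A * dd e Z A\<bar> \<le> (\<Sum>e\<in>I. \<bar>y e A\<bar> * \<bar>dd e Z A\<bar>)"
        using sum_abs[of "\<lambda>e. y e A * dd e Z A" I] by (simp add: abs_mult)
      finally show "\<bar>\<Sum>e\<in>I. y e A * dd e K A\<bar>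
          \<le> \<bar>\<Sum>e\<in>I. y e A * dd e U A\<bar> + (\<Sum>e\<in>I. \<bar>y e A\<bar> * \<bar>dd e Z A\<bar>)" by simp
    qed
    \<comment> \<open>For \<open>Z\<close> the cancellation between the signs of \<open>y e\<close>
      is given up: \<open>dd e Z\<close> is independent of \<open>e\<close>, and
      \<open>\<bar>y e\<bar>\<close> has mean \<open>2 * p * (1 - p)\<close>.\<close>
    also have "\<dots> = E (\<lambda>A. \<bar>\<Sum>e\<in>I. y e A * dd e U A\<bar>) + (\<Sum>e\<in>I. 2 * p * (1 - p) * E (\<lambda>A. \<bar>dd e Z A\<bar>))"
      unfolding E_add E_sum
      by (intro arg_cong2[where f = "(+)"] refl sum.cong E_abs_y_mult)
         (auto simp: indep_of_def dd_def)
    also have "\<dots> \<le> C * r ^ 3 + 2 * (p * ?D)"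
    proof (rule add_mono)
      show "E (\<lambda>A. \<bar>\<Sum>e\<in>I. y e A * dd e U A\<bar>) \<le> C * r ^ 3"
        using E_abs_le_sqrt[of "\<lambda>A. \<Sum>e\<in>I. y e A * dd e U A"] real_sqrt_le_mono[OF lin] pos by simp
      have "(\<Sum>e\<in>I. 2 * p * (1 - p) * E (\<lambda>A. \<bar>dd e Z A\<bar>)) = (1 - p) * (2 * (p * ?D))"
        by (simp only: sum_distrib_left mult_ac)
      also have "\<dots> \<le> 1 * (2 * (p * ?D))" using p D0 by (intro mult_right_mono) auto
      finally show "(\<Sum>e\<in>I. 2 * p * (1 - p) * E (\<lambda>A. \<bar>dd e Z A\<bar>)) \<le> 2 * (p * ?D)" by simp
    qed
    finally show ?thesis using small by linarith
  qed

  have "\<bar>E (\<lambda>A. of_bool ((K A - \<mu>) / \<sigma> \<le> z)) - Phi z\<bar>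
    \<le> 2 * E (\<lambda>A. \<bar>1 - p * (1 - p) * (\<Sum>e\<in>I. \<eta> e A / \<sigma> * dd e (\<lambda>A. (K A - \<mu>) / \<sigma>) A)\<bar>)
      + 2 * (C * r\<^sup>2 / \<sigma>) * E (\<lambda>A. \<bar>\<Sum>e\<in>I. y e A * dd e (\<lambda>A. (K A - \<mu>) / \<sigma>) A\<bar>)
      + 5 * E (\<lambda>A. \<bar>(\<Sum>e\<in>I. y e A * (\<eta> e A / \<sigma>)) - (K A - \<mu>) / \<sigma>\<bar>)"
  proof (rule normal_approximation)
    show "indep_of e (\<lambda>A. \<eta> e A / \<sigma>)" if "e \<in> I" for e
      using \<eta>(1)[OF that] by (simp add: indep_of_def dd_divide)
    show "\<bar>\<eta> e A / \<sigma>\<bar> \<le> C * r\<^sup>2 / \<sigma>" if "e \<in> I" "A \<subseteq> I" for e A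
      using \<eta>(2)[OF that] \<sigma>0 by (simp add: divide_right_mono)
  qed (use pos \<sigma>0 in auto)
  also have "(\<lambda>A. \<bar>1 - p * (1 - p) * (\<Sum>e\<in>I. \<eta> e A / \<sigma> * dd e (\<lambda>A. (K A - \<mu>) / \<sigma>) A)\<bar>)
      = (\<lambda>A. 1 / \<sigma>\<^sup>2 * \<bar>\<sigma>\<^sup>2 - (?\<Gamma>U A + ?\<Gamma>Z A)\<bar>)"
  proof
    fix A
    have "p * (1 - p) * (\<Sum>e\<in>I. \<eta> e A / \<sigma> * dd e (\<lambda>A. (K A - \<mu>) / \<sigma>) A) = (?\<Gamma>U A + ?\<Gamma>Z A) / \<sigma>\<^sup>2"
      by (simp add: ddW ddK sum.distrib sum_distrib_left sum_divide_distrib power2_eq_square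
          add_divide_distrib distrib_left)
    then have "1 - p * (1 - p) * (\<Sum>e\<in>I. \<eta> e A / \<sigma> * dd e (\<lambda>A. (K A - \<mu>) / \<sigma>) A)
        = 1 / \<sigma>\<^sup>2 * (\<sigma>\<^sup>2 - (?\<Gamma>U A + ?\<Gamma>Z A))"
      using \<sigma>0 by (simp only:) (simp add: field_simps)
    then show "\<bar>1 - p * (1 - p) * (\<Sum>e\<in>I. \<eta> e A / \<sigma> * dd e (\<lambda>A. (K A - \<mu>) / \<sigma>) A)\<bar>
        = 1 / \<sigma>\<^sup>2 * \<bar>\<sigma>\<^sup>2 - (?\<Gamma>U A + ?\<Gamma>Z A)\<bar>"
      by (simp only: abs_mult) simp
  qed
  also have "(\<lambda>A. \<bar>\<Sum>e\<in>I. y e A * dd e (\<lambda>A. (K A - \<mu>) / \<sigma>) A\<bar>) = (\<lambda>A. 1 / \<sigma> * \<bar>\<Sum>e\<in>I. y e A * dd e K A\<bar>)"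
    using \<sigma>0 by (simp add: ddW sum_divide_distrib[symmetric])
  also have "(\<lambda>A. \<bar>(\<Sum>e\<in>I. y e A * (\<eta> e A / \<sigma>)) - (K A - \<mu>) / \<sigma>\<bar>) = (\<lambda>A. 1 / \<sigma> * \<bar>?R A\<bar>)"
    using \<sigma>0 by (simp add: sum_divide_distrib[symmetric] diff_divide_distrib[symmetric])
  also have "2 * E (\<lambda>A. 1 / \<sigma>\<^sup>2 * \<bar>\<sigma>\<^sup>2 - (?\<Gamma>U A + ?\<Gamma>Z A)\<bar>)
      + 2 * (C * r\<^sup>2 / \<sigma>) * E (\<lambda>A. 1 / \<sigma> * \<bar>\<Sum>e\<in>I. y e A * dd e K A\<bar>) + 5 * E (\<lambda>A. 1 / \<sigma> * \<bar>?R A\<bar>)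
      \<le> 2 * (1 / \<sigma>\<^sup>2 * (\<sigma> * (C * r\<^sup>2) + C * r ^ 5 + 2 * C\<^sup>2 * r ^ 5))
      + 2 * (C * r\<^sup>2 / \<sigma>) * (1 / \<sigma> * (3 * C * r ^ 3)) + 5 * (1 / \<sigma> * (C * r\<^sup>2))"
    unfolding E_cmult using first second ER \<sigma>0 pos
    by (intro add_mono mult_left_mono) auto
  \<comment> \<open>The coefficients collect the three contributions: \<open>10 = 4 + 6\<close> and
    \<open>7 = 2 + 5\<close>.\<close>
  also have "\<dots> = (2 * C + 10 * C\<^sup>2) * r ^ 5 / \<sigma>\<^sup>2 + 7 * C * r\<^sup>2 / \<sigma>"
    using \<sigma>0 by (simp add: field_simps power2_eq_square power_numeral_reduce)
  also have "\<dots> \<le> (2 * C + 10 * C\<^sup>2) * r ^ 5 / (c * r ^ 6) + 7 * C * r\<^sup>2 / (sqrt c * r ^ 3)"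
    using \<sigma>ge \<sigma>2ge \<sigma>0 pos by (intro add_mono divide_left_mono) auto
  also have "\<dots> = ((2 * C + 10 * C\<^sup>2) / c + 7 * C / sqrt c) / r"
    using pos by (simp add: add_divide_distrib power_numeral_reduce)
  finally show ?thesis .
qed

text \<open>Iterating the inequality of Efron and Stein, the first two levels only see expectations of derivatives.\<close>

theorem efron_stein_third_order:
  "Var f \<le> p * (\<Sum>e\<in>I. (E (dd e f))\<^sup>2) + p\<^sup>2 * (\<Sum>e\<in>I. \<Sum>g\<in>I. (E (dd g (dd e f)))\<^sup>2)
         + p ^ 3 * (\<Sum>e\<in>I. \<Sum>g\<in>I. \<Sum>h\<in>I. E (\<lambda>A. (dd h (dd g (dd e f)) A)\<^sup>2))"
proof -
  have one: "E (\<lambda>A. (f A)\<^sup>2) \<le> (E f)\<^sup>2 + p * (\<Sum>e\<in>I. E (\<lambda>A. (dd e f A)\<^sup>2))" for f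
  proof -
    have "0 \<le> (\<Sum>e\<in>I. E (\<lambda>A. (dd e f A)\<^sup>2))" by (intro sum_nonneg E_nonneg) simp
    then have "p * (1 - p) * (\<Sum>e\<in>I. E (\<lambda>A. (dd e f A)\<^sup>2)) \<le> p * 1 * (\<Sum>e\<in>I. E (\<lambda>A. (dd e f A)\<^sup>2))"
      using p by (intro mult_right_mono mult_left_mono) auto
    then show ?thesis using E_square_le[of f] by simp
  qed
  have two: "E (\<lambda>A. (f A)\<^sup>2) \<le> (E f)\<^sup>2 + p * (\<Sum>g\<in>I. (E (dd g f))\<^sup>2
      + p * (\<Sum>h\<in>I. E (\<lambda>A. (dd h (dd g f) A)\<^sup>2)))" for f
    by (rule order.trans[OF one add_left_mono[OF mult_left_mono[OF sum_mono[OF one]]]]) (use p in auto)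
  have "Var f \<le> p * (\<Sum>e\<in>I. E (\<lambda>A. (dd e f A)\<^sup>2))"
    using one[of f] by (simp add: Var_def)
  also have "\<dots> \<le> p * (\<Sum>e\<in>I. (E (dd e f))\<^sup>2 + p * (\<Sum>g\<in>I. (E (dd g (dd e f)))\<^sup>2
      + p * (\<Sum>h\<in>I. E (\<lambda>A. (dd h (dd g (dd e f)) A)\<^sup>2))))"
    by (rule mult_left_mono[OF sum_mono[OF two]]) (use p in auto)
  finally show ?thesis
    by (simp add: sum.distrib sum_distrib_left distrib_left power2_eq_square power3_eq_cube mult.assoc)
qed

end

section \<open>Cycles of length four\<close>

definition quads :: "'v set \<Rightarrow> ('v \<times> 'v \<times> 'v \<times> 'v) set" where
  "quads V = {(i, k, j, l). {i, k, j, l} \<subseteq> V \<and> distinct [i, k, j, l]}"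

fun cycle_arcs :: "'v \<times> 'v \<times> 'v \<times> 'v \<Rightarrow> 'v set set" where
  "cycle_arcs (i, k, j, l) = {{i, k}, {k, j}, {j, l}, {l, i}}"

text \<open>Each 4-cycle is counted eight times, once for every starting node and direction.\<close>

definition cycles4 :: "'v set \<Rightarrow> 'v set set \<Rightarrow> real" where
  "cycles4 V A = (\<Sum>t\<in>quads V. of_bool (cycle_arcs t \<subseteq> A))"

definition arc_count :: "'v set \<Rightarrow> 'v set set \<Rightarrow> real" where
  "arc_count V A = (\<Sum>e\<in>all_arcs V. of_bool (e \<in> A))"

definition degree_in :: "'v set \<Rightarrow> 'v set set \<Rightarrow> 'v \<Rightarrow> real" where
  "degree_in V A v = (\<Sum>w\<in>V. of_bool ({v, w} \<in> A))"

text \<open>The cycles run over the complete graph, so this number bounds the derivative of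
  \<open>cycles4\<close> uniformly and equals its mean up to a power of \<open>p\<close>. The same
  holds for \<open>through2\<close> and \<open>through3\<close> with higher derivatives in distinct
  arcs.\<close>

definition through1 :: "'v set \<Rightarrow> 'v set \<Rightarrow> real" where
  "through1 V e = (\<Sum>t\<in>quads V. of_bool (e \<in> cycle_arcs t))"

definition through2 :: "'v set \<Rightarrow> 'v set \<Rightarrow> 'v set \<Rightarrow> real" where
  "through2 V e f = (\<Sum>t\<in>quads V. of_bool (e \<in> cycle_arcs t \<and> f \<in> cycle_arcs t))"

definition through3 :: "'v set \<Rightarrow> 'v set \<Rightarrow> 'v set \<Rightarrow> 'v set \<Rightarrow> real" where
  "through3 V e f g = (\<Sum>t\<in>quads V. of_bool (e \<in> cycle_arcs t \<and> f \<in> cycle_arcs t \<and> g \<in> cycle_arcs t))"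

section \<open>Counting the 4-cycles through given arcs\<close>

lemma finite_all_arcs: "finite V \<Longrightarrow> finite (all_arcs V)"
  unfolding all_arcs_def by (rule finite_subset[of _ "Pow V"]) auto

lemma card_all_arcs: "finite V \<Longrightarrow> real (card (all_arcs V)) = real (card V) * (real (card V) - 1) / 2"
proof -
  assume "finite V"
  then have "card (all_arcs V) = card V choose 2"
    unfolding all_arcs_def by (rule n_subsets)
  also have "real \<dots> = real (card V) * (real (card V) - 1) / 2"
    by (cases "card V") (auto simp: choose_two real_of_nat_div algebra_simps)
  finally show ?thesis .
qed

lemma quads_subset: "quads V \<subseteq> V \<times> V \<times> V \<times> V"
  by (auto simp: quads_def)

lemma finite_quads: "finite V \<Longrightarrow> finite (quads V)"
  by (rule finite_subset[OF quads_subset]) auto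

lemma cycle_arcs_subset: "t \<in> quads V \<Longrightarrow> cycle_arcs t \<subseteq> all_arcs V"
  by (auto simp: quads_def all_arcs_def card_insert_if)

lemma card_cycle_arcs: "t \<in> quads V \<Longrightarrow> card (cycle_arcs t) = 4"
  by (cases t) (auto simp add: quads_def doubleton_eq_iff card_insert_if)

lemma finite_cycle_arcs: "finite (cycle_arcs t)"
  by (cases t) auto

lemma all_arcs_pairD: "e \<in> all_arcs V \<Longrightarrow> \<exists>a b. e = {a, b} \<and> a \<noteq> b \<and> a \<in> V \<and> b \<in> V"
  by (auto simp: all_arcs_def card_2_iff)

lemma sum_of_bool_le:
  assumes "finite S" "{t \<in> S. P t} \<subseteq> B" "finite B" "card B \<le> N"
  shows "(\<Sum>t\<in>S. of_bool (P t)) \<le> real N"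
proof -
  have "(\<Sum>t\<in>S. of_bool (P t)) = real (card {t \<in> S. P t})"
    using assms(1) by (simp add: sum.If_cases of_bool_def Int_def)
  also have "\<dots> \<le> real N" using card_mono[OF assms(3,2)] assms(4) by simp
  finally show ?thesis .
qed

lemma card_Union_list_le:
  assumes "\<And>B. B \<in> set Bs \<Longrightarrow> card B \<le> m"
  shows "card (\<Union>(set Bs)) \<le> length Bs * m"
  using assms
proof (induction Bs)
  case (Cons B Bs)
  have "card (\<Union>(set (B # Bs))) \<le> card B + card (\<Union>(set Bs))" using card_Un_le by simp
  also have "\<dots> \<le> m + length Bs * m" using Cons by (intro add_mono) auto
  finally show ?case by simp
qed simp

lemma card_times4: "card (A \<times> B \<times> C \<times> D) = card A * card B * card C * card D"
  by (simp add: card_cartesian_product)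

text \<open>The arc has four positions in the quadruple and two orientations, and two nodes remain
  free. The constant 8 has to be the right one: in the lower bound for the variance it is played off
  against the leading term of the arc count.\<close>

lemma through1_le:
  assumes "finite V" "e \<in> all_arcs V"
  shows "through1 V e \<le> 8 * real (card V) ^ 2"
proof -
  obtain a b where e: "e = {a, b}" "a \<noteq> b" using all_arcs_pairD[OF assms(2)] by blast
  define Bs where "Bs = [{a} \<times> {b} \<times> V \<times> V, {b} \<times> {a} \<times> V \<times> V, V \<times> {a} \<times> {b} \<times> V,
    V \<times> {b} \<times> {a} \<times> V, V \<times> V \<times> {a} \<times> {b}, V \<times> V \<times> {b} \<times> {a}, {a} \<times> V \<times> V \<times> {b}, {b} \<times> V \<times> V \<times> {a}]"
  have "through1 V e \<le> real (8 * (card V * card V))"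
    unfolding through1_def
  proof (rule sum_of_bool_le[where B = "\<Union>(set Bs)"])
    show "{t \<in> quads V. e \<in> cycle_arcs t} \<subseteq> \<Union>(set Bs)"
    proof
      fix t assume t: "t \<in> {t \<in> quads V. e \<in> cycle_arcs t}"
      obtain i k j l where ijkl: "t = (i, k, j, l)" by (cases t)
      have m: "i \<in> V" "k \<in> V" "j \<in> V" "l \<in> V" using t ijkl by (auto simp: quads_def)
      have "{a, b} = {i, k} \<or> {a, b} = {k, j} \<or> {a, b} = {j, l} \<or> {a, b} = {l, i}"
        using t by (simp add: ijkl e)
      then show "t \<in> \<Union>(set Bs)"
        unfolding doubleton_eq_iff by (elim disjE conjE) (simp_all add: m ijkl Bs_def)
    qed
    have "card (\<Union>(set Bs)) \<le> length Bs * (card V * card V)"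
      by (rule card_Union_list_le) (auto simp: Bs_def card_cartesian_product)
    then show "card (\<Union>(set Bs)) \<le> 8 * (card V * card V)" by (simp add: Bs_def)
  qed (use assms in \<open>auto intro: finite_quads simp: Bs_def\<close>)
  then show ?thesis by (simp add: power2_eq_square)
qed

lemma card_Un_arcs:
  assumes "e \<in> all_arcs V" "f \<in> all_arcs V" "e \<noteq> f"
  shows "3 \<le> card (e \<union> f)" "card (e \<union> f) \<le> 4" "finite (e \<union> f)"
proof -
  have ef: "card e = 2" "card f = 2" "finite e" "finite f"
    using assms by (auto simp: all_arcs_def intro: card_ge_0_finite)
  show "card (e \<union> f) \<le> 4" using card_Un_le[of e f] ef by simp
  show "finite (e \<union> f)" using ef by simp
  have "\<not> f \<subseteq> e" using assms(3) ef card_subset_eq[of e f] by metis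
  then have "e \<subset> e \<union> f" by auto
  then show "3 \<le> card (e \<union> f)" using psubset_card_mono[of "e \<union> f" e] ef by simp
qed

lemma cycle_arcs_vertices: "e \<in> cycle_arcs (i, k, j, l) \<Longrightarrow> e \<subseteq> {i, k, j, l}"
  by auto

text \<open>Two distinct arcs span at least three nodes, so at most one entry of the quadruple lies
  outside their union \<open>W\<close>; the constant is 4 positions times \<open>4 ^ 3\<close>
  choices in \<open>W\<close>.\<close>

lemma through2_le:
  assumes "finite V" "e \<in> all_arcs V" "f \<in> all_arcs V" "e \<noteq> f"
  shows "through2 V e f \<le> 256 * real (card V)"
proof -
  define W where "W = e \<union> f"
  note W = card_Un_arcs[OF assms(2-4), folded W_def]
  define Bs where "Bs = [V \<times> W \<times> W \<times> W, W \<times> V \<times> W \<times> W, W \<times> W \<times> V \<times> W, W \<times> W \<times> W \<times> V]"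
  have "through2 V e f \<le> real (256 * card V)"
    unfolding through2_def
  proof (rule sum_of_bool_le[where B = "\<Union>(set Bs)"])
    show "{t \<in> quads V. e \<in> cycle_arcs t \<and> f \<in> cycle_arcs t} \<subseteq> (\<Union>(set Bs))"
    proof
      fix t assume t: "t \<in> {t \<in> quads V. e \<in> cycle_arcs t \<and> f \<in> cycle_arcs t}"
      obtain i k j l where ijkl: "t = (i, k, j, l)" by (cases t)
      have sub: "W \<subseteq> {i, k, j, l}"
        using t cycle_arcs_vertices[of e i k j l] cycle_arcs_vertices[of f i k j l] unfolding W_def ijkl by simp
      have no2: False if "W \<subseteq> {a, b}" for a b
      proof -
        have "card W \<le> card {a, b}" by (rule card_mono[OF _ that]) simp
        also have "\<dots> \<le> 2" by (simp add: card_insert_if)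
        finally show False using W(1) by simp
      qed
      have "i \<in> W \<or> k \<in> W" "i \<in> W \<or> j \<in> W" "i \<in> W \<or> l \<in> W" "k \<in> W \<or> j \<in> W" "k \<in> W \<or> l \<in> W" "j \<in> W \<or> l \<in> W"
        using no2[of j l] no2[of k l] no2[of k j] no2[of i l] no2[of i j] no2[of i k] sub by blast+
      moreover have "i \<in> V" "k \<in> V" "j \<in> V" "l \<in> V" using t ijkl by (auto simp: quads_def)
      ultimately show "t \<in> \<Union>(set Bs)" unfolding ijkl Bs_def by simp blast
    qed
    have w3: "card W * card W * card W \<le> 4 * 4 * 4" using W(2) by (intro mult_mono) auto
    have "card (\<Union>(set Bs)) \<le> length Bs * (card V * (card W * card W * card W))"
      by (rule card_Union_list_le) (auto simp: Bs_def card_times4)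
    then have "card (\<Union>(set Bs)) \<le> 4 * card V * (card W * card W * card W)" by (simp add: Bs_def)
    also have "\<dots> \<le> 256 * card V" using mult_left_mono[OF w3, of "4 * card V"] by simp
    finally show "card (\<Union>(set Bs)) \<le> 256 * card V" .
  qed (use assms W in \<open>auto intro: finite_quads simp: Bs_def\<close>)
  then show ?thesis by simp
qed

text \<open>Disjoint arcs already span all four nodes, which leaves no free node and at most
  \<open>4 ^ 4\<close> quadruples.\<close>

lemma through2_disjoint_le:
  assumes "finite V" "e \<in> all_arcs V" "f \<in> all_arcs V" "e \<inter> f = {}"
  shows "through2 V e f \<le> 256"
proof -
  define W where "W = e \<union> f"
  have ef: "card e = 2" "card f = 2" "finite e" "finite f"
    using assms by (auto simp: all_arcs_def intro: card_ge_0_finite)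
  have W: "card W = 4" "finite W" unfolding W_def using card_Un_disjoint[of e f] ef assms(4) by auto
  have "through2 V e f \<le> real 256"
    unfolding through2_def
  proof (rule sum_of_bool_le[where B = "W \<times> W \<times> W \<times> W"])
    show "{t \<in> quads V. e \<in> cycle_arcs t \<and> f \<in> cycle_arcs t} \<subseteq> W \<times> W \<times> W \<times> W"
    proof
      fix t assume t: "t \<in> {t \<in> quads V. e \<in> cycle_arcs t \<and> f \<in> cycle_arcs t}"
      obtain i k j l where ijkl: "t = (i, k, j, l)" by (cases t)
      have sub: "W \<subseteq> {i, k, j, l}"
        using t cycle_arcs_vertices[of e i k j l] cycle_arcs_vertices[of f i k j l] unfolding W_def ijkl by simp
      have "card {i, k, j, l} = 4" using t ijkl by (auto simp: quads_def)
      then have "W = {i, k, j, l}" using card_subset_eq[OF _ sub] W by simp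
      then show "t \<in> W \<times> W \<times> W \<times> W" unfolding ijkl by blast
    qed
  qed (use assms W in \<open>auto intro: finite_quads simp: card_times4\<close>)
  then show ?thesis by simp
qed

text \<open>A node of a 4-cycle is missed by only two of its arcs, so three distinct arcs cover all
  nodes. The crude bound \<open>6 ^ 4\<close> comes from at most six end points.\<close>

lemma through3_le:
  assumes "finite V" "e \<in> all_arcs V" "f \<in> all_arcs V" "g \<in> all_arcs V" "distinct [e, f, g]"
  shows "through3 V e f g \<le> 1296"
proof -
  define W where "W = e \<union> f \<union> g"
  have efg: "card e = 2" "card f = 2" "card g = 2" "finite e" "finite f" "finite g"
    using assms by (auto simp: all_arcs_def intro: card_ge_0_finite)
  have W: "card W \<le> 6" "finite W"
    unfolding W_def using card_Un_le[of e f] card_Un_le[of "e \<union> f" g] efg by auto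
  have "through3 V e f g \<le> real 1296"
    unfolding through3_def
  proof (rule sum_of_bool_le[where B = "W \<times> W \<times> W \<times> W"])
    show "{t \<in> quads V. e \<in> cycle_arcs t \<and> f \<in> cycle_arcs t \<and> g \<in> cycle_arcs t} \<subseteq> W \<times> W \<times> W \<times> W"
    proof
      fix t assume t: "t \<in> {t \<in> quads V. e \<in> cycle_arcs t \<and> f \<in> cycle_arcs t \<and> g \<in> cycle_arcs t}"
      obtain i k j l where ijkl: "t = (i, k, j, l)" by (cases t)
      have no2: False if "e \<in> {x, y}" "f \<in> {x, y}" "g \<in> {x, y}" for x y
        using that assms(5) by auto
      have m: "e \<in> cycle_arcs t" "f \<in> cycle_arcs t" "g \<in> cycle_arcs t" using t by auto
      have "i \<in> W" using no2[of "{k, j}" "{j, l}"] m unfolding ijkl W_def by auto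
      moreover have "k \<in> W" using no2[of "{j, l}" "{l, i}"] m unfolding ijkl W_def by auto
      moreover have "j \<in> W" using no2[of "{i, k}" "{l, i}"] m unfolding ijkl W_def by auto
      moreover have "l \<in> W" using no2[of "{i, k}" "{k, j}"] m unfolding ijkl W_def by auto
      ultimately show "t \<in> W \<times> W \<times> W \<times> W" unfolding ijkl by blast
    qed
    have "card W * card W * card W * card W \<le> 6 * 6 * 6 * 6" using W by (intro mult_mono) auto
    then show "card (W \<times> W \<times> W \<times> W) \<le> 1296" by (simp add: card_times4)
  qed (use assms W in \<open>auto intro: finite_quads\<close>)
  then show ?thesis by simp
qed

lemma sum_arcs_of_bool_cycle:
  assumes "finite V" "t \<in> quads V"
  shows "(\<Sum>f\<in>all_arcs V. of_bool (f \<in> cycle_arcs t)) = (4 :: real)"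
proof -
  have "(\<Sum>f\<in>all_arcs V. of_bool (f \<in> cycle_arcs t)) = real (card (all_arcs V \<inter> cycle_arcs t))"
    using finite_all_arcs[OF assms(1)] by (simp add: sum.If_cases of_bool_def Int_def)
  also have "all_arcs V \<inter> cycle_arcs t = cycle_arcs t" using cycle_arcs_subset[OF assms(2)] by auto
  finally show ?thesis using card_cycle_arcs[OF assms(2)] by simp
qed

text \<open>Double counting with four arcs per cycle; the term \<open>f = e\<close> is included in
  the sum.\<close>

lemma sum_through2:
  assumes "finite V"
  shows "(\<Sum>f\<in>all_arcs V. through2 V e f) = 4 * through1 V e"
proof -
  have "(\<Sum>f\<in>all_arcs V. through2 V e f)
      = (\<Sum>t\<in>quads V. of_bool (e \<in> cycle_arcs t) * (\<Sum>f\<in>all_arcs V. of_bool (f \<in> cycle_arcs t)))"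
    unfolding through2_def of_bool_conj sum_distrib_left by (rule sum.swap)
  also have "\<dots> = (\<Sum>t\<in>quads V. of_bool (e \<in> cycle_arcs t) * 4)"
    using assms by (intro sum.cong refl) (simp only: sum_arcs_of_bool_cycle)
  finally show ?thesis by (simp add: through1_def sum_distrib_left mult.commute)
qed

lemma sum_through3:
  assumes "finite V"
  shows "(\<Sum>g\<in>all_arcs V. through3 V e f g) = 4 * through2 V e f"
proof -
  have "(\<Sum>g\<in>all_arcs V. through3 V e f g)
      = (\<Sum>t\<in>quads V. of_bool (e \<in> cycle_arcs t \<and> f \<in> cycle_arcs t) * (\<Sum>g\<in>all_arcs V. of_bool (g \<in> cycle_arcs t)))"
    unfolding through3_def of_bool_conj sum_distrib_left mult.assoc by (rule sum.swap)
  also have "\<dots> = (\<Sum>t\<in>quads V. of_bool (e \<in> cycle_arcs t \<and> f \<in> cycle_arcs t) * 4)"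
    using assms by (intro sum.cong refl) (simp only: sum_arcs_of_bool_cycle)
  finally show ?thesis by (simp add: through2_def sum_distrib_left mult.commute)
qed

lemma through_nonneg: "0 \<le> through1 V e" "0 \<le> through2 V e f" "0 \<le> through3 V e f g"
  unfolding through1_def through2_def through3_def by (rule sum_nonneg, simp)+

lemma through2_commute: "through2 V e f = through2 V f e"
  unfolding through2_def by (intro sum.cong refl) auto

text \<open>\<open>S\<close> holds the arcs in which a derivative was already taken, so that the
  rule can be iterated.\<close>

lemma dd_of_bool_subset:
  "dd e (\<lambda>A. of_bool (B - S \<subseteq> A)) A = of_bool (e \<in> B - S) * of_bool (B - insert e S \<subseteq> A)"
  by (auto simp: dd_def of_bool_def)

lemma dd_cycles4:
  "dd e (cycles4 V) A = (\<Sum>t\<in>quads V. of_bool (e \<in> cycle_arcs t) * of_bool (cycle_arcs t - {e} \<subseteq> A))"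
  unfolding cycles4_def[abs_def] dd_sum
  using dd_of_bool_subset[of e _ "{}" A] by (intro sum.cong refl) simp

lemma dd2_cycles4:
  assumes "e \<noteq> f"
  shows "dd f (dd e (cycles4 V)) A =
    (\<Sum>t\<in>quads V. of_bool (e \<in> cycle_arcs t \<and> f \<in> cycle_arcs t) * of_bool (cycle_arcs t - {e, f} \<subseteq> A))"
  unfolding dd_cycles4[abs_def] dd_sum dd_cmult
  using assms by (intro sum.cong refl, subst dd_of_bool_subset) (auto simp: insert_commute)

lemma dd3_cycles4:
  assumes "distinct [e, f, g]"
  shows "dd g (dd f (dd e (cycles4 V))) A =
    (\<Sum>t\<in>quads V. of_bool (e \<in> cycle_arcs t \<and> f \<in> cycle_arcs t \<and> g \<in> cycle_arcs t)
       * of_bool (cycle_arcs t - {e, f, g} \<subseteq> A))"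
proof -
  have "dd f (dd e (cycles4 V)) = (\<lambda>A. \<Sum>t\<in>quads V. of_bool (e \<in> cycle_arcs t \<and> f \<in> cycle_arcs t) * of_bool (cycle_arcs t - {e, f} \<subseteq> A))"
    using dd2_cycles4[of e f V] assms by auto
  then show ?thesis
    unfolding dd_sum dd_cmult using assms
    by (simp only: dd_sum dd_cmult) (intro sum.cong refl, subst dd_of_bool_subset, auto simp: insert_commute)
qed

lemma dd_cycles4_bounds: "0 \<le> dd e (cycles4 V) A" "dd e (cycles4 V) A \<le> through1 V e"
  unfolding dd_cycles4 through1_def by (rule sum_nonneg sum_mono, simp)+

lemma dd2_cycles4_bounds:
  assumes "e \<noteq> f"
  shows "0 \<le> dd f (dd e (cycles4 V)) A" "dd f (dd e (cycles4 V)) A \<le> through2 V e f"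
  unfolding dd2_cycles4[OF assms] through2_def by (rule sum_nonneg sum_mono, simp)+

lemma dd3_cycles4_bounds:
  assumes "distinct [e, f, g]"
  shows "0 \<le> dd g (dd f (dd e (cycles4 V))) A" "dd g (dd f (dd e (cycles4 V))) A \<le> through3 V e f g"
  unfolding dd3_cycles4[OF assms] through3_def by (rule sum_nonneg sum_mono, simp)+

locale random_graph =
  fixes V :: "'v set" and p :: real
  assumes finV: "finite V" and p01: "0 < p" "p < 1"

sublocale random_graph \<subseteq> random_subsets "all_arcs V" p
  using finV p01 by unfold_locales (auto intro: finite_all_arcs)

lemma (in random_subsets) E_of_bool_subset:
  assumes "finite B" "B \<subseteq> I"
  shows "E (\<lambda>A. of_bool (B \<subseteq> A)) = p ^ card B"
  using assms
proof (induction B rule: finite_induct)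
  case (insert e B)
  then have "E (\<lambda>A. of_bool (insert e B \<subseteq> A)) = p * E (\<lambda>A. of_bool (B \<subseteq> A))"
    by (subst E_split[of e]) (auto simp: subset_insert)
  then show ?case using insert by simp
qed simp

context random_graph
begin

lemma E_of_bool_mem: "e \<in> all_arcs V \<Longrightarrow> E (\<lambda>A. of_bool (e \<in> A)) = p"
  using E_of_bool_subset[of "{e}"] by simp

lemma E_dd_cycles4: "E (dd e (cycles4 V)) = p ^ 3 * through1 V e"
proof -
  have "E (\<lambda>A. of_bool (e \<in> cycle_arcs t) * of_bool (cycle_arcs t - {e} \<subseteq> A))
      = p ^ 3 * of_bool (e \<in> cycle_arcs t)" if t: "t \<in> quads V" for t
  proof (cases "e \<in> cycle_arcs t")
    case True
    then have "card (cycle_arcs t - {e}) = 3" using card_cycle_arcs[OF t] finite_cycle_arcs[of t] by simp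
    then show ?thesis
      using True E_of_bool_subset[of "cycle_arcs t - {e}"] cycle_arcs_subset[OF t] finite_cycle_arcs[of t]
      by auto
  qed simp
  then show ?thesis
    unfolding dd_cycles4[abs_def] E_sum through1_def sum_distrib_left by (intro sum.cong refl)
qed

lemma E_dd2_cycles4:
  assumes "e \<noteq> f"
  shows "E (dd f (dd e (cycles4 V))) = p ^ 2 * through2 V e f"
proof -
  have "E (\<lambda>A. of_bool (e \<in> cycle_arcs t \<and> f \<in> cycle_arcs t) * of_bool (cycle_arcs t - {e, f} \<subseteq> A))
      = p ^ 2 * of_bool (e \<in> cycle_arcs t \<and> f \<in> cycle_arcs t)" if t: "t \<in> quads V" for t
  proof (cases "e \<in> cycle_arcs t \<and> f \<in> cycle_arcs t")
    case True
    then have "card (cycle_arcs t - {e, f}) = 2"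
      using card_cycle_arcs[OF t] finite_cycle_arcs[of t] assms by (simp add: card_Diff_subset)
    then show ?thesis
      using True E_of_bool_subset[of "cycle_arcs t - {e, f}"] cycle_arcs_subset[OF t] finite_cycle_arcs[of t]
      by auto
  qed simp
  then show ?thesis
    unfolding dd2_cycles4[OF assms, abs_def] E_sum through2_def sum_distrib_left by (intro sum.cong refl)
qed

end

section \<open>Variance bounds for the main part\<close>

definition main_part :: "'v set \<Rightarrow> 'v set set \<Rightarrow> real" where
  "main_part V A = 2 * (arc_count V A)\<^sup>2 - cycles4 V A / 4"

context random_graph
begin

abbreviation "n \<equiv> real (card V)"
abbreviation "N \<equiv> real (card (all_arcs V))"

lemma N_eq: "N = n * (n - 1) / 2"
  using card_all_arcs[OF finV] .

lemma N_le: "N \<le> n\<^sup>2 / 2"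
  unfolding N_eq by (simp add: power2_eq_square algebra_simps)

lemma arc_count_eq: "arc_count V A = N * p + (\<Sum>e\<in>all_arcs V. y e A)"
  by (simp add: arc_count_def y_def sum_subtractf)

lemma dd_arc_count: "e \<in> all_arcs V \<Longrightarrow> dd e (arc_count V) A = 1"
proof -
  assume e: "e \<in> all_arcs V"
  have "dd e (arc_count V) A = (\<Sum>f\<in>all_arcs V. if f = e then 1 else 0)"
    unfolding arc_count_def[abs_def] dd_sum by (intro sum.cong refl) (auto simp: dd_def)
  then show ?thesis using e fin by simp
qed

lemma arc_count_remove:
  "e \<in> all_arcs V \<Longrightarrow> arc_count V (insert e A) = arc_count V (A - {e}) + 1"
  using dd_arc_count[of e A] by (simp add: dd_def)

lemma arc_count_bounds: "0 \<le> arc_count V A" "arc_count V A \<le> N"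
proof -
  show "0 \<le> arc_count V A" unfolding arc_count_def by (rule sum_nonneg) simp
  have "arc_count V A \<le> (\<Sum>e\<in>all_arcs V. 1)" unfolding arc_count_def by (rule sum_mono) simp
  then show "arc_count V A \<le> N" by simp
qed

lemma arc_count_remove_le: "arc_count V (A - {e}) \<le> arc_count V A"
  unfolding arc_count_def by (rule sum_mono) auto

lemma dd_main_part:
  assumes "e \<in> all_arcs V"
  shows "dd e (main_part V) A = 4 * arc_count V (A - {e}) + 2 - dd e (cycles4 V) A / 4"
  unfolding main_part_def[abs_def]
  by (simp add: dd_def arc_count_remove[OF assms] power2_eq_square algebra_simps diff_divide_distrib)

lemma dd2_main_part:
  assumes "e \<in> all_arcs V" "f \<in> all_arcs V" "e \<noteq> f"
  shows "dd f (dd e (main_part V)) A = 4 - dd f (dd e (cycles4 V)) A / 4"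
proof -
  have "insert f A - {e} = insert f (A - {e})" "A - {f} - {e} = A - {e} - {f}" using assms(3) by auto
  then have "dd f (\<lambda>A. arc_count V (A - {e})) A = dd f (arc_count V) (A - {e})"
    by (simp add: dd_def)
  then have 1: "dd f (\<lambda>A. arc_count V (A - {e})) A = 1" using dd_arc_count[OF assms(2)] by simp
  have "dd e (main_part V) = (\<lambda>A. 4 * arc_count V (A - {e}) + 2 - dd e (cycles4 V) A / 4)"
    using dd_main_part[OF assms(1)] by auto
  then show ?thesis by (simp add: dd_diff dd_add dd_cmult dd_const dd_divide 1)
qed

lemma dd3_main_part:
  assumes "e \<in> all_arcs V" "f \<in> all_arcs V" "distinct [e, f, g]"
  shows "dd g (dd f (dd e (main_part V))) A = - dd g (dd f (dd e (cycles4 V))) A / 4"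
proof -
  have "dd f (dd e (main_part V)) = (\<lambda>A. 4 - dd f (dd e (cycles4 V)) A / 4)"
    using dd2_main_part[of e f] assms by auto
  then show ?thesis by (simp add: dd_diff dd_const dd_divide)
qed

lemma through1_le': "e \<in> all_arcs V \<Longrightarrow> through1 V e \<le> 8 * n\<^sup>2"
  by (rule through1_le[OF finV])

text \<open>The arc part and the cycle part of \<open>dd_main_part\<close> enter with opposite signs
  and are each at most \<open>2 * n^2\<close>, so the bounds need not be added.\<close>

lemma abs_dd_main_part_le:
  assumes "e \<in> all_arcs V"
  shows "\<bar>dd e (main_part V) A\<bar> \<le> 2 * n\<^sup>2"
proof -
  have "arc_count V (A - {e}) + 1 \<le> N"
    using arc_count_bounds(2)[of "insert e A"] arc_count_remove[OF assms, of A] by simp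
  then show ?thesis
    using dd_main_part[OF assms, of A] arc_count_bounds(1)[of "A - {e}"] N_le
      dd_cycles4_bounds[of e V A] through1_le'[OF assms] by linarith
qed

lemma E_sum_y_square: "E (\<lambda>A. (\<Sum>e\<in>all_arcs V. y e A)\<^sup>2) = p * (1 - p) * N"
  using E_square_sum_y[of "\<lambda>_ _. 1"] by (simp add: indep_of_def dd_const)

lemma E_arc_count: "E (arc_count V) = N * p"
  unfolding arc_count_eq[abs_def] by (simp add: E_sum E_y)

lemma E_arc_count_square: "E (\<lambda>A. (arc_count V A)\<^sup>2) = (N * p)\<^sup>2 + p * (1 - p) * N"
proof -
  have "(\<lambda>A. (arc_count V A)\<^sup>2) = (\<lambda>A. (N * p)\<^sup>2 + 2 * (N * p) * (arc_count V A - N * p)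
      + (\<Sum>e\<in>all_arcs V. y e A)\<^sup>2)"
    by (auto simp: arc_count_eq power2_eq_square algebra_simps)
  then show ?thesis by (simp only: E_add E_cmult E_diff E_const E_sum_y_square E_arc_count) simp
qed

definition lin_coeff :: "'v set \<Rightarrow> real" where
  "lin_coeff e = E (dd e (main_part V))"

text \<open>Only adjacent arcs get a second order coefficient: the disjoint pairs have coefficients of constant
  order and are small enough to be left in the remainder, but as part of \<open>stein_coeff\<close> they would break
  its uniform bound of order \<open>n\<^sup>2 p\<close>.\<close>

definition quad_coeff :: "'v set \<Rightarrow> 'v set \<Rightarrow> real" where
  "quad_coeff e f = of_bool (f \<noteq> e \<and> e \<inter> f \<noteq> {}) * - (p\<^sup>2 / 4 * through2 V e f)"

text \<open>The half distributes a pair over its two arcs: it occurs twice in \<open>proj\<close>,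
  so that \<open>dd e proj\<close> carries the full coefficient
  \<open>quad_coeff e f\<close>.\<close>

definition stein_coeff :: "'v set \<Rightarrow> 'v set set \<Rightarrow> real" where
  "stein_coeff e A = lin_coeff e + (\<Sum>f\<in>all_arcs V. quad_coeff e f * y f A) / 2"

text \<open>The first chaos of \<open>main_part V\<close> together with its second chaos on adjacent
  pairs, the latter without the constant 4 of \<open>dd2_main_part\<close>, which is small enough
  for the remainder.\<close>

definition proj :: "'v set set \<Rightarrow> real" where
  "proj A = (\<Sum>e\<in>all_arcs V. y e A * stein_coeff e A)"

lemma quad_coeff_commute: "quad_coeff e f = quad_coeff f e"
  by (auto simp: quad_coeff_def through2_commute[of V e f] Int_commute)

lemma quad_coeff_same: "quad_coeff e e = 0"
  by (simp add: quad_coeff_def)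

lemma sum_abs_quad_coeff:
  assumes "e \<in> all_arcs V"
  shows "(\<Sum>f\<in>all_arcs V. \<bar>quad_coeff e f\<bar>) \<le> 8 * n\<^sup>2 * p\<^sup>2"
proof -
  have "(\<Sum>f\<in>all_arcs V. \<bar>quad_coeff e f\<bar>) \<le> (\<Sum>f\<in>all_arcs V. p\<^sup>2 / 4 * through2 V e f)"
    by (intro sum_mono) (auto simp: quad_coeff_def abs_mult through_nonneg)
  also have "\<dots> = p\<^sup>2 * through1 V e"
    by (simp add: sum_distrib_left[symmetric] sum_through2[OF finV] sum_divide_distrib[symmetric])
  also have "\<dots> \<le> p\<^sup>2 * (8 * n\<^sup>2)" using through1_le'[OF assms] by (intro mult_left_mono) auto
  finally show ?thesis by (simp add: mult_ac)
qed

lemma dd_sum_quad: "f \<in> all_arcs V \<Longrightarrow> dd f (\<lambda>A. \<Sum>g\<in>all_arcs V. c g * y g A) A = c f"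
proof -
  assume f: "f \<in> all_arcs V"
  have "dd f (\<lambda>A. \<Sum>g\<in>all_arcs V. c g * y g A) A = (\<Sum>g\<in>all_arcs V. if g = f then c f else 0)"
    unfolding dd_sum dd_cmult
    by (intro sum.cong refl) (metis dd_y_other dd_y_same mult.right_neutral mult_zero_right)
  then show ?thesis using f fin by simp
qed

lemma dd_stein_coeff: "f \<in> all_arcs V \<Longrightarrow> dd f (stein_coeff e) A = quad_coeff e f / 2"
  unfolding stein_coeff_def[abs_def] dd_add dd_divide dd_const by (simp add: dd_sum_quad)

lemma indep_of_stein_coeff: "e \<in> all_arcs V \<Longrightarrow> indep_of e (stein_coeff e)"
  by (simp add: indep_of_def dd_stein_coeff quad_coeff_same)

lemma dd_proj:
  assumes e: "e \<in> all_arcs V"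
  shows "dd e proj A = lin_coeff e + (\<Sum>f\<in>all_arcs V. quad_coeff e f * y f A)"
proof -
  have "dd e proj A = (\<Sum>f\<in>all_arcs V. dd e (\<lambda>A. y f A * stein_coeff f A) A)"
    unfolding proj_def[abs_def] dd_sum ..
  also have "\<dots> = (\<Sum>f\<in>all_arcs V. (if f = e then stein_coeff e A else 0) + y f A * (quad_coeff f e / 2))"
  proof (intro sum.cong refl)
    fix f assume f: "f \<in> all_arcs V"
    show "dd e (\<lambda>A. y f A * stein_coeff f A) A
        = (if f = e then stein_coeff e A else 0) + y f A * (quad_coeff f e / 2)"
    proof (cases "f = e")
      case True
      then show ?thesis
        using dd_mult_indep[OF indep_of_stein_coeff[OF e], of "y e" A] dd_y_same[of e A]
        by (simp add: mult.commute quad_coeff_same)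
    next
      case False
      then show ?thesis
        using dd_mult_indep[OF indep_of_y, of e f "stein_coeff f" A] dd_stein_coeff[OF e, of f A] by simp
    qed
  qed
  also have "\<dots> = stein_coeff e A + (\<Sum>f\<in>all_arcs V. quad_coeff e f * y f A) / 2"
    using e fin by (simp add: sum.distrib quad_coeff_commute[of _ e] sum_divide_distrib mult.commute)
  finally show ?thesis by (simp add: stein_coeff_def)
qed

lemma dd2_proj:
  assumes "e \<in> all_arcs V" "f \<in> all_arcs V"
  shows "dd f (dd e proj) A = quad_coeff e f"
proof -
  have "dd e proj = (\<lambda>A. lin_coeff e + (\<Sum>f\<in>all_arcs V. quad_coeff e f * y f A))"
    using dd_proj[OF assms(1)] by auto
  then show ?thesis by (simp add: dd_add dd_const dd_sum_quad assms)
qed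

lemma E_proj: "E proj = 0"
  unfolding proj_def[abs_def] E_sum
  by (intro sum.neutral ballI)
     (simp add: E_y_mult dd_stein_coeff quad_coeff_same cong: Bochner_Integration.integral_cong)

end

text \<open>The condition \<open>1 \<le> s\<close> lets constants and lower powers of
  \<open>s\<close> be absorbed into higher ones; it holds eventually when p dominates
  \<open>1 / n^2\<close>.\<close>

locale dense_random_graph = random_graph V p for V :: "'v set" and p :: real +
  assumes p_dense: "1 \<le> (real (card V))\<^sup>2 * p"
begin

abbreviation "s \<equiv> n\<^sup>2 * p"

lemma n_pos: "1 \<le> n"
proof -
  have "card V \<noteq> 0" using p_dense by (intro notI) simp
  then show ?thesis by simp
qed

lemma N_p_le: "N * p \<le> s / 2"
  using mult_right_mono[OF N_le, of p] p by simp

lemma square_p_le: "n ^ 4 * p ^ 3 \<le> s\<^sup>2" "n ^ 4 * p ^ 2 = s\<^sup>2" "n\<^sup>2 * p\<^sup>2 \<le> s" "n\<^sup>2 * p ^ 3 \<le> s" "s \<le> s\<^sup>2" "s\<^sup>2 \<le> s ^ 3"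
proof -
  show 2: "n ^ 4 * p ^ 2 = s\<^sup>2" by (simp add: power_mult_distrib flip: power_mult)
  have "p ^ 3 \<le> p ^ 2" "p ^ 2 \<le> p ^ 1" "p ^ 3 \<le> p ^ 1"
    using p by (intro power_decreasing; simp)+
  then have "n ^ 4 * p ^ 3 \<le> n ^ 4 * p ^ 2" "n\<^sup>2 * p ^ 3 \<le> n\<^sup>2 * p ^ 1" "n\<^sup>2 * p ^ 2 \<le> n\<^sup>2 * p ^ 1"
    by (intro mult_left_mono; simp)+
  then show "n ^ 4 * p ^ 3 \<le> s\<^sup>2" "n\<^sup>2 * p\<^sup>2 \<le> s" "n\<^sup>2 * p ^ 3 \<le> s" using 2 by simp_all
  show "s \<le> s\<^sup>2" "s\<^sup>2 \<le> s ^ 3"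
    using power_increasing[of 1 2 s] power_increasing[of 2 3 s] p_dense by simp_all
qed

lemma abs_lin_coeff_le:
  assumes "e \<in> all_arcs V"
  shows "\<bar>lin_coeff e\<bar> \<le> 6 * s"
proof -
  have eq: "lin_coeff e = 4 * E (\<lambda>A. arc_count V (A - {e})) + 2 - p ^ 3 * through1 V e / 4"
    unfolding lin_coeff_def E_dd_cycles4[symmetric]
    using dd_main_part[OF assms] by (simp add: E_add E_diff E_cmult cong: Bochner_Integration.integral_cong)
  have "E (\<lambda>A. arc_count V (A - {e})) \<le> N * p"
    unfolding E_arc_count[symmetric] by (intro E_mono arc_count_remove_le)
  moreover have "0 \<le> E (\<lambda>A. arc_count V (A - {e}))" by (intro E_nonneg arc_count_bounds)
  moreover have "p ^ 3 * through1 V e \<le> 8 * s"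
  proof -
    have "p ^ 3 * through1 V e \<le> p ^ 3 * (8 * n\<^sup>2)"
      using through1_le'[OF assms] p by (intro mult_left_mono) auto
    also have "\<dots> = 8 * (n\<^sup>2 * p ^ 3)" by simp
    also have "\<dots> \<le> 8 * s" using square_p_le(4) by simp
    finally show ?thesis .
  qed
  moreover have "0 \<le> p ^ 3 * through1 V e" using p by (simp add: through_nonneg)
  ultimately show ?thesis using eq N_p_le p_dense by linarith
qed

lemma abs_stein_coeff_le:
  assumes "e \<in> all_arcs V"
  shows "\<bar>stein_coeff e A\<bar> \<le> 10 * s"
proof -
  have "\<bar>\<Sum>f\<in>all_arcs V. quad_coeff e f * y f A\<bar> \<le> (\<Sum>f\<in>all_arcs V. \<bar>quad_coeff e f\<bar> * 1)"
    unfolding abs_mult[symmetric]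
    by (intro order.trans[OF sum_abs] sum_mono, unfold abs_mult) (intro mult_left_mono abs_y_le abs_ge_zero)
  also have "\<dots> \<le> 8 * n\<^sup>2 * p\<^sup>2" using sum_abs_quad_coeff[OF assms] by simp
  also have "\<dots> \<le> 8 * s" using square_p_le(3) by simp
  finally show ?thesis using abs_lin_coeff_le[OF assms] unfolding stein_coeff_def by linarith
qed

text \<open>A uniform bound on the derivative and one step of Efron-Stein suffice. By the product
  rule the sum changes by at most \<open>8 n^4 p^2\<close> through the coefficients and by
  \<open>10 s * (2 n^2 + 8 n^2)\<close> through the derivatives of \<open>main_part\<close>, and
  \<open>108 = 8 + 100\<close>.\<close>

lemma Var_quad:
  "Var (\<lambda>A. p * (1 - p) * (\<Sum>e\<in>all_arcs V. stein_coeff e A * dd e (main_part V) A)) \<le> 108\<^sup>2 * s ^ 5"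
proof -
  let ?L = "\<lambda>A. p * (1 - p) * (\<Sum>e\<in>all_arcs V. stein_coeff e A * dd e (main_part V) A)"
  have b: "\<bar>dd f ?L A\<bar> \<le> 108 * s\<^sup>2" if f: "f \<in> all_arcs V" for f A
  proof -
    have "\<bar>dd f (\<lambda>A. \<Sum>e\<in>all_arcs V. stein_coeff e A * dd e (main_part V) A) A\<bar>
        \<le> (\<Sum>e\<in>all_arcs V. \<bar>quad_coeff e f\<bar> / 2 * (2 * n\<^sup>2) + 10 * s * (4 + through2 V e f / 4))"
      unfolding dd_sum
    proof (rule order.trans[OF sum_abs sum_mono])
      fix e assume e: "e \<in> all_arcs V"
      have d2: "\<bar>dd f (dd e (main_part V)) A\<bar> \<le> 4 + through2 V e f / 4"
      proof (cases "e = f")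
        case True
        then show ?thesis using through_nonneg(2)[of V e f] by (simp add: dd_dd_same)
      next
        case False
        then show ?thesis using dd2_main_part[OF e f False, of A] dd2_cycles4_bounds[OF False, of V A] by linarith
      qed
      have "\<bar>dd f (\<lambda>A. stein_coeff e A * dd e (main_part V) A) A\<bar>
          \<le> \<bar>quad_coeff e f / 2\<bar> * \<bar>dd e (main_part V) (insert f A)\<bar>
            + \<bar>stein_coeff e (A - {f})\<bar> * \<bar>dd f (dd e (main_part V)) A\<bar>"
        unfolding dd_mult dd_stein_coeff[OF f] abs_mult[symmetric] by (rule abs_triangle_ineq)
      also have "\<dots> \<le> \<bar>quad_coeff e f / 2\<bar> * (2 * n\<^sup>2) + (10 * s) * (4 + through2 V e f / 4)"
        using p abs_dd_main_part_le[OF e] abs_stein_coeff_le[OF e] d2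
        by (intro add_mono mult_mono) auto
      finally show "\<bar>dd f (\<lambda>A. stein_coeff e A * dd e (main_part V) A) A\<bar>
          \<le> \<bar>quad_coeff e f\<bar> / 2 * (2 * n\<^sup>2) + 10 * s * (4 + through2 V e f / 4)" by simp
    qed
    also have "\<dots> = n\<^sup>2 * (\<Sum>e\<in>all_arcs V. \<bar>quad_coeff f e\<bar>) + 10 * s * (4 * N + through1 V f)"
    proof -
      have "(\<Sum>e\<in>all_arcs V. through2 V e f) = 4 * through1 V f"
        using sum_through2[OF finV, of f] by (simp add: through2_commute)
      then have "(\<Sum>e\<in>all_arcs V. 4 + through2 V e f / 4) = 4 * N + through1 V f"
        by (simp add: sum.distrib sum_divide_distrib[symmetric])
      then show ?thesis
        by (simp add: sum.distrib sum_distrib_left[symmetric] quad_coeff_commute[of _ f] sum_distrib_right[symmetric] mult.commute[of "\<bar>_\<bar>"])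
    qed
    also have "\<dots> \<le> n\<^sup>2 * (8 * n\<^sup>2 * p\<^sup>2) + 10 * s * (2 * n\<^sup>2 + 8 * n\<^sup>2)"
      using sum_abs_quad_coeff[OF f] through1_le'[OF f] N_le p
      by (intro add_mono mult_left_mono) auto
    also have "\<dots> \<le> 108 * n ^ 4 * p"
    proof -
      have "n ^ 4 * p\<^sup>2 \<le> n ^ 4 * p" using p by (intro mult_left_mono) (auto simp: power2_eq_square mult_left_le)
      then show ?thesis by (simp add: power2_eq_square power4_eq_xxxx algebra_simps)
    qed
    finally have "p * (1 - p) * \<bar>dd f (\<lambda>A. \<Sum>e\<in>all_arcs V. stein_coeff e A * dd e (main_part V) A) A\<bar>
        \<le> p * 1 * (108 * n ^ 4 * p)"
      using p by (intro mult_mono) auto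
    then show ?thesis
      using p unfolding dd_cmult abs_mult[of "p * (1 - p)"] square_p_le(2)[symmetric]
      by (simp add: power2_eq_square mult_ac)
  qed
  have "Var ?L \<le> p * (1 - p) * (\<Sum>f\<in>all_arcs V. E (\<lambda>A. (dd f ?L A)\<^sup>2))" by (rule Var_le)
  also have "\<dots> \<le> p * 1 * (\<Sum>f\<in>all_arcs V. (108 * s\<^sup>2)\<^sup>2)"
  proof (intro mult_mono sum_mono E_le_const)
    fix f A assume "f \<in> all_arcs V"
    then show "(dd f ?L A)\<^sup>2 \<le> (108 * s\<^sup>2)\<^sup>2"
      using power_mono[OF b abs_ge_zero, of f A 2] by (simp only: power2_abs)
  qed (use p in \<open>auto intro!: sum_nonneg E_nonneg\<close>)
  also have "\<dots> = (N * p) * (108\<^sup>2 * s ^ 4)" by (simp add: power_mult_distrib mult_ac flip: power_mult)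
  also have "\<dots> \<le> s * (108\<^sup>2 * s ^ 4)"
  proof (rule mult_right_mono)
    show "N * p \<le> s" using N_p_le p_dense by linarith
  qed simp
  also have "\<dots> = 108\<^sup>2 * s ^ 5" by (simp add: power_numeral_reduce)
  finally show ?thesis .
qed

text \<open>By \<open>E_square_sum_y\<close> only second moments of first and second derivatives are
  needed. For the cycle terms one factor is replaced by its supremum and the mean of the other is
  taken, which keeps the needed powers of \<open>p\<close> without any second moment of cycle
  counts.\<close>

lemma E_square_weighted:
  "E (\<lambda>A. (\<Sum>e\<in>all_arcs V. y e A * dd e (main_part V) A)\<^sup>2) \<le> 24\<^sup>2 * s ^ 3"
proof -
  let ?U = "main_part V"
  have d1: "E (\<lambda>A. (dd e ?U A)\<^sup>2) \<le> 88 * s\<^sup>2" if e: "e \<in> all_arcs V" for e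
  proof -
    have pt: "(dd e ?U A)\<^sup>2 \<le> 64 * (arc_count V A)\<^sup>2 + 16 + n\<^sup>2 * dd e (cycles4 V) A" for A
    proof -
      define m where "m = arc_count V (A - {e})"
      define t where "t = dd e (cycles4 V) A"
      have m: "0 \<le> m" "m \<le> arc_count V A" using arc_count_bounds arc_count_remove_le by (auto simp: m_def)
      have t: "0 \<le> t" "t \<le> 8 * n\<^sup>2"
        using dd_cycles4_bounds[of e V A] through1_le'[OF e] by (auto simp: t_def)
      have "(dd e ?U A)\<^sup>2 = (4 * m + 2 - t / 4)\<^sup>2"
        unfolding dd_main_part[OF e] m_def t_def ..
      \<comment> \<open>Two applications of \<open>(a + b)^2 \<le> 2 a^2 + 2 b^2\<close>, written as
        an explicit sum of squares.\<close>
      also have "\<dots> \<le> 64 * m\<^sup>2 + 16 + t\<^sup>2 / 8"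
      proof -
        have "64 * m\<^sup>2 + 16 + t\<^sup>2 / 8 - (4 * m + 2 - t / 4)\<^sup>2 = 2 * (4 * m - 2)\<^sup>2 + (4 * m + 2 + t / 4)\<^sup>2"
          by (simp add: power2_eq_square field_simps)
        also have "\<dots> \<ge> 0" by simp
        finally show ?thesis by simp
      qed
      also have "t\<^sup>2 / 8 \<le> n\<^sup>2 * t" using t mult_right_mono[OF t(2,1)] by (simp add: power2_eq_square)
      also have "m\<^sup>2 \<le> (arc_count V A)\<^sup>2" using m by (intro power_mono)
      finally show ?thesis by (simp add: t_def)
    qed
    have "E (\<lambda>A. (dd e ?U A)\<^sup>2) \<le> E (\<lambda>A. 64 * (arc_count V A)\<^sup>2 + 16 + n\<^sup>2 * dd e (cycles4 V) A)"
      by (rule E_mono) (rule pt)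
    then have "E (\<lambda>A. (dd e ?U A)\<^sup>2) \<le> 64 * E (\<lambda>A. (arc_count V A)\<^sup>2) + 16 + n\<^sup>2 * E (dd e (cycles4 V))"
      by (simp only: E_add E_cmult E_const)
    also have "n\<^sup>2 * E (dd e (cycles4 V)) \<le> n\<^sup>2 * (p ^ 3 * (8 * n\<^sup>2))"
      unfolding E_dd_cycles4 using p through1_le'[OF e] by (intro mult_left_mono) auto
    also have "\<dots> = 8 * (n ^ 4 * p ^ 3)" by (simp add: power2_eq_square power4_eq_xxxx)
    also have "\<dots> \<le> 8 * s\<^sup>2" using square_p_le(1) by simp
    also have "E (\<lambda>A. (arc_count V A)\<^sup>2) \<le> s\<^sup>2 / 4 + s / 2"
    proof -
      have "(N * p)\<^sup>2 \<le> (s / 2)\<^sup>2" using N_p_le p by (intro power_mono) auto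
      moreover have "p * (1 - p) * N \<le> N * p" using p by (simp add: algebra_simps)
      ultimately show ?thesis unfolding E_arc_count_square using N_p_le by (simp add: power_divide)
    qed
    finally have "E (\<lambda>A. (dd e ?U A)\<^sup>2) \<le> 64 * (s\<^sup>2 / 4 + s / 2) + 16 + 8 * s\<^sup>2" by simp
    moreover have "64 * (a / 4 + b / 2) + 16 + 8 * a \<le> 88 * a" if "b \<le> a" "1 \<le> b" for a b :: real
    proof -
      have "64 * (a / 4 + b / 2) + 16 + 8 * a = 24 * a + 32 * b + 16" by simp
      then show ?thesis using that by simp
    qed
    ultimately show ?thesis using square_p_le(5) p_dense order.trans by blast
  qed
  have d2: "E (\<lambda>A. dd f (dd e ?U) A * dd e (dd f ?U) A) \<le> 32 + 32 * n * p\<^sup>2 * through2 V e f"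
    if ef: "e \<in> all_arcs V" "f \<in> all_arcs V - {e}" for e f
  proof -
    have ne: "e \<noteq> f" "f \<in> all_arcs V" using ef by auto
    have pt: "dd f (dd e ?U) A * dd e (dd f ?U) A \<le> 32 + 32 * n * dd f (dd e (cycles4 V)) A" for A
    proof -
      define t where "t = dd f (dd e (cycles4 V)) A"
      have t: "0 \<le> t" "t \<le> 256 * n"
        using dd2_cycles4_bounds[OF ne(1), of V A] through2_le[OF finV ef(1) ne(2,1)] by (auto simp: t_def)
      have "dd f (dd e ?U) A * dd e (dd f ?U) A = (4 - t / 4)\<^sup>2"
        unfolding dd_commute[of e f] dd2_main_part[OF ef(1) ne(2,1)] t_def by (simp add: power2_eq_square)
      also have "\<dots> \<le> 32 + t\<^sup>2 / 8"
      proof -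
        have "32 + t\<^sup>2 / 8 - (4 - t / 4)\<^sup>2 = (4 + t / 4)\<^sup>2" by (simp add: power2_eq_square field_simps)
        also have "\<dots> \<ge> 0" by simp
        finally show ?thesis by simp
      qed
      also have "t\<^sup>2 / 8 \<le> 32 * n * t" using t mult_right_mono[OF t(2,1)] by (simp add: power2_eq_square)
      finally show ?thesis by (simp add: t_def)
    qed
    have "E (\<lambda>A. dd f (dd e ?U) A * dd e (dd f ?U) A) \<le> E (\<lambda>A. 32 + 32 * n * dd f (dd e (cycles4 V)) A)"
      by (rule E_mono) (rule pt)
    then show ?thesis
      by (simp only: E_add E_cmult E_const E_dd2_cycles4[OF ne(1)] mult.assoc)
  qed
  have nn: "0 \<le> 32 + 32 * n * p\<^sup>2 * through2 V e f" for e f by (simp add: through_nonneg)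
  have "E (\<lambda>A. (\<Sum>e\<in>all_arcs V. y e A * dd e ?U A)\<^sup>2)
      = p * (1 - p) * (\<Sum>e\<in>all_arcs V. E (\<lambda>A. (dd e ?U A)\<^sup>2))
        + (p * (1 - p))\<^sup>2 * (\<Sum>e\<in>all_arcs V. \<Sum>f\<in>all_arcs V - {e}. E (\<lambda>A. dd f (dd e ?U) A * dd e (dd f ?U) A))"
    by (rule E_square_sum_y) (rule indep_of_dd)
  also have "\<dots> \<le> p * 1 * (\<Sum>e\<in>all_arcs V. 88 * s\<^sup>2)
      + (p * 1)\<^sup>2 * (\<Sum>e\<in>all_arcs V. \<Sum>f\<in>all_arcs V. 32 + 32 * n * p\<^sup>2 * through2 V e f)"
  proof (intro add_mono)
    show "p * (1 - p) * (\<Sum>e\<in>all_arcs V. E (\<lambda>A. (dd e ?U A)\<^sup>2)) \<le> p * 1 * (\<Sum>e\<in>all_arcs V. 88 * s\<^sup>2)"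
      using p d1 by (intro mult_mono sum_mono) (auto intro!: sum_nonneg E_nonneg)
    have "(p * (1 - p))\<^sup>2 * (\<Sum>e\<in>all_arcs V. \<Sum>f\<in>all_arcs V - {e}. E (\<lambda>A. dd f (dd e ?U) A * dd e (dd f ?U) A))
        \<le> (p * (1 - p))\<^sup>2 * (\<Sum>e\<in>all_arcs V. \<Sum>f\<in>all_arcs V - {e}. 32 + 32 * n * p\<^sup>2 * through2 V e f)"
      using d2 by (intro mult_left_mono sum_mono) auto
    also have "\<dots> \<le> (p * 1)\<^sup>2 * (\<Sum>e\<in>all_arcs V. \<Sum>f\<in>all_arcs V. 32 + 32 * n * p\<^sup>2 * through2 V e f)"
      using p nn fin by (intro mult_mono power_mono sum_mono sum_mono2 sum_nonneg) auto
    finally show "(p * (1 - p))\<^sup>2 * (\<Sum>e\<in>all_arcs V. \<Sum>f\<in>all_arcs V - {e}. E (\<lambda>A. dd f (dd e ?U) A * dd e (dd f ?U) A))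
        \<le> (p * 1)\<^sup>2 * (\<Sum>e\<in>all_arcs V. \<Sum>f\<in>all_arcs V. 32 + 32 * n * p\<^sup>2 * through2 V e f)" .
  qed
  also have "(\<Sum>e\<in>all_arcs V. \<Sum>f\<in>all_arcs V. 32 + 32 * n * p\<^sup>2 * through2 V e f)
      = 32 * N\<^sup>2 + 128 * n * p\<^sup>2 * (\<Sum>e\<in>all_arcs V. through1 V e)"
    by (simp add: sum.distrib sum_distrib_left[symmetric] sum_through2[OF finV] power2_eq_square)
  also have "p * 1 * (\<Sum>e\<in>all_arcs V. 88 * s\<^sup>2) + (p * 1)\<^sup>2 * (32 * N\<^sup>2 + 128 * n * p\<^sup>2 * (\<Sum>e\<in>all_arcs V. through1 V e))
      \<le> 44 * s ^ 3 + (8 * s\<^sup>2 + 512 * s ^ 3)"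
  proof (intro add_mono)
    have "p * 1 * (\<Sum>e\<in>all_arcs V. 88 * s\<^sup>2) = 88 * s\<^sup>2 * (N * p)" by simp
    also have "\<dots> \<le> 88 * s\<^sup>2 * (s / 2)" using N_p_le by (intro mult_left_mono) auto
    also have "\<dots> = 44 * s ^ 3" by (simp add: power2_eq_square power3_eq_cube)
    finally show "p * 1 * (\<Sum>e\<in>all_arcs V. 88 * s\<^sup>2) \<le> 44 * s ^ 3" .
    have "(\<Sum>e\<in>all_arcs V. through1 V e) \<le> (\<Sum>e\<in>all_arcs V. 8 * n\<^sup>2)" by (intro sum_mono through1_le')
    also have "\<dots> \<le> 8 * n\<^sup>2 * (n\<^sup>2 / 2)" using mult_left_mono[OF N_le, of "8 * n\<^sup>2"] by (simp add: mult_ac)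
    also have "\<dots> = 4 * n ^ 4" by (simp add: power2_eq_square power4_eq_xxxx)
    finally have S: "(\<Sum>e\<in>all_arcs V. through1 V e) \<le> 4 * n ^ 4" .
    have "(p * 1)\<^sup>2 * (32 * N\<^sup>2 + 128 * n * p\<^sup>2 * (\<Sum>e\<in>all_arcs V. through1 V e))
        \<le> (p * 1)\<^sup>2 * (32 * (n\<^sup>2 / 2)\<^sup>2 + 128 * n * p\<^sup>2 * (4 * n ^ 4))"
      using N_le S by (intro mult_left_mono add_mono power_mono) auto
    also have "\<dots> = 8 * (n ^ 4 * p ^ 2) + 512 * (n ^ 5 * p ^ 4)"
      by (simp add: power2_eq_square algebra_simps power_numeral_reduce)
    also have "n ^ 5 * p ^ 4 \<le> n ^ 6 * p ^ 3"
      using n_pos p by (intro mult_mono power_increasing power_decreasing) auto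
    also have "n ^ 6 * p ^ 3 = s ^ 3" by (simp add: power_mult_distrib flip: power_mult)
    finally show "(p * 1)\<^sup>2 * (32 * N\<^sup>2 + 128 * n * p\<^sup>2 * (\<Sum>e\<in>all_arcs V. through1 V e)) \<le> 8 * s\<^sup>2 + 512 * s ^ 3"
      unfolding square_p_le(2) by simp
  qed
  \<comment> \<open>By \<open>s^2 \<le> s^3\<close> the coefficients add up to
    \<open>44 + 8 + 512 = 564\<close>, and \<open>24^2 = 576\<close>.\<close>
  also have "\<dots> \<le> 24\<^sup>2 * s ^ 3"
  proof -
    have "44 * b + (8 * a + 512 * b) \<le> 24\<^sup>2 * b" if "a \<le> b" "0 \<le> b" for a b :: real
      using that by simp
    moreover have "0 \<le> s ^ 3" using p by (intro zero_le_power) simp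
    ultimately show ?thesis using square_p_le(6) by blast
  qed
  finally show ?thesis .
qed

text \<open>Subtracting \<open>proj\<close> makes the means of the first derivatives vanish and
  those of the second bounded, so that \<open>efron_stein_third_order\<close> applies. The second
  level gives \<open>3600 / 4 = 900\<close>, the third \<open>81 * 4 * 4 * 8 / 2 = 5184\<close>, in
  total 6084.\<close>

lemma Var_main_part_proj: "Var (\<lambda>A. main_part V A - proj A) \<le> 6084 * s\<^sup>2"
proof -
  let ?g = "\<lambda>A. main_part V A - proj A"
  have dg: "dd e ?g = (\<lambda>A. dd e (main_part V) A - dd e proj A)" for e
    by (auto simp: dd_diff)
  have d2g: "dd f (dd e ?g) = (\<lambda>A. dd f (dd e (main_part V)) A - quad_coeff e f)"
    if "e \<in> all_arcs V" "f \<in> all_arcs V" for e f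
    unfolding dg dd_diff using dd2_proj[OF that] by (auto simp: dd_diff)
  have d3g: "dd h (dd f (dd e ?g)) A = dd h (dd f (dd e (main_part V))) A"
    if "e \<in> all_arcs V" "f \<in> all_arcs V" for e f h A
    unfolding d2g[OF that] by (simp add: dd_diff dd_const)
  have E1: "E (dd e ?g) = 0" if e: "e \<in> all_arcs V" for e
    unfolding dg E_diff lin_coeff_def[symmetric]
    by (simp add: dd_proj[OF e, abs_def] dd_proj[OF e] E_add E_sum E_y cong: Bochner_Integration.integral_cong sum.cong)
  \<comment> \<open>For disjoint arcs the mean is \<open>4 - t / 4\<close> with
    \<open>0 \<le> t \<le> 256\<close>, so at most 60 in absolute value; for adjacent arcs exactly 4
    is left.\<close>
  have E2: "(E (dd f (dd e ?g)))\<^sup>2 \<le> 3600" if ef: "e \<in> all_arcs V" "f \<in> all_arcs V" for e f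
  proof (cases "e = f")
    case True
    then show ?thesis unfolding d2g[OF ef] by (simp add: dd_dd_same[abs_def] quad_coeff_same cong: Bochner_Integration.integral_cong)
  next
    case False
    have "E (dd f (dd e ?g)) = 4 - p\<^sup>2 * through2 V e f / 4 - quad_coeff e f"
      unfolding d2g[OF ef] E_dd2_cycles4[OF False, symmetric]
      by (simp add: dd2_main_part[OF ef False] cong: Bochner_Integration.integral_cong)
    moreover have "\<bar>4 - p\<^sup>2 * through2 V e f / 4 - quad_coeff e f\<bar> \<le> 60"
    proof (cases "e \<inter> f = {}")
      case True
      have "p\<^sup>2 * through2 V e f \<le> 1 * 256"
        using p through2_disjoint_le[OF finV ef True] by (intro mult_mono) (auto simp: power_le_one through_nonneg)
      moreover have "0 \<le> p\<^sup>2 * through2 V e f" by (simp add: through_nonneg)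
      ultimately show ?thesis using True by (simp add: quad_coeff_def)
    next
      case False2: False
      then show ?thesis using False by (simp add: quad_coeff_def)
    qed
    ultimately show ?thesis using power_mono[of "\<bar>E (dd f (dd e ?g))\<bar>" 60 2] by simp
  qed
  \<comment> \<open>One factor of the square is bounded by 1296, and \<open>1296 / 16 = 81\<close>;
    keeping the other as \<open>through3\<close> allows the sum over all triples to be evaluated by
    double counting.\<close>
  have E3: "E (\<lambda>A. (dd h (dd f (dd e ?g)) A)\<^sup>2) \<le> 81 * through3 V e f h"
    if efh: "e \<in> all_arcs V" "f \<in> all_arcs V" "h \<in> all_arcs V" for e f h
  proof (rule E_le_const)
    fix A
    show "(dd h (dd f (dd e ?g)) A)\<^sup>2 \<le> 81 * through3 V e f h"
    proof (cases "distinct [e, f, h]")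
      case True
      define t where "t = dd h (dd f (dd e (cycles4 V))) A"
      have t: "0 \<le> t" "t \<le> through3 V e f h" "through3 V e f h \<le> 1296"
        using dd3_cycles4_bounds[OF True, of V A] through3_le[OF finV efh True] by (auto simp: t_def)
      have "(dd h (dd f (dd e ?g)) A)\<^sup>2 = t * t / 16"
        unfolding d3g[OF efh(1,2)] dd3_main_part[OF efh(1,2) True] t_def by (simp add: power2_eq_square)
      also have "\<dots> \<le> 1296 * through3 V e f h / 16" using t by (intro divide_right_mono mult_mono) auto
      finally show ?thesis by simp
    next
      case False
      have "dd h (dd f (dd e (main_part V))) A = 0"
      proof -
        consider "h = f" | "f = e" | "h = e" using False by auto
        then show ?thesis
        proof cases
          case 3
          have "dd e (dd f (dd e (main_part V))) A = dd f (dd e (dd e (main_part V))) A" by (rule dd_commute)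
          then show ?thesis using 3 by (simp add: dd_def[of f] dd_dd_same)
        qed (simp_all add: dd_dd_same dd_def[of h])
      qed
      then show ?thesis using d3g[OF efh(1,2)] by (simp add: through_nonneg)
    qed
  qed
  have "Var ?g \<le> p * (\<Sum>e\<in>all_arcs V. (E (dd e ?g))\<^sup>2)
      + p\<^sup>2 * (\<Sum>e\<in>all_arcs V. \<Sum>f\<in>all_arcs V. (E (dd f (dd e ?g)))\<^sup>2)
      + p ^ 3 * (\<Sum>e\<in>all_arcs V. \<Sum>f\<in>all_arcs V. \<Sum>h\<in>all_arcs V. E (\<lambda>A. (dd h (dd f (dd e ?g)) A)\<^sup>2))"
    by (rule efron_stein_third_order)
  also have "\<dots> \<le> p * (\<Sum>e\<in>all_arcs V. 0)
      + p\<^sup>2 * (\<Sum>e\<in>all_arcs V. \<Sum>f\<in>all_arcs V. 3600)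
      + p ^ 3 * (\<Sum>e\<in>all_arcs V. \<Sum>f\<in>all_arcs V. \<Sum>h\<in>all_arcs V. 81 * through3 V e f h)"
    using p E1 E2 E3 by (intro add_mono mult_left_mono sum_mono) auto
  also have "(\<Sum>e\<in>all_arcs V. \<Sum>f\<in>all_arcs V. \<Sum>h\<in>all_arcs V. 81 * through3 V e f h)
      = 1296 * (\<Sum>e\<in>all_arcs V. through1 V e)"
    by (simp add: sum_distrib_left[symmetric] sum_through2[OF finV] sum_through3[OF finV])
  also have "\<dots> \<le> 1296 * (\<Sum>e\<in>all_arcs V. 8 * n\<^sup>2)"
    by (intro mult_left_mono sum_mono through1_le') auto
  also have "\<dots> \<le> 5184 * n ^ 4"
    using mult_right_mono[OF N_le, of "n\<^sup>2"] by (simp add: power2_eq_square power4_eq_xxxx mult_ac)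
  also have "p * (\<Sum>e\<in>all_arcs V. 0) + p\<^sup>2 * (\<Sum>e\<in>all_arcs V. \<Sum>f\<in>all_arcs V. 3600) + p ^ 3 * (5184 * n ^ 4)
      = 3600 * (N * p)\<^sup>2 + 5184 * (n ^ 4 * p ^ 3)"
    by (simp add: power2_eq_square mult_ac)
  also have "\<dots> \<le> 3600 * (s / 2)\<^sup>2 + 5184 * s\<^sup>2"
    using N_p_le p square_p_le(1) by (intro add_mono mult_left_mono power_mono) auto
  also have "\<dots> = 6084 * s\<^sup>2" by (simp add: power2_eq_square)
  finally show ?thesis using p by (simp add: mult_left_mono)
qed

end

section \<open>Normal approximation on random graphs\<close>

definition arc_degree :: "'v set \<Rightarrow> 'v set \<Rightarrow> 'v set set \<Rightarrow> real" where
  "arc_degree V e A = (\<Sum>v\<in>e. degree_in V A v)"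

context random_graph
begin

lemma degree_in_bounds: "0 \<le> degree_in V A v" "degree_in V A v \<le> n"
proof -
  show "0 \<le> degree_in V A v" unfolding degree_in_def by (rule sum_nonneg) simp
  have "degree_in V A v \<le> (\<Sum>w\<in>V. 1)" unfolding degree_in_def by (rule sum_mono) simp
  then show "degree_in V A v \<le> n" by simp
qed

lemma arc_degree_bounds:
  assumes "e \<in> all_arcs V"
  shows "0 \<le> arc_degree V e A" "arc_degree V e A \<le> 2 * n"
proof -
  show "0 \<le> arc_degree V e A" unfolding arc_degree_def by (intro sum_nonneg degree_in_bounds)
  have "arc_degree V e A \<le> (\<Sum>v\<in>e. n)" unfolding arc_degree_def by (intro sum_mono degree_in_bounds)
  then show "arc_degree V e A \<le> 2 * n" using assms by (simp add: all_arcs_def)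
qed

lemma E_arc_degree_le:
  assumes "e \<in> all_arcs V"
  shows "E (arc_degree V e) \<le> 2 * n * p"
proof -
  have 1: "E (\<lambda>A. of_bool ({v, w} \<in> A)) \<le> p" for v w
  proof (cases "{v, w} \<in> all_arcs V")
    case True
    then show ?thesis using E_of_bool_mem by simp
  next
    case False
    have "E (\<lambda>A. of_bool ({v, w} \<in> A)) \<le> 0"
      by (rule E_le_const) (use False in auto)
    then show ?thesis using p by linarith
  qed
  have "E (arc_degree V e) = (\<Sum>v\<in>e. \<Sum>w\<in>V. E (\<lambda>A. of_bool ({v, w} \<in> A)))"
    unfolding arc_degree_def[abs_def] degree_in_def E_sum ..
  also have "\<dots> \<le> (\<Sum>v\<in>e. \<Sum>w\<in>V. p)" by (intro sum_mono 1)
  also have "\<dots> = 2 * n * p" using assms by (simp add: all_arcs_def)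
  finally show ?thesis .
qed

lemma Var_add_le: "Var (\<lambda>A. f A + g A) \<le> 2 * Var f + 2 * Var g"
proof -
  have "Var (\<lambda>A. f A + g A) = E (\<lambda>A. ((f A - E f) + (g A - E g))\<^sup>2)"
    unfolding Var_eq by (simp add: algebra_simps)
  also have "\<dots> \<le> E (\<lambda>A. 2 * (f A - E f)\<^sup>2 + 2 * (g A - E g)\<^sup>2)"
  proof (rule E_mono)
    fix A
    have "2 * a\<^sup>2 + 2 * b\<^sup>2 - (a + b)\<^sup>2 = (a - b)\<^sup>2" for a b :: real
      by (simp add: power2_eq_square algebra_simps)
    then show "((f A - E f) + (g A - E g))\<^sup>2 \<le> 2 * (f A - E f)\<^sup>2 + 2 * (g A - E g)\<^sup>2"
      by (metis diff_ge_0_iff_ge zero_le_power2)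
  qed
  finally show ?thesis by (simp only: E_add E_cmult Var_eq)
qed

text \<open>Cauchy-Schwarz against the centred number of arcs: by integration by parts its
  covariance with \<open>f\<close> is at least \<open>p * (1 - p) * N * \<kappa>\<close>, and its
  own variance is \<open>p * (1 - p) * N\<close>.\<close>

lemma Var_ge:
  assumes "\<And>e. e \<in> all_arcs V \<Longrightarrow> \<kappa> \<le> E (dd e f)" "0 \<le> \<kappa>"
  shows "p * (1 - p) * N * \<kappa>\<^sup>2 \<le> Var f"
proof (cases "N = 0")
  case True
  then show ?thesis unfolding Var_eq by (auto intro: E_nonneg)
next
  case False
  let ?Y = "\<lambda>A. \<Sum>e\<in>all_arcs V. y e A"
  let ?d = "p * (1 - p) * N"
  have d: "0 < ?d" using p False by simp
  have "?d * \<kappa> \<le> p * (1 - p) * (\<Sum>e\<in>all_arcs V. E (dd e f))"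
    using sum_mono[of "all_arcs V" "\<lambda>_. \<kappa>" "\<lambda>e. E (dd e f)"] assms(1) p by simp
  also have "\<dots> = E (\<lambda>A. ?Y A * (f A - E f))"
  proof -
    have "E (\<lambda>A. ?Y A * (f A - E f)) = (\<Sum>e\<in>all_arcs V. E (\<lambda>A. y e A * (f A - E f)))"
      by (simp only: sum_distrib_right E_sum)
    also have "\<dots> = (\<Sum>e\<in>all_arcs V. p * (1 - p) * E (dd e f))"
    proof (intro sum.cong refl)
      fix e assume "e \<in> all_arcs V"
      moreover have "dd e (\<lambda>A. f A - E f) = dd e f" by (auto simp: dd_def)
      ultimately show "E (\<lambda>A. y e A * (f A - E f)) = p * (1 - p) * E (dd e f)"
        by (simp only: E_y_mult)
    qed
    finally show ?thesis by (simp only: sum_distrib_left)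
  qed
  finally have "?d * \<kappa> \<le> E (\<lambda>A. ?Y A * (f A - E f))" .
  then have "(?d * \<kappa>)\<^sup>2 \<le> (E (\<lambda>A. ?Y A * (f A - E f)))\<^sup>2"
    using d assms(2) by (intro power_mono) auto
  also have "\<dots> \<le> E (\<lambda>A. (?Y A)\<^sup>2) * E (\<lambda>A. (f A - E f)\<^sup>2)" by (rule E_Cauchy_Schwarz)
  also have "\<dots> = ?d * Var f" by (simp only: E_sum_y_square Var_eq)
  finally have "?d * (?d * \<kappa>\<^sup>2) \<le> ?d * Var f"
    unfolding power_mult_distrib[of ?d] power2_eq_square[of ?d] mult.assoc[of ?d] .
  then show ?thesis using d by (simp only: mult_le_cancel_left_pos)
qed

end

context dense_random_graph
begin

text \<open>The lower bounds on \<open>n\<close> and \<open>s\<close> ensure that the lower order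
  terms in the mean of \<open>dd e K\<close>, of order \<open>n * p\<close> and 1, use up at most
  half of \<open>2 * \<delta> * s\<close>, the guaranteed size of the leading difference.\<close>

theorem graph_normal_approximation:
  fixes K Z :: "'v set set \<Rightarrow> real" and c0 \<delta> z :: real
  assumes K: "\<And>A. K A = main_part V A + Z A"
    and Z: "\<And>e A. e \<in> all_arcs V \<Longrightarrow> A \<subseteq> all_arcs V \<Longrightarrow> \<bar>dd e Z A\<bar> \<le> c0 * (1 + arc_degree V e A)"
    and c0: "1 \<le> c0" and \<delta>: "0 < \<delta>" "p \<le> 1 - \<delta>"
    and n_large: "(8 + 4 * c0) / \<delta> \<le> n" and s_large: "2 * c0 / \<delta> \<le> s"
  defines "C \<equiv> 111 + 4 * c0" \<comment> \<open>\<open>111\<^sup>2 \<ge> 2 * 6084\<close>, the bound of \<open>Var_main_part_proj\<close>\<close>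
    and "c \<equiv> \<delta> ^ 3 / 4"
  shows "\<bar>E (\<lambda>A. of_bool ((K A - E K) / sqrt (Var K) \<le> z)) - Phi z\<bar>
         \<le> ((2 * C + 10 * C\<^sup>2) / c + 7 * C / sqrt c) / (n * sqrt p)"
proof (rule normal_approximation_split[where U = "main_part V" and Z = Z and \<eta> = stein_coeff])
  let ?r = "n * sqrt p"
  have r2: "?r\<^sup>2 = s" using p by (simp add: power_mult_distrib)
  have r1: "1 \<le> ?r" 
  proof (rule power2_le_imp_le)
    show "1\<^sup>2 \<le> ?r\<^sup>2" unfolding r2 using p_dense by simp
  qed (use p in simp)
  have r6: "?r ^ 6 = s ^ 3" "?r ^ 10 = s ^ 5"
  proof -
    have "x ^ 6 = (x\<^sup>2) ^ 3" "x ^ 10 = (x\<^sup>2) ^ 5" for x :: real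
      by (simp_all flip: power_mult)
    from this[of ?r] show "?r ^ 6 = s ^ 3" "?r ^ 10 = s ^ 5" unfolding r2 .
  qed
  have n2: "2 \<le> n"
  proof -
    have "2 \<le> (12 :: real) / 1" by simp
    also have "(12 :: real) / 1 \<le> (8 + 4 * c0) / \<delta>" using c0 \<delta> p by (intro frac_le) auto
    finally show ?thesis using n_large by linarith
  qed
  have np: "n * p \<le> ?r"
  proof -
    have "p = sqrt p * sqrt p" using p by simp
    also have "\<dots> \<le> sqrt p * 1" using p by (intro mult_left_mono) auto
    finally show ?thesis by (intro mult_left_mono) auto
  qed
  have C: "111 \<le> C" "115 \<le> C" "c0 \<le> C" using c0 by (auto simp: C_def)
  show "K A = main_part V A + Z A" for A by (rule K)
  show "indep_of e (stein_coeff e)" if "e \<in> all_arcs V" for e using that by (rule indep_of_stein_coeff)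
  show "\<bar>stein_coeff e A\<bar> \<le> C * ?r\<^sup>2" if "e \<in> all_arcs V" for e A
  proof -
    have "10 * s \<le> C * s" using C p by (intro mult_right_mono) auto
    then show ?thesis using abs_stein_coeff_le[OF that, of A] unfolding r2 by linarith
  qed
  show "0 < c" using \<delta> by (simp add: c_def)
  show "0 < C" using C by simp
  show "0 < ?r" using r1 by linarith
  have EdZ: "E (\<lambda>A. \<bar>dd e Z A\<bar>) \<le> c0 * (1 + 2 * n * p)" if e: "e \<in> all_arcs V" for e
  proof -
    have "E (\<lambda>A. \<bar>dd e Z A\<bar>) \<le> E (\<lambda>A. c0 * (1 + arc_degree V e A))" by (intro E_mono Z e)
    also have "\<dots> = c0 * (1 + E (arc_degree V e))" by (simp only: E_cmult E_add E_const)
    also have "\<dots> \<le> c0 * (1 + 2 * n * p)" using E_arc_degree_le[OF e] c0 by (intro mult_left_mono) auto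
    finally show ?thesis .
  qed
  \<comment> \<open>In the square of the degree one factor is replaced by its maximum
    \<open>2 * n\<close>; the mean of the other makes the product of order \<open>s\<close>.\<close>
  have EdZ2: "E (\<lambda>A. (dd e Z A)\<^sup>2) \<le> 10 * c0\<^sup>2 * s" if e: "e \<in> all_arcs V" for e
  proof -
    have "(dd e Z A)\<^sup>2 \<le> c0\<^sup>2 * (2 + 4 * n * arc_degree V e A)" if A: "A \<subseteq> all_arcs V" for A
    proof -
      define t where "t = arc_degree V e A"
      have t: "0 \<le> t" "t \<le> 2 * n" using arc_degree_bounds[OF e] by (auto simp: t_def)
      have "(dd e Z A)\<^sup>2 \<le> (c0 * (1 + t))\<^sup>2"
        using power_mono[OF Z[OF e A] abs_ge_zero, of 2] by (simp add: t_def)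
      also have "\<dots> = c0\<^sup>2 * (2 + 2 * t\<^sup>2 - (1 - t)\<^sup>2)" by (simp add: power2_eq_square algebra_simps)
      also have "\<dots> \<le> c0\<^sup>2 * (2 + 4 * n * t)"
      proof (rule mult_left_mono)
        have "t\<^sup>2 \<le> 2 * n * t" using mult_right_mono[OF t(2,1)] by (simp add: power2_eq_square)
        then show "2 + 2 * t\<^sup>2 - (1 - t)\<^sup>2 \<le> 2 + 4 * n * t" using zero_le_power2[of "1 - t"] by linarith
      qed simp
      finally show ?thesis by (simp add: t_def)
    qed
    then have "E (\<lambda>A. (dd e Z A)\<^sup>2) \<le> E (\<lambda>A. c0\<^sup>2 * (2 + 4 * n * arc_degree V e A))" by (rule E_mono)
    also have "\<dots> = c0\<^sup>2 * (2 + 4 * n * E (arc_degree V e))" by (simp only: E_cmult E_add E_const)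
    also have "\<dots> \<le> c0\<^sup>2 * (2 + 4 * n * (2 * n * p))"
      using E_arc_degree_le[OF e] by (intro mult_left_mono add_left_mono) auto
    also have "\<dots> = c0\<^sup>2 * (2 * 1 + 8 * s)" by (simp add: power2_eq_square)
    also have "\<dots> \<le> c0\<^sup>2 * (2 * s + 8 * s)" using p_dense by (intro mult_left_mono add_right_mono) auto
    finally show ?thesis by (simp add: mult_ac)
  qed
  show "c * ?r ^ 6 \<le> Var K"
  proof -
    have mean: "\<delta> * s \<le> E (dd e K)" if e: "e \<in> all_arcs V" for e
    proof -
      \<comment> \<open>Here \<open>S\<close>, \<open>m\<close>, \<open>q\<close> and
        \<open>D\<close> stand for \<open>s\<close>, \<open>n * p\<close>, \<open>n^2 p^2\<close>
        and \<open>\<delta> * s\<close>. The gain \<open>2 * S - 2 * q\<close> is at least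
        \<open>2 * D\<close>, and the remaining terms cost at most \<open>D\<close>.\<close>
      have lin1: "4 * (S / 2 - m / 2 - p) + 2 - 2 * q - b \<le> x"
        if "x = 4 * a + 2 - t / 4 + z'" "a = w - p" "t \<le> 8 * q" "- b \<le> z'" "w = S / 2 - m / 2"
        for x a t z' w q b S m :: real
        using that by (simp add: right_diff_distrib)
      have lin2: "D \<le> x"
        if "4 * (S / 2 - m / 2 - p) + 2 - 2 * q - b \<le> x" "q \<le> S - D" "4 * p \<le> 2 * m"
          "b = c0 + c1" "4 * m + c1 \<le> D / 2" "c0 \<le> D / 2"
        for x q b S m D c1 :: real
        using that by (simp add: right_diff_distrib)
      have "dd e K = (\<lambda>A. 4 * arc_count V (A - {e}) + 2 - dd e (cycles4 V) A / 4 + dd e Z A)"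
        using dd_main_part[OF e] K by (auto simp: dd_def)
      then have "E (dd e K) = 4 * E (\<lambda>A. arc_count V (A - {e})) + 2 - E (dd e (cycles4 V)) / 4 + E (dd e Z)"
        by simp
      moreover have "E (\<lambda>A. arc_count V (A - {e})) = N * p - p"
      proof -
        have "arc_count V (A - {e}) = arc_count V A - of_bool (e \<in> A)" for A
          using arc_count_remove[OF e, of A] by (cases "e \<in> A") (auto simp: insert_absorb)
        then show ?thesis by (simp only: E_diff E_arc_count E_of_bool_mem[OF e])
      qed
      moreover have "E (dd e (cycles4 V)) \<le> 8 * (n\<^sup>2 * p * p)"
      proof -
        have "p ^ 3 * through1 V e \<le> p ^ 2 * (8 * n\<^sup>2)"
          using through1_le'[OF e] p by (intro mult_mono power_decreasing) (auto simp: through_nonneg)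
        then show ?thesis by (simp add: E_dd_cycles4 power2_eq_square mult_ac)
      qed
      moreover have "- (c0 * (1 + 2 * n * p)) \<le> E (dd e Z)"
        using EdZ[OF e] abs_E_le[of "dd e Z"] by linarith
      moreover have "N * p = s / 2 - n * p / 2" by (simp add: N_eq power2_eq_square field_simps)
      ultimately have "E (dd e K) \<ge> 4 * (s / 2 - n * p / 2 - p) + 2 - 2 * (n\<^sup>2 * p * p) - c0 * (1 + 2 * n * p)"
        by (rule lin1)
      moreover have "n\<^sup>2 * p * p \<le> s - \<delta> * s"
      proof -
        have "n\<^sup>2 * p * p \<le> s * (1 - \<delta>)" using \<delta> p by (intro mult_left_mono) auto
        then show ?thesis by (simp add: algebra_simps)
      qed
      moreover have "4 * p \<le> 2 * (n * p)" using mult_right_mono[OF n2, of p] p by simp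
      moreover have "c0 * (1 + 2 * n * p) = c0 + 2 * c0 * (n * p)" by (simp add: algebra_simps)
      moreover have "4 * (n * p) + 2 * c0 * (n * p) \<le> \<delta> * s / 2"
      proof -
        have "8 + 4 * c0 \<le> n * \<delta>" using n_large \<delta> by (simp add: field_simps)
        then have "(8 + 4 * c0) * (n * p) \<le> (n * \<delta>) * (n * p)" using p by (intro mult_right_mono) auto
        then show ?thesis by (simp add: power2_eq_square algebra_simps)
      qed
      moreover have "c0 \<le> \<delta> * s / 2" using s_large \<delta> by (simp add: field_simps)
      ultimately show ?thesis by (rule lin2)
    qed
    \<comment> \<open>The constant \<open>\<delta> ^ 3 / 4\<close> comes from
      \<open>\<delta> \<le> 1 - p\<close>, from \<open>n^2 / 4 \<le> N\<close> and from the square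
      of the mean derivative \<open>\<delta> * s\<close>.\<close>
    have "c * ?r ^ 6 = p * \<delta> * (n\<^sup>2 / 4) * (\<delta> * s)\<^sup>2"
      unfolding r6 c_def by (simp add: power2_eq_square power3_eq_cube)
    also have "\<dots> \<le> p * (1 - p) * N * (\<delta> * s)\<^sup>2"
    proof (intro mult_right_mono mult_mono)
      have "n * (n / 2) \<le> n * (n - 1)" using n2 by (intro mult_left_mono) auto
      then show "n\<^sup>2 / 4 \<le> N" unfolding N_eq by (simp add: power2_eq_square)
    qed (use p \<delta> in auto)
    also have "\<dots> \<le> Var K" by (rule Var_ge) (use mean \<delta> p in auto)
    finally show ?thesis .
  qed
  show "Var (\<lambda>A. p * (1 - p) * (\<Sum>e\<in>all_arcs V. stein_coeff e A * dd e (main_part V) A)) \<le> (C * ?r ^ 5)\<^sup>2"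
  proof -
    have "108\<^sup>2 * s ^ 5 \<le> C\<^sup>2 * s ^ 5" using C p by (intro mult_right_mono power_mono) auto
    also have "\<dots> = (C * ?r ^ 5)\<^sup>2" unfolding r6(2)[symmetric] power_mult_distrib[of C] power_mult[symmetric, of ?r] by simp
    finally show ?thesis using Var_quad by linarith
  qed
  show "E (\<lambda>A. (\<Sum>e\<in>all_arcs V. y e A * dd e (main_part V) A)\<^sup>2) \<le> (C * ?r ^ 3)\<^sup>2"
  proof -
    have "24\<^sup>2 * s ^ 3 \<le> C\<^sup>2 * s ^ 3" using C p by (intro mult_right_mono power_mono) auto
    also have "\<dots> = (C * ?r ^ 3)\<^sup>2" unfolding r6(1)[symmetric] power_mult_distrib[of C] power_mult[symmetric, of ?r] by simp
    finally show ?thesis using E_square_weighted by linarith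
  qed
  show "E (\<lambda>A. ((\<Sum>e\<in>all_arcs V. y e A * stein_coeff e A) - (K A - E K))\<^sup>2) \<le> (C * ?r\<^sup>2)\<^sup>2"
  proof -
    let ?g = "\<lambda>A. main_part V A - proj A"
    have VZ: "Var Z \<le> 5 * c0\<^sup>2 * s\<^sup>2"
    proof -
      have "Var Z \<le> p * (1 - p) * (\<Sum>e\<in>all_arcs V. E (\<lambda>A. (dd e Z A)\<^sup>2))" by (rule Var_le)
      also have "\<dots> \<le> p * 1 * (\<Sum>e\<in>all_arcs V. 10 * c0\<^sup>2 * s)"
        using p EdZ2 by (intro mult_mono sum_mono) (auto intro!: sum_nonneg E_nonneg)
      also have "\<dots> = 10 * c0\<^sup>2 * s * (N * p)" by simp
      also have "\<dots> \<le> 10 * c0\<^sup>2 * s * (s / 2)" using N_p_le p by (intro mult_left_mono) auto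
      finally show ?thesis by (simp add: power2_eq_square mult_ac)
    qed
    have "E (\<lambda>A. ((\<Sum>e\<in>all_arcs V. y e A * stein_coeff e A) - (K A - E K))\<^sup>2)
        = E (\<lambda>A. (proj A - (K A - E K))\<^sup>2)" by (simp only: proj_def)
    also have "\<dots> = Var (\<lambda>A. ?g A + Z A)"
    proof -
      have eq: "(\<lambda>A. ?g A + Z A) = (\<lambda>A. K A - proj A)" using K by auto
      have "E (\<lambda>A. K A - proj A) = E K" by (simp only: E_diff E_proj diff_zero)
      moreover have "(proj A - (K A - E K))\<^sup>2 = (K A - proj A - E K)\<^sup>2" for A
        by (simp add: power2_eq_square algebra_simps)
      ultimately show ?thesis unfolding eq Var_eq by (simp only:)
    qed
    also have "\<dots> \<le> 2 * Var ?g + 2 * Var Z" by (rule Var_add_le)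
    also have "\<dots> \<le> 2 * (6084 * s\<^sup>2) + 2 * (5 * c0\<^sup>2 * s\<^sup>2)"
      using Var_main_part_proj VZ by (intro add_mono mult_left_mono) auto
    also have "\<dots> = (12168 + 10 * c0\<^sup>2) * s\<^sup>2" by (simp add: algebra_simps)
    also have "\<dots> \<le> C\<^sup>2 * s\<^sup>2"
    proof (rule mult_right_mono)
      have "C\<^sup>2 = 12321 + 888 * c0 + 16 * c0\<^sup>2" by (simp add: C_def power2_eq_square algebra_simps)
      then show "12168 + 10 * c0\<^sup>2 \<le> C\<^sup>2" using c0 by simp
    qed simp
    also have "\<dots> = (C * ?r\<^sup>2)\<^sup>2" unfolding r2 by (simp add: power_mult_distrib)
    finally show ?thesis .
  qed
  show "p * (\<Sum>e\<in>all_arcs V. E (\<lambda>A. \<bar>dd e Z A\<bar>)) \<le> C * ?r ^ 3"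
  proof -
    have "p * (\<Sum>e\<in>all_arcs V. E (\<lambda>A. \<bar>dd e Z A\<bar>)) \<le> p * (\<Sum>e\<in>all_arcs V. c0 * (1 + 2 * n * p))"
      using p EdZ by (intro mult_left_mono sum_mono) auto
    also have "\<dots> = (N * p) * (c0 * (1 + 2 * (n * p)))" by simp
    also have "\<dots> \<le> (s / 2) * (c0 * (?r + 2 * ?r))"
    proof (intro mult_mono)
      show "1 + 2 * (n * p) \<le> ?r + 2 * ?r" using r1 np by linarith
    qed (use N_p_le c0 p in auto)
    also have "\<dots> = 3 / 2 * c0 * ?r ^ 3" unfolding r2[symmetric] by (simp add: power2_eq_square power3_eq_cube)
    also have "\<dots> \<le> C * ?r ^ 3" using c0 r1 by (intro mult_right_mono) (auto simp: C_def)
    finally show ?thesis .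
  qed
qed

end

section \<open>Simplices and unimodular triangulations\<close>

abbreviation "lk \<equiv> Poly_Mapping.lookup"

lemma lookup_scaleR: "lk (r *\<^sub>R x) i = r *\<^sub>R lk x i"
proof -
  have "finite {i. lk x i \<noteq> 0}" by (rule finite_lookup)
  then have "finite {i. r *\<^sub>R lk x i \<noteq> 0}"
    by (rule rev_finite_subset) auto
  then show ?thesis by (simp add: scaleR_poly_mapping_def)
qed

lemma lookup_unit_vec: "lk (unit_vec i) j = of_bool (i = j)"
  by (simp add: unit_vec_def lookup_single when_def)

lemma affine_hull_translate_span:
  assumes "a \<in> B"
  shows "affine hull B = (\<lambda>x. a + x) ` span ((\<lambda>x. - a + x) ` (B - {a}))"
  using affine_hull_insert_span_gen[of a "B - {a}"] assms by (simp add: insert_absorb)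

text \<open>Makes the choice in \<open>affdim\<close> unambiguous: translated to the origin, the two
  sets without one point each are bases of the same linear span.\<close>

lemma affine_independent_card_unique:
  fixes B B' :: "'a::real_vector set"
  assumes "finite B" "\<not> affine_dependent B" "finite B'" "\<not> affine_dependent B'"
    and hull: "affine hull B = affine hull B'"
  shows "card B = card B'"
proof (cases "B = {}")
  case True
  then have "affine hull B' = {}" using hull by simp
  then have "B' = {}" using hull_subset[of B' affine] by auto
  then show ?thesis using True by simp
next
  case False
  then obtain a where a: "a \<in> B" by auto
  have "affine hull B \<noteq> {}" using a hull_inc[of a B affine] by auto
  then have "B' \<noteq> {}" using hull by auto
  then obtain b where b: "b \<in> B'" by auto
  let ?T = "(\<lambda>x. - a + x) ` (B - {a})" and ?T' = "(\<lambda>x. - b + x) ` (B' - {b})"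
  have ind: "independent ?T" "independent ?T'"
    using assms a b affine_dependent_iff_dependent2 by blast+
  have "b - a \<in> span ?T"
  proof -
    have "b \<in> affine hull B" using b hull hull_inc[of b B' affine] by auto
    then show ?thesis unfolding affine_hull_translate_span[OF a] by auto
  qed
  have "span ?T = span ?T'"
  proof -
    have e: "(\<lambda>x. a + x) ` span ?T = (\<lambda>x. b + x) ` span ?T'"
      using hull affine_hull_translate_span[OF a] affine_hull_translate_span[OF b] by simp
    have "x \<in> span ?T'" if x: "x \<in> span ?T" for x
    proof -
      have "x + (b - a) \<in> span ?T" using x \<open>b - a \<in> span ?T\<close> by (rule span_add)
      then have "a + (x + (b - a)) \<in> (\<lambda>x. b + x) ` span ?T'" unfolding e[symmetric] by blast
      then show ?thesis by auto
    qed
    moreover have "x \<in> span ?T" if x: "x \<in> span ?T'" for x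
    proof -
      have "b + x \<in> (\<lambda>x. a + x) ` span ?T" unfolding e using x by blast
      then obtain y where y: "y \<in> span ?T" "b + x = a + y" by auto
      then have "x = y - (b - a)" by (simp add: algebra_simps)
      then show ?thesis using span_diff[OF y(1) \<open>b - a \<in> span ?T\<close>] by simp
    qed
    ultimately show ?thesis by auto
  qed
  then have "card ?T = card ?T'"
    using dim_span_eq_card_independent[OF ind(1)] dim_span_eq_card_independent[OF ind(2)] by simp
  then have "card (B - {a}) = card (B' - {b})" by (simp add: card_image)
  then show ?thesis using assms(1,3) a b by (metis card.remove)
qed

lemma affdim_eqI:
  assumes "finite B" "\<not> affine_dependent B" "affine hull B = affine hull S"
  shows "affdim S = int (card B) - 1"
  unfolding affdim_def
proof (rule some_equality)
  show "\<exists>B'. finite B' \<and> \<not> affine_dependent B' \<and> affine hull B' = affine hull S \<and> int (card B') = int (card B) - 1 + 1"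
    using assms by (intro exI[of _ B]) auto
next
  fix d assume "\<exists>B'. finite B' \<and> \<not> affine_dependent B' \<and> affine hull B' = affine hull S \<and> int (card B') = d + 1"
  then obtain B' where "finite B'" "\<not> affine_dependent B'" "affine hull B' = affine hull S" "int (card B') = d + 1"
    by blast
  then show "d = int (card B) - 1"
    using affine_independent_card_unique[of B' B] assms by simp
qed

lemma disjoint_affine_hull_independent:
  fixes C :: "'a::real_vector set"
  assumes "finite C" "\<not> affine_dependent C" "D \<subseteq> C"
  shows "affine hull D \<inter> affine hull (C - D) = {}"
proof (rule ccontr)
  assume "\<not> ?thesis"
  then obtain y where y: "y \<in> affine hull D" "y \<in> affine hull (C - D)" by auto
  have fin: "finite D" "finite (C - D)" using assms finite_subset by auto
  obtain a where a: "sum a D = 1" "(\<Sum>v\<in>D. a v *\<^sub>R v) = y"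
    using y(1) affine_hull_finite[OF fin(1)] by auto
  obtain b where b: "sum b (C - D) = 1" "(\<Sum>v\<in>C - D. b v *\<^sub>R v) = y"
    using y(2) affine_hull_finite[OF fin(2)] by auto
  define u where "u v = (if v \<in> D then a v else - b v)" for v
  have C: "sum g C = sum g D + sum g (C - D)" for g :: "'a \<Rightarrow> 'b::ab_group_add"
    using sum.subset_diff[OF assms(3,1), of g] by (simp add: add.commute)
  have s1: "sum u D = 1" using a(1) by (simp add: u_def)
  have s2: "sum u (C - D) = - 1"
    using b(1) by (simp add: u_def sum_negf)
  have v1: "(\<Sum>v\<in>D. u v *\<^sub>R v) = y" using a(2) by (simp add: u_def)
  have v2: "(\<Sum>v\<in>C - D. u v *\<^sub>R v) = - y" using b(2) by (simp add: u_def sum_negf)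
  have "\<exists>v\<in>D. u v \<noteq> 0" using s1 by (metis sum.neutral zero_neq_one)
  then have "\<exists>v\<in>C. u v \<noteq> 0" using assms(3) by auto
  moreover have "sum u C = 0" using C[of u] s1 s2 by simp
  moreover have "(\<Sum>v\<in>C. u v *\<^sub>R v) = 0" using C[of "\<lambda>v. u v *\<^sub>R v"] v1 v2 by simp
  ultimately have "affine_dependent C" using affine_dependent_explicit_finite[OF assms(1)] by blast
  then show False using assms(2) by simp
qed

lemma face_of_simplex:
  fixes C :: "'a::real_vector set"
  assumes "finite C" "\<not> affine_dependent C" "D \<subseteq> C"
  shows "convex hull D face_of convex hull C"
proof (rule face_of_convex_hulls[OF assms(1,3)])
  show "affine hull D \<inter> convex hull (C - D) = {}"
    using disjoint_affine_hull_independent[OF assms] convex_hull_subset_affine_hull[of "C - D"] by blast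
qed

text \<open>In a convex combination representing a point \<open>x\<close> of the face, a generator
  \<open>c\<close> of weight strictly between 0 and 1 spans an open segment through \<open>x\<close>
  with the weighted mean \<open>z\<close> of the others, and therefore belongs to the face.\<close>

lemma face_of_convex_hull_eq:
  fixes C :: "'a::real_vector set"
  assumes "finite C" and F: "F face_of convex hull C"
  shows "F = convex hull (F \<inter> C)"
proof
  have "convex F" using F by (rule face_of_imp_convex)
  then show "convex hull (F \<inter> C) \<subseteq> F" by (intro hull_minimal) auto
  show "F \<subseteq> convex hull (F \<inter> C)"
  proof
    fix x assume x: "x \<in> F"
    then have "x \<in> convex hull C" using face_of_imp_subset[OF F] by auto
    then obtain u where u: "\<And>c. c \<in> C \<Longrightarrow> 0 \<le> u c" "sum u C = 1" "(\<Sum>c\<in>C. u c *\<^sub>R c) = x"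
      using convex_hull_finite[OF assms(1)] by auto
    have mem: "c \<in> F" if c: "c \<in> C" "u c \<noteq> 0" for c
    proof (cases "u c = 1")
      case True
      have "sum u (C - {c}) = 0" using sum.remove[OF assms(1) c(1), of u] u(2) True by simp
      then have "u d = 0" if "d \<in> C - {c}" for d
        using that sum_nonneg_eq_0_iff[of "C - {c}" u] assms(1) u(1) by auto
      then have "x = c"
        using sum.remove[OF assms(1) c(1), of "\<lambda>c. u c *\<^sub>R c"] u(3) True by simp
      then show ?thesis using x by simp
    next
      case False
      have pos: "0 < u c" using u(1)[OF c(1)] c(2) by simp
      have rest: "sum u (C - {c}) = 1 - u c" using sum.remove[OF assms(1) c(1), of u] u(2) by simp
      have "0 \<le> sum u (C - {c})" using u(1) by (intro sum_nonneg) auto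
      then have lt: "u c < 1" using rest False by simp
      define z where "z = (\<Sum>d\<in>C - {c}. (u d / (1 - u c)) *\<^sub>R d)"
      have "z \<in> convex hull (C - {c})"
        unfolding z_def
      proof (rule convex_sum)
        show "(\<Sum>d\<in>C - {c}. u d / (1 - u c)) = 1" using rest lt by (simp add: sum_divide_distrib[symmetric])
      qed (use assms(1) u(1) lt in \<open>auto intro: hull_inc\<close>)
      then have z: "z \<in> convex hull C" using hull_mono[of "C - {c}" C convex] by auto
      have "(1 - u c) *\<^sub>R z = (\<Sum>d\<in>C - {c}. u d *\<^sub>R d)"
        using lt by (simp add: z_def scaleR_sum_right)
      then have xe: "x = (1 - (1 - u c)) *\<^sub>R c + (1 - u c) *\<^sub>R z"
        using sum.remove[OF assms(1) c(1), of "\<lambda>c. u c *\<^sub>R c"] u(3) by simp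
      show ?thesis
      proof (cases "c = z")
        case True
        then have "x = c" using xe by (simp add: scaleR_left_distrib[symmetric])
        then show ?thesis using x by simp
      next
        case False
        then have "x \<in> open_segment c z"
          unfolding in_segment using xe pos lt by (intro conjI exI[of _ "1 - u c"]) auto
        then show ?thesis using face_ofD[OF F _ hull_inc[OF c(1)] z x] by blast
      qed
    qed
    have "x = (\<Sum>c\<in>F \<inter> C. u c *\<^sub>R c)"
      unfolding u(3)[symmetric] using assms(1) mem by (intro sum.mono_neutral_right) auto
    moreover have "sum u (F \<inter> C) = 1"
      unfolding u(2)[symmetric] using assms(1) mem by (intro sum.mono_neutral_left) auto
    ultimately show "x \<in> convex hull (F \<inter> C)"
      using assms(1) u(1) by (simp only:) (rule convex_sum, auto intro: hull_inc)
  qed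
qed

lemma edge_face_of_simplex_iff:
  fixes C :: "'a::real_vector set"
  assumes "finite C" "\<not> affine_dependent C"
  shows "F face_of convex hull C \<and> affdim F = 1
    \<longleftrightarrow> (\<exists>v w. v \<in> C \<and> w \<in> C \<and> v \<noteq> w \<and> F = convex hull {v, w})"
proof
  assume F: "F face_of convex hull C \<and> affdim F = 1"
  define D where "D = F \<inter> C"
  have D: "finite D" "\<not> affine_dependent D" "D \<subseteq> C" "F = convex hull D"
    using assms affine_dependent_subset[of D C] face_of_convex_hull_eq[OF assms(1), of F] F
    by (auto simp: D_def)
  have "affdim F = int (card D) - 1"
    using D by (intro affdim_eqI) auto
  then have "card D = 2" using F by simp
  then obtain v w where "D = {v, w}" "v \<noteq> w" unfolding card_2_iff by blast
  then show "\<exists>v w. v \<in> C \<and> w \<in> C \<and> v \<noteq> w \<and> F = convex hull {v, w}"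
    using D(3,4) by (intro exI[of _ v] exI[of _ w]) simp
next
  assume "\<exists>v w. v \<in> C \<and> w \<in> C \<and> v \<noteq> w \<and> F = convex hull {v, w}"
  then obtain v w where vw: "v \<in> C" "w \<in> C" "v \<noteq> w" "F = convex hull {v, w}" by blast
  have "affdim F = int (card {v, w}) - 1" unfolding vw(4) by (intro affdim_eqI) auto
  then show "F face_of convex hull C \<and> affdim F = 1"
    using face_of_simplex[OF assms, of "{v, w}"] vw by auto
qed

text \<open>Serves twice: for lattice points in the double of the standard simplex, and for the
  positive and negative parts of lattice points in the double of the polytope.\<close>

lemma nat_fun_sum_cases:
  fixes g :: "'i \<Rightarrow> nat"
  assumes "finite V"
  shows "sum g V = 0 \<Longrightarrow> \<forall>k\<in>V. g k = 0"
    and "sum g V = 1 \<Longrightarrow> \<exists>i\<in>V. \<forall>k\<in>V. g k = of_bool (i = k)"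
    and "sum g V = 2 \<Longrightarrow> \<exists>i\<in>V. \<exists>j\<in>V. \<forall>k\<in>V. g k = of_bool (i = k) + of_bool (j = k)"
proof -
  show "sum g V = 0 \<Longrightarrow> \<forall>k\<in>V. g k = 0" using assms by simp
  have one: "\<exists>i\<in>V. \<forall>k\<in>V. h k = of_bool (i = k)" if h1: "sum h V = 1" for h :: "'i \<Rightarrow> nat"
  proof -
    have "\<not> (\<forall>i\<in>V. h i = 0)"
    proof
      assume "\<forall>i\<in>V. h i = 0"
      then have "sum h V = 0" by simp
      with h1 show False by simp
    qed
    then obtain i where i: "i \<in> V" "h i \<noteq> 0" by blast
    have "sum h V = h i + sum h (V - {i})" using sum.remove[OF assms i(1)] .
    then have "h i = 1" "sum h (V - {i}) = 0" using i h1 by auto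
    then show ?thesis using i assms by (intro bexI[of _ i]) auto
  qed
  then show "sum g V = 1 \<Longrightarrow> \<exists>i\<in>V. \<forall>k\<in>V. g k = of_bool (i = k)" .
  assume 2: "sum g V = 2"
  then have "\<not> (\<forall>i\<in>V. g i = 0)" by (metis sum.neutral zero_neq_numeral)
  then obtain i where i: "i \<in> V" "g i \<noteq> 0" by blast
  define h where "h k = g k - of_bool (i = k)" for k
  have "sum g V = (\<Sum>k\<in>V. h k + of_bool (i = k))"
    using i by (intro sum.cong) (auto simp: h_def)
  also have "\<dots> = sum h V + 1" using assms i by (simp add: sum.distrib of_bool_def)
  finally have "sum h V = 1" using 2 by simp
  then obtain j where j: "j \<in> V" "\<forall>k\<in>V. h k = of_bool (j = k)" using one by blast
  have "g k = of_bool (i = k) + of_bool (j = k)" if "k \<in> V" for k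
  proof -
    have "g k = of_bool (i = k) + h k" using i by (cases "i = k") (auto simp: h_def)
    then show ?thesis using j that by simp
  qed
  then show "\<exists>i\<in>V. \<exists>j\<in>V. \<forall>k\<in>V. g k = of_bool (i = k) + of_bool (j = k)"
    using i j by blast
qed

section \<open>Lattice points of the standard simplex and of its double\<close>

definition std_vertices :: "nat \<Rightarrow> nat coords set" where
  "std_vertices d = insert 0 (unit_vec ` {..<d})"

lemma unit_vec_eq_iff [simp]: "unit_vec i = unit_vec j \<longleftrightarrow> i = j"
  by (metis lookup_unit_vec of_bool_eq_iff)

lemma card_std_vertices: "card (std_vertices d) = d + 1"
proof -
  have "(0 :: nat coords) \<notin> unit_vec ` {..<d}"
  proof
    assume "(0 :: nat coords) \<in> unit_vec ` {..<d}"
    then obtain i where "(0 :: nat coords) = unit_vec i" by auto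
    then have "lk (0 :: nat coords) i = 1" by (metis lookup_unit_vec of_bool_eq(2))
    then show False by simp
  qed
  moreover have "card (unit_vec ` {..<d} :: nat coords set) = d" by (simp add: card_image inj_on_def)
  ultimately show ?thesis unfolding std_vertices_def by (simp add: card_insert_if)
qed

lemma standard_simplex_bounds:
  assumes "z \<in> standard_simplex d"
  shows "z \<in> coord_space {..<d}" "\<And>i. 0 \<le> lk z i" "(\<Sum>i<d. lk z i) \<le> 1"
proof -
  let ?H = "{z :: nat coords. (\<forall>i. i \<notin> {..<d} \<longrightarrow> lk z i = 0) \<and>
    (\<forall>i. 0 \<le> lk z i) \<and> (\<Sum>i<d. lk z i) \<le> 1}"
  have "convex ?H"
    unfolding convex_def
  proof (intro ballI allI impI)
    fix x y :: "nat coords" and u v :: real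
    assume x: "x \<in> ?H" and y: "y \<in> ?H" and uv: "0 \<le> u" "0 \<le> v" "u + v = 1"
    have "(\<Sum>i<d. lk (u *\<^sub>R x + v *\<^sub>R y) i)
        = u * (\<Sum>i<d. lk x i) + v * (\<Sum>i<d. lk y i)"
      by (simp add: lookup_add lookup_scaleR sum.distrib sum_distrib_left)
    also have "\<dots> \<le> u * 1 + v * 1" using x y uv by (intro add_mono mult_left_mono) auto
    finally show "u *\<^sub>R x + v *\<^sub>R y \<in> ?H"
      using x y uv by (auto simp: lookup_add lookup_scaleR)
  qed
  moreover have "insert 0 (unit_vec ` {..<d}) \<subseteq> ?H"
    by (auto simp: lookup_unit_vec of_bool_def)
  ultimately have "standard_simplex d \<subseteq> ?H"
    unfolding standard_simplex_def by (intro hull_minimal)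
  then have "z \<in> ?H" using assms by auto
  then show "z \<in> coord_space {..<d}" "\<And>i. 0 \<le> lk z i" "(\<Sum>i<d. lk z i) \<le> 1"
    by (auto simp: coord_space_def in_keys_iff)
qed

lemma std_vertices_subset: "std_vertices d \<subseteq> standard_simplex d" "std_vertices d \<subseteq> int_lattice {..<d}"
proof -
  show "std_vertices d \<subseteq> standard_simplex d"
    unfolding std_vertices_def standard_simplex_def by (rule hull_subset)
  show "std_vertices d \<subseteq> int_lattice {..<d}"
    by (auto simp: std_vertices_def int_lattice_def coord_space_def lookup_unit_vec of_bool_def in_keys_iff
        split: if_splits)
qed

text \<open>The coordinates are nonnegative integers of total at most 2; the vertex 0 supplies what
  is missing to a sum of exactly two vertices.\<close>

lemma std_double_lattice_point:
  assumes x: "x \<in> int_lattice {..<d}" and nn: "\<And>i. 0 \<le> lk x i"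
    and le: "(\<Sum>i<d. lk x i) \<le> 2"
  shows "\<exists>u\<in>std_vertices d. \<exists>v\<in>std_vertices d. x = u + v"
    and "(\<Sum>i<d. lk x i) \<le> 1 \<Longrightarrow> x \<in> std_vertices d"
proof -
  define g where "g i = nat \<lfloor>lk x i\<rfloor>" for i
  have g: "lk x i = real (g i)" for i
  proof -
    have "lk x i \<in> \<int>" using x by (auto simp: int_lattice_def)
    then show ?thesis using nn[of i] by (auto simp: g_def elim!: Ints_cases)
  qed
  have out: "lk x i = 0" if "i \<notin> {..<d}" for i
    using x that by (auto simp: int_lattice_def coord_space_def in_keys_iff)
  have eqI: "x = z" if "\<forall>k\<in>{..<d}. real (g k) = lk z k" "\<And>k. k \<notin> {..<d} \<Longrightarrow> lk z k = 0" for z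
    by (rule poly_mapping_eqI) (metis that g out)
  have s: "(\<Sum>i<d. lk x i) = real (sum g {..<d})" by (simp add: g)
  have c0: "x = 0" if "sum g {..<d} = 0"
    using nat_fun_sum_cases(1)[OF _ that] by (intro eqI) auto
  have c1: "\<exists>i<d. x = unit_vec i" if s1: "sum g {..<d} = 1"
  proof -
    obtain i where "i < d" "\<forall>k\<in>{..<d}. g k = of_bool (i = k)"
      using nat_fun_sum_cases(2)[OF _ s1] by auto
    then have "x = unit_vec i" by (intro eqI) (auto simp: lookup_unit_vec)
    then show ?thesis using \<open>i < d\<close> by auto
  qed
  have c2: "\<exists>i<d. \<exists>j<d. x = unit_vec i + unit_vec j" if s2: "sum g {..<d} = 2"
  proof -
    obtain i j where ij: "i < d" "j < d" "\<forall>k\<in>{..<d}. g k = of_bool (i = k) + of_bool (j = k)"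
      using nat_fun_sum_cases(3)[OF _ s2] by auto
    then have "x = unit_vec i + unit_vec j" by (intro eqI) (auto simp: lookup_unit_vec lookup_add)
    then show ?thesis using ij by auto
  qed
  show "x \<in> std_vertices d" if "(\<Sum>i<d. lk x i) \<le> 1"
  proof -
    have "sum g {..<d} = 0 \<or> sum g {..<d} = 1" using that s by linarith
    then show ?thesis using c0 c1 by (auto simp: std_vertices_def)
  qed
  have "sum g {..<d} = 0 \<or> sum g {..<d} = 1 \<or> sum g {..<d} = 2" using le s by linarith
  then show "\<exists>u\<in>std_vertices d. \<exists>v\<in>std_vertices d. x = u + v"
  proof (elim disjE)
    assume "sum g {..<d} = 2"
    then show ?thesis using c2 unfolding std_vertices_def by blast
  next
    assume "sum g {..<d} = 0"
    then show ?thesis using c0 unfolding std_vertices_def by (metis add.right_neutral insertI1)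
  next
    assume "sum g {..<d} = 1"
    then obtain i where "i < d" "x = unit_vec i + 0" using c1 by auto
    then show ?thesis unfolding std_vertices_def by blast
  qed
qed

text \<open>A standard vertex is the indicator of a set with at most one element, and a sum of two
  indicators determines the union and the intersection of the sets.\<close>

lemma std_vertices_sum_unique:
  assumes "a \<in> std_vertices d" "b \<in> std_vertices d" "a' \<in> std_vertices d" "b' \<in> std_vertices d" "a + b = a' + b'"
  shows "{a, b} = {a', b'}"
proof -
  have l: "lk a k + lk b k = lk a' k + lk b' k" for k
    using assms(5) by (metis lookup_add)
  have v: "\<exists>S. (S = {} \<or> (\<exists>i. S = {i})) \<and> (\<forall>k. lk u k = of_bool (k \<in> S))"
    if u: "u \<in> std_vertices d" for u
  proof (cases "u = 0")
    case True
    then show ?thesis by (intro exI[of _ "{}"]) simp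
  next
    case False
    then obtain i where "u = unit_vec i" using u by (auto simp: std_vertices_def)
    then show ?thesis by (intro exI[of _ "{i}"]) (auto simp: lookup_unit_vec)
  qed
  obtain A where A: "A = {} \<or> (\<exists>i. A = {i})" "\<And>k. lk a k = of_bool (k \<in> A)" using v[OF assms(1)] by blast
  obtain B where B: "B = {} \<or> (\<exists>i. B = {i})" "\<And>k. lk b k = of_bool (k \<in> B)" using v[OF assms(2)] by blast
  obtain A' where A': "A' = {} \<or> (\<exists>i. A' = {i})" "\<And>k. lk a' k = of_bool (k \<in> A')" using v[OF assms(3)] by blast
  obtain B' where B': "B' = {} \<or> (\<exists>i. B' = {i})" "\<And>k. lk b' k = of_bool (k \<in> B')" using v[OF assms(4)] by blast
  have m: "(of_bool (k \<in> A) :: real) + of_bool (k \<in> B) = of_bool (k \<in> A') + of_bool (k \<in> B')" for k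
    using l[of k] unfolding A(2) B(2) A'(2) B'(2) .
  have un: "(k \<in> A \<or> k \<in> B) = (k \<in> A' \<or> k \<in> B')" "(k \<in> A \<and> k \<in> B) = (k \<in> A' \<and> k \<in> B')" for k
    using m[of k] by (auto simp: of_bool_def split: if_splits)
  have "(A = A' \<and> B = B') \<or> (A = B' \<and> B = A')"
  proof (cases "A = {}")
    case True
    then have *: "(k \<in> B) = (k \<in> A' \<or> k \<in> B')" "\<not> (k \<in> A' \<and> k \<in> B')" for k using un[of k] by auto
    have "A' = {} \<or> B' = {}"
    proof (rule ccontr)
      assume "\<not> (A' = {} \<or> B' = {})"
      then obtain i j where "i \<in> A'" "j \<in> B'" by blast
      then have "i \<in> B" "j \<in> B" using * by auto
      then have "i = j" using B(1) by auto
      then show False using *(2)[of i] \<open>i \<in> A'\<close> \<open>j \<in> B'\<close> by auto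
    qed
    then show ?thesis using * True by auto
  next
    case False
    then obtain i where i: "A = {i}" using A(1) by auto
    have "i \<in> A' \<or> i \<in> B'" using un(1)[of i] i by auto
    then show ?thesis
    proof
      assume "i \<in> A'"
      then have "A' = A" using A'(1) i by auto
      moreover have "(k \<in> B) = (k \<in> B')" for k using un[of k] calculation by blast
      ultimately show ?thesis by blast
    next
      assume "i \<in> B'"
      then have "B' = A" using B'(1) i by auto
      moreover have "(k \<in> B) = (k \<in> A')" for k using un[of k] calculation by blast
      ultimately show ?thesis by blast
    qed
  qed
  then have "(a = a' \<and> b = b') \<or> (a = b' \<and> b = a')"
    using A(2) B(2) A'(2) B'(2) by (metis poly_mapping_eqI)
  then show ?thesis by auto
qed

section \<open>Edges of unimodular triangulations\<close>

lemma int_lattice_add: "x \<in> int_lattice V \<Longrightarrow> y \<in> int_lattice V \<Longrightarrow> x + y \<in> int_lattice V"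
  using Poly_Mapping.keys_add[of x y] by (auto simp: int_lattice_def coord_space_def lookup_add)

lemma int_lattice_uminus: "x \<in> int_lattice V \<Longrightarrow> - x \<in> int_lattice V"
  by (auto simp: int_lattice_def coord_space_def)

lemma int_lattice_diff: "x \<in> int_lattice V \<Longrightarrow> y \<in> int_lattice V \<Longrightarrow> x - y \<in> int_lattice V"
  using int_lattice_add[OF _ int_lattice_uminus, of x V y] by simp

text \<open>All statements are transported along the lattice equivalence \<open>f\<close> from the
  standard simplex. Since \<open>f\<close> is only affine and only known on the affine hull, sums
  \<open>v + w\<close> are handled through midpoints.\<close>

lemma unimodular_simplex_lattice_points:
  assumes S: "unimodular_simplex (int_lattice V) P (nat (affdim P)) S" "lattice_simplex (int_lattice V) (affdim P) S"
    and SP: "S \<subseteq> P"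
  defines "C \<equiv> S \<inter> int_lattice V"
  shows "finite C" "\<not> affine_dependent C" "S = convex hull C"
    "\<And>x. x \<in> int_lattice V \<Longrightarrow> (1 / 2) *\<^sub>R x \<in> S \<Longrightarrow> \<exists>v\<in>C. \<exists>w\<in>C. x = v + w"
    "\<And>v w v' w'. v \<in> C \<Longrightarrow> w \<in> C \<Longrightarrow> v' \<in> C \<Longrightarrow> w' \<in> C \<Longrightarrow> v + w = v' + w' \<Longrightarrow> {v, w} = {v', w'}"
proof -
  define d where "d = nat (affdim P)"
  let ?A = "affine hull P" and ?L = "int_lattice V"
  obtain f where f: "affine_map_on ?A f" "bij_betw f ?A (coord_space {..<d})"
      "f ` (?L \<inter> ?A) = int_lattice {..<d}" "f ` S = standard_simplex d"
    using S(1) unfolding unimodular_simplex_def d_def by blast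
  obtain B where B: "B \<subseteq> ?L" "finite B" "\<not> affine_dependent B" "int (card B) = affdim P + 1" "S = convex hull B"
    using S(2) unfolding lattice_simplex_def by blast
  have SA: "S \<subseteq> ?A" using SP hull_subset[of P affine] by auto
  have inj: "inj_on f ?A" using f(2) by (simp add: bij_betw_def)
  have aff: "f ((1 - u) *\<^sub>R x + u *\<^sub>R y) = (1 - u) *\<^sub>R f x + u *\<^sub>R f y" if "x \<in> ?A" "y \<in> ?A" for x y u
    using f(1) that unfolding affine_map_on_def by blast
  have "B \<noteq> {}"
  proof
    assume "B = {}"
    then have "S = {}" using B(5) by simp
    then have "standard_simplex d = {}" using f(4) by simp
    then show False using std_vertices_subset(1)[of d] by (auto simp: std_vertices_def)
  qed
  then have "card B \<noteq> 0" using B(2) by simp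
  then have cardB: "card B = d + 1" using B(4) unfolding d_def by linarith
  have BC: "B \<subseteq> C" unfolding C_def using B(1,5) hull_subset[of B convex] by auto
  have fC: "f ` C \<subseteq> std_vertices d"
  proof (rule image_subsetI)
    fix v assume v: "v \<in> C"
    have "f v \<in> int_lattice {..<d}" using v SA f(3) by (auto simp: C_def)
    moreover have "f v \<in> standard_simplex d" using v f(4) by (auto simp: C_def)
    ultimately show "f v \<in> std_vertices d"
      using standard_simplex_bounds[of "f v" d] by (intro std_double_lattice_point(2)) auto
  qed
  have injC: "inj_on f C" using inj by (rule inj_on_subset) (use SA in \<open>auto simp: C_def\<close>)
  have finstd: "finite (std_vertices d)" by (simp add: std_vertices_def)
  have finC: "finite C" using finite_imageD[OF finite_subset[OF fC finstd] injC] .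
  have cardC: "card C \<le> d + 1"
    using card_inj_on_le[OF injC fC finstd] by (simp add: card_std_vertices)
  \<comment> \<open>\<open>C\<close> contains the \<open>d + 1\<close> vertices in \<open>B\<close>
    and injects into the \<open>d + 1\<close> standard vertices, so a unimodular simplex has no
    lattice points besides its vertices.\<close>
  have C: "C = B" using card_seteq[OF finC BC] cardC cardB by simp
  have fCeq: "f ` C = std_vertices d"
    using card_image[OF injC] card_subset_eq[OF finstd fC] cardB C by (simp add: card_std_vertices)
  show "finite C" by (rule finC)
  show "\<not> affine_dependent C" "S = convex hull C" using B C by auto
  have CA: "C \<subseteq> ?A" using SA by (auto simp: C_def)
  have mid: "f ((1 / 2) *\<^sub>R (v + w)) = (1 / 2) *\<^sub>R (f v + f w)" "(1 / 2) *\<^sub>R (v + w) \<in> ?A"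
    if "v \<in> ?A" "w \<in> ?A" for v w
  proof -
    have e: "(1 / 2) *\<^sub>R (v + w) = (1 - 1 / 2) *\<^sub>R v + (1 / 2) *\<^sub>R w" by (simp add: scaleR_add_right)
    show "f ((1 / 2) *\<^sub>R (v + w)) = (1 / 2) *\<^sub>R (f v + f w)"
      unfolding e aff[OF that] by (simp add: scaleR_add_right)
    show "(1 / 2) *\<^sub>R (v + w) \<in> ?A"
      unfolding e using that by (intro mem_affine[OF affine_affine_hull]) auto
  qed
  show "\<exists>v\<in>C. \<exists>w\<in>C. x = v + w" if x: "x \<in> ?L" "(1 / 2) *\<^sub>R x \<in> S" for x
  proof -
    let ?y = "(1 / 2) *\<^sub>R x"
    have "0 \<in> f ` C" unfolding fCeq by (simp add: std_vertices_def)
    then obtain v0 where v0: "v0 \<in> C" "f v0 = 0" by auto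
    have yA: "?y \<in> ?A" "v0 \<in> ?A" using x(2) SA v0 CA by auto
    \<comment> \<open>The point \<open>x\<close> itself may lie outside the affine hull, but its
      reflected version \<open>x - v0 = 2 ?y - v0\<close> lies in it and in the lattice; choosing
      \<open>v0\<close> above the origin makes its image exactly twice that of
      \<open>?y\<close>.\<close>
    have e: "x - v0 = (1 - 2) *\<^sub>R v0 + 2 *\<^sub>R ?y" by simp
    have "x - v0 \<in> ?A" unfolding e using yA by (intro mem_affine[OF affine_affine_hull]) auto
    moreover have "x - v0 \<in> ?L" using x(1) v0(1) by (intro int_lattice_diff) (auto simp: C_def)
    ultimately have "f (x - v0) \<in> int_lattice {..<d}" using f(3) by auto
    moreover have "f (x - v0) = 2 *\<^sub>R f ?y" unfolding e aff[OF yA(2,1)] v0(2) by simp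
    ultimately have lat: "2 *\<^sub>R f ?y \<in> int_lattice {..<d}" by simp
    have "f ?y \<in> standard_simplex d" using x(2) f(4) by auto
    note bd = standard_simplex_bounds[OF this]
    have "\<exists>u\<in>std_vertices d. \<exists>v\<in>std_vertices d. 2 *\<^sub>R f ?y = u + v"
    proof (rule std_double_lattice_point(1)[OF lat])
      show "0 \<le> lk (2 *\<^sub>R f ?y) i" for i using bd(2) by (simp add: lookup_scaleR)
      show "(\<Sum>i<d. lk (2 *\<^sub>R f ?y) i) \<le> 2"
        using bd(3) by (simp add: lookup_scaleR sum_distrib_left[symmetric])
    qed
    then obtain v w where vw: "v \<in> C" "w \<in> C" "2 *\<^sub>R f ?y = f v + f w" unfolding fCeq[symmetric] by blast
    have "f ?y = (1 / 2) *\<^sub>R (2 *\<^sub>R f ?y)" by simp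
    also have "\<dots> = f ((1 / 2) *\<^sub>R (v + w))" unfolding vw(3) using vw CA by (subst mid) auto
    finally have eq: "f ?y = f ((1 / 2) *\<^sub>R (v + w))" .
    have "(1 / 2) *\<^sub>R (v + w) \<in> ?A" using vw CA by (intro mid(2)) blast+
    then have "?y = (1 / 2) *\<^sub>R (v + w)" by (rule inj_onD[OF inj eq yA(1)])
    then have "2 *\<^sub>R ?y = 2 *\<^sub>R ((1 / 2) *\<^sub>R (v + w))" by simp
    then have "x = v + w" by simp
    then show ?thesis using vw by blast
  qed
  show "{v, w} = {v', w'}" if m: "v \<in> C" "w \<in> C" "v' \<in> C" "w' \<in> C" "v + w = v' + w'" for v w v' w'
  proof -
    have A: "v \<in> ?A" "w \<in> ?A" "v' \<in> ?A" "w' \<in> ?A" using m CA by blast+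
    have "(1 / 2) *\<^sub>R (f v + f w) = (1 / 2) *\<^sub>R (f v' + f w')"
      unfolding mid(1)[OF A(1,2), symmetric] mid(1)[OF A(3,4), symmetric] m(5) ..
    then have "f v + f w = f v' + f w'" by simp
    then have "{f v, f w} = {f v', f w'}" using fC m by (intro std_vertices_sum_unique[of _ d]) auto
    then have "f ` {v, w} = f ` {v', w'}" by simp
    then show ?thesis using inj_on_image_eq_iff[OF injC, of "{v, w}" "{v', w'}"] m by simp
  qed
qed

text \<open>An edge is sent to the sum of its end points, twice its midpoint. Inside one simplex
  this is injective by uniqueness of the representation; across simplices, a simplex containing the
  midpoint of an edge contains the whole edge, because simplices meet in faces.\<close>

lemma card_triangulation_edges:
  assumes T: "unimodular_triangulation (int_lattice V) P \<T>"
  shows "card (triangulation_edges \<T>)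
    = card ({x \<in> int_lattice V. (1 / 2) *\<^sub>R x \<in> P} - (\<lambda>v. v + v) ` (P \<inter> int_lattice V))"
proof -
  let ?L = "int_lattice V"
  define Q where "Q = {x \<in> ?L. (1 / 2) *\<^sub>R x \<in> P} - (\<lambda>v. v + v) ` (P \<inter> ?L)"
  have tri: "\<Union>\<T> = P" "\<And>S. S \<in> \<T> \<Longrightarrow> lattice_simplex ?L (affdim P) S"
    "\<And>S S'. S \<in> \<T> \<Longrightarrow> S' \<in> \<T> \<Longrightarrow> (S \<inter> S') face_of S \<and> (S \<inter> S') face_of S'"
    "\<And>S. S \<in> \<T> \<Longrightarrow> unimodular_simplex ?L P (nat (affdim P)) S"
    using T unfolding unimodular_triangulation_def lattice_triangulation_def by auto
  have SP: "S \<subseteq> P" if "S \<in> \<T>" for S using that tri(1) by auto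
  note simp = unimodular_simplex_lattice_points[OF tri(4) tri(2) SP]
  \<comment> \<open>An edge contains no lattice points but its ends, so this sum gives the sum of
    the end points without choosing names for them.\<close>
  define \<Phi> where "\<Phi> F = (\<Sum>u\<in>F \<inter> ?L. u)" for F :: "'a coords set"
  have edge: "\<exists>S v w. S \<in> \<T> \<and> v \<in> S \<inter> ?L \<and> w \<in> S \<inter> ?L \<and> v \<noteq> w \<and> F = convex hull {v, w}"
    if F: "F \<in> triangulation_edges \<T>" for F
  proof -
    obtain S where S: "S \<in> \<T>" "F face_of S" "affdim F = 1"
      using F unfolding triangulation_edges_def by blast
    then have "F face_of convex hull (S \<inter> ?L) \<and> affdim F = 1" using simp(3)[of S] by simp
    then obtain v w where "v \<in> S \<inter> ?L" "w \<in> S \<inter> ?L" "v \<noteq> w" "F = convex hull {v, w}"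
      using edge_face_of_simplex_iff[OF simp(1,2), of S F] S(1) by auto
    then show ?thesis using S(1) by blast
  qed
  have edgeI: "convex hull {v, w} \<in> triangulation_edges \<T>"
    if "S \<in> \<T>" "v \<in> S \<inter> ?L" "w \<in> S \<inter> ?L" "v \<noteq> w" for S v w
  proof -
    have "convex hull {v, w} face_of convex hull (S \<inter> ?L) \<and> affdim (convex hull {v, w}) = 1"
      using edge_face_of_simplex_iff[OF simp(1,2), of S "convex hull {v, w}"] that by blast
    then show ?thesis using that(1) simp(3)[of S] unfolding triangulation_edges_def by auto
  qed
  have \<Phi>: "\<Phi> (convex hull {v, w}) = v + w"
    if S: "S \<in> \<T>" "v \<in> S \<inter> ?L" "w \<in> S \<inter> ?L" "v \<noteq> w" for S v w
  proof -
    have "convex hull {v, w} \<inter> ?L = {v, w}"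
    proof
      show "{v, w} \<subseteq> convex hull {v, w} \<inter> ?L" using S hull_subset[of "{v, w}" convex] by auto
      show "convex hull {v, w} \<inter> ?L \<subseteq> {v, w}"
      proof
        fix c assume c: "c \<in> convex hull {v, w} \<inter> ?L"
        have "convex S" using simp(3)[OF S(1) S(1) S(1)] by (metis convex_convex_hull)
        then have "convex hull {v, w} \<subseteq> S" using S by (intro hull_minimal) auto
        then have cC: "c \<in> S \<inter> ?L" using c by auto
        show "c \<in> {v, w}"
        proof (rule ccontr)
          assume "c \<notin> {v, w}"
          then have "{v, w} \<subseteq> S \<inter> ?L - {c}" using S by auto
          then have "c \<in> affine hull (S \<inter> ?L - {c})"
            using c hull_mono[of "{v, w}" "S \<inter> ?L - {c}" affine] convex_hull_subset_affine_hull[of "{v, w}"] by blast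
          then have "affine_dependent (S \<inter> ?L)" unfolding affine_dependent_def using cC by blast
          then show False using simp(2)[OF S(1) S(1) S(1)] by simp
        qed
      qed
    qed
    then show ?thesis using S(4) by (simp add: \<Phi>_def)
  qed
  have half: "(1 / 2) *\<^sub>R (v + w) \<in> S" if S: "S \<in> \<T>" "v \<in> S" "w \<in> S" for S v w
  proof -
    have "convex S" using simp(3)[OF S(1) S(1) S(1)] by (metis convex_convex_hull)
    then have "(1 / 2) *\<^sub>R v + (1 / 2) *\<^sub>R w \<in> S" using S by (intro convexD) auto
    then show ?thesis by (simp add: scaleR_add_right)
  qed
  have ends: "v \<in> S'" "w \<in> S'"
    if S: "S \<in> \<T>" "v \<in> S" "w \<in> S" "v \<noteq> w" and S': "S' \<in> \<T>" "(1 / 2) *\<^sub>R (v + w) \<in> S'" for S S' v w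
  proof -
    have "(1 / 2) *\<^sub>R (v + w) \<in> open_segment v w"
      unfolding in_segment using S(4) by (intro conjI exI[of _ "1/2"]) (auto simp: scaleR_add_right)
    moreover have "(1 / 2) *\<^sub>R (v + w) \<in> S \<inter> S'" using half[OF S(1-3)] S'(2) by auto
    ultimately have "v \<in> S \<inter> S' \<and> w \<in> S \<inter> S'"
      using tri(3)[OF S(1) S'(1)] S by (blast dest: face_ofD)
    then show "v \<in> S'" "w \<in> S'" by auto
  qed
  have "bij_betw \<Phi> (triangulation_edges \<T>) Q"
  proof (rule bij_betwI')
    fix F F' assume F: "F \<in> triangulation_edges \<T>" and F': "F' \<in> triangulation_edges \<T>"
    show "(\<Phi> F = \<Phi> F') = (F = F')"
    proof
      assume eq: "\<Phi> F = \<Phi> F'"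
      obtain S v w where S: "S \<in> \<T>" "v \<in> S \<inter> ?L" "w \<in> S \<inter> ?L" "v \<noteq> w" "F = convex hull {v, w}"
        using edge[OF F] by blast
      obtain S' v' w' where S': "S' \<in> \<T>" "v' \<in> S' \<inter> ?L" "w' \<in> S' \<inter> ?L" "v' \<noteq> w'" "F' = convex hull {v', w'}"
        using edge[OF F'] by blast
      have sum: "v + w = v' + w'" using eq \<Phi>[OF S(1-4)] \<Phi>[OF S'(1-4)] S(5) S'(5) by simp
      have "(1 / 2) *\<^sub>R (v' + w') \<in> S" unfolding sum[symmetric] using half[of S v w] S by auto
      then have "v' \<in> S \<inter> ?L" "w' \<in> S \<inter> ?L" using ends[OF S'(1), of v' w' S] S S' by auto
      then have "{v, w} = {v', w'}" using simp(5)[OF S(1) S(1) S(1) S(2,3)] sum by blast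
      then show "F = F'" using S(5) S'(5) by simp
    qed simp
  next
    fix F assume "F \<in> triangulation_edges \<T>"
    then obtain S v w where S: "S \<in> \<T>" "v \<in> S \<inter> ?L" "w \<in> S \<inter> ?L" "v \<noteq> w" "F = convex hull {v, w}"
      using edge by blast
    have "v + w \<noteq> u + u" if u: "u \<in> P \<inter> ?L" for u
    proof
      assume eq: "v + w = u + u"
      have "(1 / 2) *\<^sub>R (v + w) \<in> S" using half[of S v w] S by auto
      moreover have "(1 / 2) *\<^sub>R (u + u) = u" by (simp add: scaleR_2[symmetric])
      ultimately have "u \<in> S \<inter> ?L" using u eq by auto
      then have "{v, w} = {u, u}" using simp(5)[OF S(1) S(1) S(1) S(2,3)] eq by blast
      then show False using S(4) by auto
    qed
    moreover have "(1 / 2) *\<^sub>R (v + w) \<in> P" using half[of S v w] S SP by blast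
    ultimately have "v + w \<in> Q" unfolding Q_def using S by (auto intro: int_lattice_add)
    then show "\<Phi> F \<in> Q" using \<Phi>[OF S(1-4)] S(5) by simp
  next
    fix x assume x: "x \<in> Q"
    then obtain S where S: "S \<in> \<T>" "(1 / 2) *\<^sub>R x \<in> S" using tri(1) unfolding Q_def by auto
    have "x \<in> ?L" using x by (simp add: Q_def)
    then obtain v w where vw: "v \<in> S \<inter> ?L" "w \<in> S \<inter> ?L" "x = v + w"
      using simp(4)[OF S(1) S(1) S(1) _ S(2)] by blast
    have "v \<noteq> w" using x vw SP[OF S(1)] unfolding Q_def by blast
    then show "\<exists>F\<in>triangulation_edges \<T>. x = \<Phi> F"
      using edgeI[OF S(1) vw(1,2)] \<Phi>[OF S(1) vw(1,2)] vw(3) by metis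
  qed
  then show ?thesis unfolding Q_def[symmetric] by (rule bij_betw_same_card)
qed

section \<open>Lattice points of symmetric edge polytopes\<close>

text \<open>One sign suffices here, as \<open>{i, j} \<in> E\<close> admits both orders of the
  nodes.\<close>

definition darcs :: "'v set set \<Rightarrow> 'v coords set" where
  "darcs E = {x. \<exists>i j. {i, j} \<in> E \<and> x = unit_vec i - unit_vec j}"

lemma symmetric_edge_polytope_eq: "symmetric_edge_polytope E = convex hull (darcs E)"
proof -
  have "{x :: 'a coords. \<exists>i j. {i, j} \<in> E \<and> (x = unit_vec i - unit_vec j \<or> x = - (unit_vec i - unit_vec j))} = darcs E"
    unfolding darcs_def by (auto simp: insert_commute) (metis insert_commute)+
  then show ?thesis unfolding symmetric_edge_polytope_def by simp
qed

lemma darcs_uminus: "a \<in> darcs E \<Longrightarrow> - a \<in> darcs E"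
  unfolding darcs_def by (auto simp: insert_commute) (metis insert_commute)

definition pairing :: "'v set \<Rightarrow> ('v \<Rightarrow> real) \<Rightarrow> 'v coords \<Rightarrow> real" where
  "pairing V \<phi> x = (\<Sum>v\<in>V. \<phi> v * lk x v)"

lemma pairing_add: "pairing V \<phi> (x + y) = pairing V \<phi> x + pairing V \<phi> y"
  by (simp add: pairing_def lookup_add distrib_left sum.distrib)

lemma pairing_diff: "pairing V \<phi> (x - y) = pairing V \<phi> x - pairing V \<phi> y"
  by (simp add: pairing_def lookup_minus right_diff_distrib sum_subtractf)

lemma pairing_scaleR: "pairing V \<phi> (r *\<^sub>R x) = r * pairing V \<phi> x"
  by (simp add: pairing_def lookup_scaleR sum_distrib_left mult_ac)

lemma pairing_unit_vec: "finite V \<Longrightarrow> i \<in> V \<Longrightarrow> pairing V \<phi> (unit_vec i) = \<phi> i"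
  by (simp add: pairing_def lookup_unit_vec of_bool_def if_distrib[of "(*) _"] cong: if_cong)

lemma all_arcs_pair: "{i, j} \<in> all_arcs V \<longleftrightarrow> i \<in> V \<and> j \<in> V \<and> i \<noteq> j"
  by (auto simp: all_arcs_def card_insert_if)

lemma darcsE:
  assumes "E \<subseteq> all_arcs V" "a \<in> darcs E"
  obtains i j where "{i, j} \<in> E" "i \<in> V" "j \<in> V" "i \<noteq> j" "a = unit_vec i - unit_vec j"
  using assms unfolding darcs_def by (auto simp: subset_iff all_arcs_pair)

lemma darcsI: "{i, j} \<in> E \<Longrightarrow> unit_vec i - unit_vec j \<in> darcs E"
  unfolding darcs_def by blast

lemma unit_vec_int_lattice: "i \<in> V \<Longrightarrow> unit_vec i \<in> int_lattice V"
  by (auto simp: int_lattice_def coord_space_def lookup_unit_vec of_bool_def in_keys_iff split: if_splits)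

lemma darcs_int_lattice: "E \<subseteq> all_arcs V \<Longrightarrow> darcs E \<subseteq> int_lattice V"
  by (auto elim!: darcsE intro!: int_lattice_diff unit_vec_int_lattice)

lemma pairing_le:
  assumes "finite V" "E \<subseteq> all_arcs V" "\<And>i j. {i, j} \<in> E \<Longrightarrow> \<bar>\<phi> i - \<phi> j\<bar> \<le> 1"
    and x: "x \<in> symmetric_edge_polytope E"
  shows "pairing V \<phi> x \<le> 1"
proof -
  have "convex {x. pairing V \<phi> x \<le> 1}"
    unfolding convex_def
  proof (intro ballI allI impI)
    fix x y :: "'a coords" and u v :: real
    assume "x \<in> {x. pairing V \<phi> x \<le> 1}" "y \<in> {x. pairing V \<phi> x \<le> 1}" "0 \<le> u" "0 \<le> v" "u + v = 1"
    then have "u * pairing V \<phi> x + v * pairing V \<phi> y \<le> u * 1 + v * 1"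
      by (intro add_mono mult_left_mono) auto
    then show "u *\<^sub>R x + v *\<^sub>R y \<in> {x. pairing V \<phi> x \<le> 1}"
      using \<open>u + v = 1\<close> by (simp add: pairing_add pairing_scaleR)
  qed
  moreover have "darcs E \<subseteq> {x. pairing V \<phi> x \<le> 1}"
  proof
    fix a assume "a \<in> darcs E"
    then obtain i j where ij: "{i, j} \<in> E" "i \<in> V" "j \<in> V" "a = unit_vec i - unit_vec j"
      using darcsE[OF assms(2)] by metis
    have "\<phi> i - \<phi> j \<le> 1" using assms(3)[OF ij(1)] by simp
    then show "a \<in> {x. pairing V \<phi> x \<le> 1}"
      using ij assms(1) by (simp add: pairing_diff pairing_unit_vec)
  qed
  ultimately have "symmetric_edge_polytope E \<subseteq> {x. pairing V \<phi> x \<le> 1}"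
    unfolding symmetric_edge_polytope_eq by (intro hull_minimal)
  then show ?thesis using x by auto
qed

text \<open>Constant potentials of arbitrary size are admissible; for a nonzero sum the constant
  \<open>2 / ?s\<close> would give \<open>2 \<le> 1\<close>.\<close>

lemma sum_lookup_eq_0:
  assumes "finite V" "E \<subseteq> all_arcs V" "x \<in> symmetric_edge_polytope E"
  shows "(\<Sum>v\<in>V. lk x v) = 0"
proof -
  let ?s = "\<Sum>v\<in>V. lk x v"
  have "c * ?s \<le> 1" for c
    using pairing_le[OF assms(1,2) _ assms(3), of "\<lambda>_. c"] by (simp add: pairing_def sum_distrib_left)
  from this[of "2 / ?s"] show ?thesis by (cases "?s = 0") auto
qed

lemma int_lattice_signed_decomp:
  assumes "finite V" "x \<in> int_lattice V" "(\<Sum>v\<in>V. lk x v) = 0"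
  obtains g h :: "'v \<Rightarrow> nat" where "\<And>v. lk x v = real (g v) - real (h v)"
    "\<And>v. g v = 0 \<or> h v = 0" "sum g V = sum h V" "\<And>v. v \<notin> V \<Longrightarrow> g v = 0" "\<And>v. v \<notin> V \<Longrightarrow> h v = 0"
proof -
  define g where "g v = nat \<lfloor>lk x v\<rfloor>" for v
  define h where "h v = nat \<lfloor>- lk x v\<rfloor>" for v
  have Z: "lk x v \<in> \<int>" for v using assms(2) by (auto simp: int_lattice_def)
  have l: "lk x v = real (g v) - real (h v)" for v
    using Z[of v] by (auto simp: g_def h_def elim!: Ints_cases)
  have z: "g v = 0 \<or> h v = 0" for v
    unfolding g_def h_def by linarith
  have out: "lk x v = 0" if "v \<notin> V" for v
    using assms(2) that by (auto simp: int_lattice_def coord_space_def in_keys_iff)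
  have "real (sum g V) = real (sum h V)" using assms(3) by (simp add: l sum_subtractf)
  then have "sum g V = sum h V" by linarith
  moreover have "g v = 0" "h v = 0" if "v \<notin> V" for v using out[OF that] by (auto simp: g_def h_def)
  ultimately show thesis using that l z by blast
qed

text \<open>Positive and negative part have the same total 0, 1 or 2. The norm is recorded in the
  last case because \<open>lattice_points\<close> rules that case out by it.\<close>

lemma int_lattice_cases:
  assumes "finite V" "x \<in> int_lattice V" "(\<Sum>v\<in>V. lk x v) = 0"
    and small: "(\<Sum>v\<in>V. \<bar>lk x v\<bar>) \<le> 4"
  shows "x = 0 \<or> (\<exists>i\<in>V. \<exists>j\<in>V. i \<noteq> j \<and> x = unit_vec i - unit_vec j)
    \<or> (\<exists>i\<in>V. \<exists>j\<in>V. \<exists>k\<in>V. \<exists>l\<in>V. i \<notin> {k, l} \<and> j \<notin> {k, l} \<and> x = unit_vec i + unit_vec j - unit_vec k - unit_vec l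
         \<and> (\<Sum>v\<in>V. \<bar>lk x v\<bar>) = 4)"
proof -
  obtain g h :: "'a \<Rightarrow> nat" where gh: "\<And>v. lk x v = real (g v) - real (h v)"
    "\<And>v. g v = 0 \<or> h v = 0" "sum g V = sum h V" "\<And>v. v \<notin> V \<Longrightarrow> g v = 0" "\<And>v. v \<notin> V \<Longrightarrow> h v = 0"
    using int_lattice_signed_decomp[OF assms(1-3)] by metis
  have ab: "\<bar>lk x v\<bar> = real (g v) + real (h v)" for v
    using gh(2)[of v] by (auto simp: gh(1))
  have n4: "(\<Sum>v\<in>V. \<bar>lk x v\<bar>) = 2 * real (sum g V)"
    unfolding ab sum.distrib using gh(3) by (simp flip: of_nat_sum)
  have eqI: "x = z" if "\<And>v. v \<in> V \<Longrightarrow> real (g v) - real (h v) = lk z v"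
    "\<And>v. v \<notin> V \<Longrightarrow> lk z v = 0" for z
    by (rule poly_mapping_eqI) (metis that gh(1,4,5) diff_self of_nat_0)
  have "sum g V \<le> 2" using small n4 by linarith
  then consider "sum g V = 0" | "sum g V = 1" | "sum g V = 2" by linarith
  then show ?thesis
  proof cases
    case 1
    then have "\<forall>v\<in>V. g v = 0" "\<forall>v\<in>V. h v = 0" using nat_fun_sum_cases(1)[OF assms(1)] gh(3) by metis+
    then have "x = 0" by (intro eqI) auto
    then show ?thesis by simp
  next
    case 2
    then obtain i where i: "i \<in> V" "\<forall>v\<in>V. g v = of_bool (i = v)" using nat_fun_sum_cases(2)[OF assms(1), of g] by auto
    obtain j where j: "j \<in> V" "\<forall>v\<in>V. h v = of_bool (j = v)" using nat_fun_sum_cases(2)[OF assms(1), of h] gh(3) 2 by auto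
    have "i \<noteq> j" using gh(2)[of i] i j by auto
    moreover have "x = unit_vec i - unit_vec j"
      by (intro eqI) (use i j in \<open>auto simp: lookup_minus lookup_unit_vec\<close>)
    ultimately show ?thesis using i(1) j(1) by blast
  next
    case 3
    obtain i j where ij: "i \<in> V" "j \<in> V" "\<forall>v\<in>V. g v = of_bool (i = v) + of_bool (j = v)"
      using nat_fun_sum_cases(3)[OF assms(1), of g] 3 by auto
    obtain k l where kl: "k \<in> V" "l \<in> V" "\<forall>v\<in>V. h v = of_bool (k = v) + of_bool (l = v)"
      using nat_fun_sum_cases(3)[OF assms(1), of h] 3 gh(3) by auto
    have "i \<notin> {k, l}" "j \<notin> {k, l}" using gh(2)[of i] gh(2)[of j] ij kl by auto
    moreover have "x = unit_vec i + unit_vec j - unit_vec k - unit_vec l"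
      by (intro eqI) (use ij kl in \<open>auto simp: lookup_minus lookup_add lookup_unit_vec\<close>)
    moreover have "(\<Sum>v\<in>V. \<bar>lk x v\<bar>) = 4" using n4 3 by simp
    ultimately show ?thesis
      using ij(1,2) kl(1,2)
      by (intro disjI2 bexI[of _ i] bexI[of _ j] bexI[of _ k] bexI[of _ l] conjI)
  qed
qed

text \<open>The test potential \<open>sgn / 2\<close> has values between -1/2 and 1/2 and is
  therefore admissible for every graph.\<close>

lemma sum_abs_lookup_le:
  assumes "finite V" "E \<subseteq> all_arcs V" "x \<in> symmetric_edge_polytope E"
  shows "(\<Sum>v\<in>V. \<bar>lk x v\<bar>) \<le> 2"
proof -
  have "pairing V (\<lambda>v. sgn (lk x v) / 2) x \<le> 1"
    by (rule pairing_le[OF assms(1,2) _ assms(3)]) (auto simp: sgn_if)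
  also have "pairing V (\<lambda>v. sgn (lk x v) / 2) x = (\<Sum>v\<in>V. \<bar>lk x v\<bar>) / 2"
    unfolding pairing_def sum_divide_distrib by (intro sum.cong refl) (auto simp: sgn_if)
  finally show ?thesis by simp
qed

lemma double_lattice_points:
  assumes "finite V" "E \<subseteq> all_arcs V"
  shows "{x \<in> int_lattice V. (1 / 2) *\<^sub>R x \<in> symmetric_edge_polytope E}
    = darcs E \<union> {a + b |a b. a \<in> darcs E \<and> b \<in> darcs E}" (is "?L = ?R")
proof
  show "?R \<subseteq> ?L"
  proof
    fix x assume x: "x \<in> ?R"
    have conv: "convex (symmetric_edge_polytope E)"
      and sub: "darcs E \<subseteq> symmetric_edge_polytope E"
      unfolding symmetric_edge_polytope_eq by (auto intro: hull_inc)
    have lat: "darcs E \<subseteq> int_lattice V" using darcs_int_lattice[OF assms(2)] .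
    from x show "x \<in> ?L"
    proof
      assume a: "x \<in> darcs E"
      have "(3/4) *\<^sub>R x + (1/4) *\<^sub>R (- x) \<in> symmetric_edge_polytope E"
        using a darcs_uminus[OF a] sub by (intro convexD[OF conv]) auto
      moreover have "(3/4) *\<^sub>R x + (1/4) *\<^sub>R (- x) = (1 / 2) *\<^sub>R x"
        by (simp add: scaleR_left_diff_distrib[symmetric])
      ultimately show ?thesis using a lat by auto
    next
      assume "x \<in> {a + b |a b. a \<in> darcs E \<and> b \<in> darcs E}"
      then obtain a b where ab: "x = a + b" "a \<in> darcs E" "b \<in> darcs E" by blast
      have "(1/2) *\<^sub>R a + (1/2) *\<^sub>R b \<in> symmetric_edge_polytope E"
        using ab sub by (intro convexD[OF conv]) auto
      moreover have "x \<in> int_lattice V" unfolding ab(1) using ab lat by (intro int_lattice_add) auto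
      ultimately show ?thesis by (simp add: ab(1) scaleR_add_right)
    qed
  qed
  show "?L \<subseteq> ?R"
  proof
    fix x assume x: "x \<in> ?L"
    note P = assms(1,2)
    have hx: "(1 / 2) *\<^sub>R x \<in> symmetric_edge_polytope E" using x by simp
    have bound: "pairing V \<phi> x \<le> 2" if "\<And>i j. {i, j} \<in> E \<Longrightarrow> \<bar>\<phi> i - \<phi> j\<bar> \<le> 1" for \<phi>
      using pairing_le[OF P that hx] by (simp add: pairing_scaleR)
    have s0: "(\<Sum>v\<in>V. lk x v) = 0"
      using sum_lookup_eq_0[OF P hx] by (simp add: lookup_scaleR sum_divide_distrib[symmetric])
    have s4: "(\<Sum>v\<in>V. \<bar>lk x v\<bar>) \<le> 4"
      using sum_abs_lookup_le[OF P hx] by (simp add: lookup_scaleR abs_mult sum_divide_distrib[symmetric])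
    have sumI: "x \<in> ?R" if "x = a + b" "a \<in> darcs E" "b \<in> darcs E" for a b
      using that by blast
    have ne: "darcs E \<noteq> {}" using hx unfolding symmetric_edge_polytope_eq by auto
    have "x \<in> int_lattice V" using x by simp
    from int_lattice_cases[OF P(1) this s0 s4]
    show "x \<in> ?R"
    proof (elim disjE bexE conjE)
      assume "x = 0"
      moreover obtain a where "a \<in> darcs E" using ne by auto
      ultimately have "x = a + - a" "a \<in> darcs E" "- a \<in> darcs E" using darcs_uminus by auto
      then show ?thesis by (intro sumI)
    next
      fix i j assume ij: "i \<in> V" "j \<in> V" "i \<noteq> j" "x = unit_vec i - unit_vec j"
      have "{i, j} \<in> E \<or> (\<exists>k. {i, k} \<in> E \<and> {k, j} \<in> E)"
      proof (rule ccontr)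
        assume no: "\<not> ?thesis"
        \<comment> \<open>The graph distance from \<open>j\<close>, truncated at 2 except at
          \<open>i\<close>: without an arc or a common neighbour, \<open>i\<close> may get the value
          3, since all its neighbours have the value 2.\<close>
        define \<phi> :: "'a \<Rightarrow> real" where
          "\<phi> v = (if v = j then 0 else if v = i then 3 else if {v, j} \<in> E then 1 else 2)" for v
        have "pairing V \<phi> x \<le> 2"
        proof (rule bound)
          fix a b assume ab: "{a, b} \<in> E"
          then have "{b, a} \<in> E" by (simp add: insert_commute)
          then show "\<bar>\<phi> a - \<phi> b\<bar> \<le> 1" using ab no unfolding \<phi>_def by (auto simp: insert_commute)
        qed
        moreover have "pairing V \<phi> x = 3"
          using ij P(1) by (simp add: pairing_diff pairing_unit_vec \<phi>_def)
        ultimately show False by simp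
      qed
      then show ?thesis
      proof
        assume "{i, j} \<in> E" then show ?thesis unfolding ij(4) by (intro UnI1 darcsI)
      next
        assume "\<exists>k. {i, k} \<in> E \<and> {k, j} \<in> E"
        then obtain k where k: "{i, k} \<in> E" "{k, j} \<in> E" by blast
        have "x = (unit_vec i - unit_vec k) + (unit_vec k - unit_vec j)" using ij(4) by simp
        with darcsI[OF k(1)] darcsI[OF k(2)] show ?thesis by (intro sumI)
      qed
    next
      fix i j k l
      assume V: "i \<in> V" "j \<in> V" "k \<in> V" "l \<in> V" and d: "i \<notin> {k, l}" "j \<notin> {k, l}"
        and xe: "x = unit_vec i + unit_vec j - unit_vec k - unit_vec l"
      have val: "pairing V \<phi> x = \<phi> i + \<phi> j - \<phi> k - \<phi> l" for \<phi>
        unfolding xe using V P(1) by (simp add: pairing_diff pairing_add pairing_unit_vec)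
      \<comment> \<open>If \<open>a\<close> had no arc to \<open>k\<close> or \<open>l\<close>, the
        potential with value 2 at \<open>a\<close>, 0 at \<open>k\<close> and \<open>l\<close> and 1
        elsewhere would be admissible, yet its pairing with \<open>x\<close> is at least 3.\<close>
      have hit: "{a, k} \<in> E \<or> {a, l} \<in> E" if a: "(a = i \<and> b = j) \<or> (a = j \<and> b = i)" for a b
      proof (rule ccontr)
        assume no: "\<not> ?thesis"
        define \<phi> :: "'a \<Rightarrow> real" where "\<phi> v = (if v = a then 2 else if v = k \<or> v = l then 0 else 1)" for v
        have "pairing V \<phi> x \<le> 2"
        proof (rule bound)
          fix c e assume "{c, e} \<in> E"
          then show "\<bar>\<phi> c - \<phi> e\<bar> \<le> 1" using no unfolding \<phi>_def by (auto simp: insert_commute)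
        qed
        then show False using a d unfolding val by (auto simp: \<phi>_def split: if_splits)
      qed
      have hit': "{i, a} \<in> E \<or> {j, a} \<in> E" if a: "(a = k \<and> b = l) \<or> (a = l \<and> b = k)" for a b
      proof (rule ccontr)
        assume no: "\<not> ?thesis"
        define \<phi> :: "'a \<Rightarrow> real" where "\<phi> v = (if v = a then 0 else if v = i \<or> v = j then 2 else 1)" for v
        have "pairing V \<phi> x \<le> 2"
        proof (rule bound)
          fix c e assume "{c, e} \<in> E"
          then show "\<bar>\<phi> c - \<phi> e\<bar> \<le> 1" using no unfolding \<phi>_def by (auto simp: insert_commute)
        qed
        then show False using a d unfolding val by (auto simp: \<phi>_def split: if_splits)
      qed
      \<comment> \<open>Hall's condition: each positive node meets a negative one and conversely,
        which for two nodes on either side yields a perfect matching.\<close>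
      have "({i, k} \<in> E \<and> {j, l} \<in> E) \<or> ({i, l} \<in> E \<and> {j, k} \<in> E)"
        using hit[of i j] hit[of j i] hit'[of k l] hit'[of l k] by blast
      then show ?thesis
      proof
        assume m: "{i, k} \<in> E \<and> {j, l} \<in> E"
        have "x = (unit_vec i - unit_vec k) + (unit_vec j - unit_vec l)" using xe by simp
        with darcsI m show ?thesis by (intro sumI) auto
      next
        assume m: "{i, l} \<in> E \<and> {j, k} \<in> E"
        have "x = (unit_vec i - unit_vec l) + (unit_vec j - unit_vec k)" using xe by simp
        with darcsI m show ?thesis by (intro sumI) auto
      qed
    qed
  qed
qed

lemma lattice_points:
  assumes "finite V" "E \<subseteq> all_arcs V"
  shows "symmetric_edge_polytope E \<inter> int_lattice V = darcs E \<union> (if E = {} then {} else {0})"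
proof
  have sub: "darcs E \<subseteq> symmetric_edge_polytope E"
    and conv: "convex (symmetric_edge_polytope E)"
    unfolding symmetric_edge_polytope_eq by (auto intro: hull_inc)
  show "darcs E \<union> (if E = {} then {} else {0}) \<subseteq> symmetric_edge_polytope E \<inter> int_lattice V"
  proof -
    have "0 \<in> symmetric_edge_polytope E" if "E \<noteq> {}"
    proof -
      obtain e where "e \<in> E" using \<open>E \<noteq> {}\<close> by auto
      then have "card e = 2" using assms(2) by (auto simp: all_arcs_def)
      then obtain i j where "e = {i, j}" unfolding card_2_iff by blast
      then have a: "unit_vec i - unit_vec j \<in> darcs E" using \<open>e \<in> E\<close> by (intro darcsI) simp
      have "(1/2) *\<^sub>R (unit_vec i - unit_vec j) + (1/2) *\<^sub>R (- (unit_vec i - unit_vec j)) \<in> symmetric_edge_polytope E"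
        using a darcs_uminus[OF a] sub by (intro convexD[OF conv]) auto
      then show ?thesis by (simp add: scaleR_diff_right)
    qed
    moreover have "0 \<in> int_lattice V" by (simp add: int_lattice_def coord_space_def)
    ultimately show ?thesis using sub darcs_int_lattice[OF assms(2)] by auto
  qed
  show "symmetric_edge_polytope E \<inter> int_lattice V \<subseteq> darcs E \<union> (if E = {} then {} else {0})"
  proof
    fix x assume x: "x \<in> symmetric_edge_polytope E \<inter> int_lattice V"
    then have xP: "x \<in> symmetric_edge_polytope E" "x \<in> int_lattice V" by auto
    have "E \<noteq> {}" using xP(1) unfolding symmetric_edge_polytope_eq darcs_def by auto
    have "(\<Sum>v\<in>V. \<bar>lk x v\<bar>) \<le> 4" using sum_abs_lookup_le[OF assms xP(1)] by simp
    from int_lattice_cases[OF assms(1) xP(2) sum_lookup_eq_0[OF assms xP(1)] this]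
    show "x \<in> darcs E \<union> (if E = {} then {} else {0})"
    proof (elim disjE bexE conjE)
      assume "x = 0" then show ?thesis using \<open>E \<noteq> {}\<close> by simp
    next
      fix i j assume ij: "i \<in> V" "j \<in> V" "i \<noteq> j" "x = unit_vec i - unit_vec j"
      have "{i, j} \<in> E"
      proof (rule ccontr)
        assume no: "{i, j} \<notin> E"
        \<comment> \<open>The values 0 and 2 occur only at \<open>j\<close> and \<open>i\<close>, so
          the only arc that could violate admissibility is the missing one.\<close>
        define \<phi> :: "'a \<Rightarrow> real" where "\<phi> v = (if v = i then 2 else if v = j then 0 else 1)" for v
        have "pairing V \<phi> x \<le> 1"
        proof (rule pairing_le[OF assms _ xP(1)])
          fix a b assume "{a, b} \<in> E"
          then show "\<bar>\<phi> a - \<phi> b\<bar> \<le> 1" using no unfolding \<phi>_def by (auto simp: insert_commute)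
        qed
        moreover have "pairing V \<phi> x = 2"
          using ij assms(1) by (simp add: pairing_diff pairing_unit_vec \<phi>_def)
        ultimately show False by simp
      qed
      then show ?thesis unfolding ij(4) by (intro UnI1 darcsI)
    next
      assume "(\<Sum>v\<in>V. \<bar>lk x v\<bar>) = 4"
      then show ?thesis using sum_abs_lookup_le[OF assms xP(1)] by simp
    qed
  qed
qed

section \<open>Counting the edges of a triangulation\<close>

text \<open>The four families of tuples index the lattice points to be counted:
  \<open>e_i - e_j\<close> for adjacent nodes and for nodes at distance two, both signs of
  \<open>2 e_i - e_j - e_k\<close> for cherries, and \<open>e_i + e_j - e_k - e_l\<close> for
  matched quadruples.\<close>

definition adjacent_pairs :: "'v set set \<Rightarrow> ('v \<times> 'v) set" where
  "adjacent_pairs A = {(i, j). {i, j} \<in> A}"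

definition distance2_pairs :: "'v set \<Rightarrow> 'v set set \<Rightarrow> ('v \<times> 'v) set" where
  "distance2_pairs V A = {(i, j). i \<in> V \<and> j \<in> V \<and> i \<noteq> j \<and> {i, j} \<notin> A \<and> (\<exists>k. {i, k} \<in> A \<and> {k, j} \<in> A)}"

definition cherries :: "'v set \<Rightarrow> 'v set set \<Rightarrow> ('v \<times> 'v \<times> 'v) set" where
  "cherries V A = {(i, j, k). i \<in> V \<and> j \<in> V \<and> k \<in> V \<and> j \<noteq> k \<and> {i, j} \<in> A \<and> {i, k} \<in> A}"

text \<open>In contrast to \<open>cycle_arcs\<close>, where a quadruple lists a cycle in its cyclic order, \<open>(i, j, k, l)\<close>
  stands here for the lattice point \<open>e\<^sub>i + e\<^sub>j - e\<^sub>k - e\<^sub>l\<close>.\<close>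

definition matched_quads :: "'v set \<Rightarrow> 'v set set \<Rightarrow> ('v \<times> 'v \<times> 'v \<times> 'v) set" where
  "matched_quads V A = {(i, j, k, l). (i, j, k, l) \<in> quads V \<and>
     ({i, k} \<in> A \<and> {j, l} \<in> A \<or> {i, l} \<in> A \<and> {j, k} \<in> A)}"

lemmas lookup_unit_simps = lookup_minus lookup_add lookup_unit_vec of_bool_def

lemma card_eq_fiber_mult:
  assumes "finite S" "\<And>x. x \<in> S \<Longrightarrow> card {y \<in> S. f y = f x} = m"
  shows "card S = m * card (f ` S)"
proof -
  have "card S = (\<Sum>z\<in>f ` S. \<Sum>x\<in>{x \<in> S. f x = z}. 1)"
    using sum.image_gen[OF assms(1), of "\<lambda>_. 1 :: nat" f] by simp
  also have "\<dots> = (\<Sum>z\<in>f ` S. m)"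
    using assms(2) by (intro sum.cong refl) auto
  finally show ?thesis by simp
qed

lemma unit_vec_sum_eq:
  assumes "unit_vec a + unit_vec b = unit_vec c + unit_vec d"
  shows "(a = c \<and> b = d) \<or> (a = d \<and> b = c)"
proof -
  have l: "lk (unit_vec a + unit_vec b) v = lk (unit_vec c + unit_vec d) v" for v using assms by simp
  show ?thesis
    using l[of a] l[of b] l[of c] l[of d] by (auto simp: lookup_unit_simps split: if_splits)
qed

lemma cherry_vec_eq:
  fixes i j k :: 'v
  assumes "i \<noteq> j" "i \<noteq> k" "i' \<noteq> j'" "i' \<noteq> k'"
    and eq: "unit_vec i + unit_vec i - unit_vec j - unit_vec k
      = unit_vec i' + unit_vec i' - unit_vec j' - unit_vec k'"
  shows "i = i'" "(j = j' \<and> k = k') \<or> (j = k' \<and> k = j')"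
proof -
  have "lk (unit_vec i + unit_vec i - unit_vec j - unit_vec k) i
      = lk (unit_vec i' + unit_vec i' - unit_vec j' - unit_vec k') i" using eq by simp
  then show i: "i = i'" using assms(1-4) by (auto simp: lookup_unit_simps split: if_splits)
  have "unit_vec j + unit_vec k = unit_vec j' + unit_vec k'"
    using eq unfolding i by (simp add: algebra_simps)
  then show "(j = j' \<and> k = k') \<or> (j = k' \<and> k = j')" by (rule unit_vec_sum_eq)
qed

lemma quad_vec_eq:
  fixes i j k l :: 'v
  assumes d: "distinct [i, j, k, l]" "distinct [i', j', k', l']"
    and eq: "unit_vec i + unit_vec j - unit_vec k - unit_vec l
      = unit_vec i' + unit_vec j' - unit_vec k' - unit_vec l'"
  shows "(i = i' \<and> j = j' \<or> i = j' \<and> j = i') \<and> (k = k' \<and> l = l' \<or> k = l' \<and> l = k')"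
proof -
  have l: "lk (unit_vec i + unit_vec j - unit_vec k - unit_vec l) v
      = lk (unit_vec i' + unit_vec j' - unit_vec k' - unit_vec l') v" for v using eq by simp
  have pos: "v = a \<or> v = b" if "lk (unit_vec a + unit_vec b - unit_vec c - unit_vec e) v = 1" for v a b c e :: 'v
    using that by (auto simp: lookup_unit_simps split: if_splits)
  have neg: "v = c \<or> v = e" if "lk (unit_vec a + unit_vec b - unit_vec c - unit_vec e) v = - 1" for v a b c e :: 'v
    using that by (auto simp: lookup_unit_simps split: if_splits)
  have "lk (unit_vec i + unit_vec j - unit_vec k - unit_vec l) i = 1"
    "lk (unit_vec i + unit_vec j - unit_vec k - unit_vec l) j = 1"
    "lk (unit_vec i + unit_vec j - unit_vec k - unit_vec l) k = - 1"
    "lk (unit_vec i + unit_vec j - unit_vec k - unit_vec l) l = - 1"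
    using d(1) by (auto simp add: lookup_unit_simps)
  then have "i = i' \<or> i = j'" "j = i' \<or> j = j'" "k = k' \<or> k = l'" "l = k' \<or> l = l'"
    unfolding eq by (blast dest: pos neg)+
  then show ?thesis using d(1) by auto
qed

locale finite_graph =
  fixes V :: "'v set" and A :: "'v set set"
  assumes finV: "finite V" and arcs: "A \<subseteq> all_arcs V"
begin

lemma arcD: "{i, j} \<in> A \<Longrightarrow> i \<in> V \<and> j \<in> V \<and> i \<noteq> j"
  using arcs all_arcs_pair[of i j V] by blast

lemma finite_tuples:
  "finite (adjacent_pairs A)" "finite (distance2_pairs V A)" "finite (cherries V A)" "finite (matched_quads V A)"
proof -
  show "finite (adjacent_pairs A)"
    by (rule finite_subset[of _ "V \<times> V"]) (use finV arcD in \<open>auto simp: adjacent_pairs_def\<close>)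
  show "finite (distance2_pairs V A)"
    by (rule finite_subset[of _ "V \<times> V"]) (use finV in \<open>auto simp: distance2_pairs_def\<close>)
  show "finite (cherries V A)"
    by (rule finite_subset[of _ "V \<times> V \<times> V"]) (use finV in \<open>auto simp: cherries_def\<close>)
  show "finite (matched_quads V A)"
    by (rule finite_subset[of _ "quads V"]) (use finite_quads[OF finV] in \<open>auto simp: matched_quads_def\<close>)
qed

definition vec2 :: "'v \<times> 'v \<Rightarrow> 'v coords" where
  "vec2 = (\<lambda>(i, j). unit_vec i - unit_vec j)"

definition vec3 :: "'v \<times> 'v \<times> 'v \<Rightarrow> 'v coords" where
  "vec3 = (\<lambda>(i, j, k). unit_vec i + unit_vec i - unit_vec j - unit_vec k)"

definition vec4 :: "'v \<times> 'v \<times> 'v \<times> 'v \<Rightarrow> 'v coords" where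
  "vec4 = (\<lambda>(i, j, k, l). unit_vec i + unit_vec j - unit_vec k - unit_vec l)"

definition P2 where "P2 = adjacent_pairs A \<union> distance2_pairs V A"

lemma P2_ne: "(i, j) \<in> P2 \<Longrightarrow> i \<noteq> j"
  using arcD by (auto simp: P2_def adjacent_pairs_def distance2_pairs_def)

lemma card_vec2: "card (vec2 ` P2) = card (adjacent_pairs A) + card (distance2_pairs V A)"
proof -
  have "inj_on vec2 P2"
  proof (rule inj_onI)
    fix x y assume xy: "x \<in> P2" "y \<in> P2" "vec2 x = vec2 y"
    obtain i j i' j' where e: "x = (i, j)" "y = (i', j')" by (cases x, cases y) auto
    have ne: "i \<noteq> j" "i' \<noteq> j'" using P2_ne xy e by auto
    have l: "lk (unit_vec i - unit_vec j) v = lk (unit_vec i' - unit_vec j') v" for v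
      using xy(3) unfolding e vec2_def by simp
    show "x = y" using l[of i] l[of j] ne unfolding e by (auto simp: lookup_unit_simps split: if_splits)
  qed
  then have "card (vec2 ` P2) = card P2" by (rule card_image)
  also have "\<dots> = card (adjacent_pairs A) + card (distance2_pairs V A)"
    unfolding P2_def using finite_tuples
    by (intro card_Un_disjoint) (auto simp: adjacent_pairs_def distance2_pairs_def)
  finally show ?thesis .
qed

lemma cherry_ne: "(i, j, k) \<in> cherries V A \<Longrightarrow> i \<noteq> j \<and> i \<noteq> k \<and> j \<noteq> k"
  using arcD by (auto simp: cherries_def)

text \<open>The two leaves of a cherry may be exchanged, and nothing else gives the same
  point.\<close>

lemma card_vec3: "card (cherries V A) = 2 * card (vec3 ` cherries V A)"
proof (rule card_eq_fiber_mult)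
  fix x assume x: "x \<in> cherries V A"
  obtain i j k where e: "x = (i, j, k)" by (cases x)
  have ne: "i \<noteq> j" "i \<noteq> k" "j \<noteq> k" using cherry_ne x e by auto
  have "{y \<in> cherries V A. vec3 y = vec3 x} = {(i, j, k), (i, k, j)}"
  proof
    show "{(i, j, k), (i, k, j)} \<subseteq> {y \<in> cherries V A. vec3 y = vec3 x}"
      using x unfolding e by (auto simp: cherries_def vec3_def)
    show "{y \<in> cherries V A. vec3 y = vec3 x} \<subseteq> {(i, j, k), (i, k, j)}"
    proof
      fix y assume y: "y \<in> {y \<in> cherries V A. vec3 y = vec3 x}"
      obtain i' j' k' where e': "y = (i', j', k')" by (cases y)
      have ne': "i' \<noteq> j'" "i' \<noteq> k'" "j' \<noteq> k'" using cherry_ne y e' by auto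
      have "unit_vec i' + unit_vec i' - unit_vec j' - unit_vec k' = unit_vec i + unit_vec i - unit_vec j - unit_vec k"
        using y unfolding e e' by (simp add: vec3_def)
      from cherry_vec_eq[OF ne'(1,2) ne(1,2) this] show "y \<in> {(i, j, k), (i, k, j)}"
        unfolding e' by auto
    qed
  qed
  then show "card {y \<in> cherries V A. vec3 y = vec3 x} = 2" using ne by simp
qed (rule finite_tuples)

text \<open>A point determines the unordered pairs of its positive and of its negative nodes, which
  leaves four orderings.\<close>

lemma card_vec4: "card (matched_quads V A) = 4 * card (vec4 ` matched_quads V A)"
proof (rule card_eq_fiber_mult)
  fix x assume x: "x \<in> matched_quads V A"
  obtain i j k l where e: "x = (i, j, k, l)" by (cases x)
  have ne: "distinct [i, j, k, l]" using x e by (auto simp: matched_quads_def quads_def)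
  have "{y \<in> matched_quads V A. vec4 y = vec4 x} = {(i, j, k, l), (j, i, k, l), (i, j, l, k), (j, i, l, k)}"
  proof
    show "{(i, j, k, l), (j, i, k, l), (i, j, l, k), (j, i, l, k)} \<subseteq> {y \<in> matched_quads V A. vec4 y = vec4 x}"
      using x unfolding e by (auto simp: matched_quads_def quads_def vec4_def algebra_simps)
    show "{y \<in> matched_quads V A. vec4 y = vec4 x} \<subseteq> {(i, j, k, l), (j, i, k, l), (i, j, l, k), (j, i, l, k)}"
    proof
      fix y assume y: "y \<in> {y \<in> matched_quads V A. vec4 y = vec4 x}"
      obtain i' j' k' l' where e': "y = (i', j', k', l')" by (cases y)
      have ne': "distinct [i', j', k', l']" using y e' by (auto simp: matched_quads_def quads_def)
      have "unit_vec i' + unit_vec j' - unit_vec k' - unit_vec l' = unit_vec i + unit_vec j - unit_vec k - unit_vec l"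
        using y unfolding e e' by (simp add: vec4_def)
      from quad_vec_eq[OF ne' ne this] show "y \<in> {(i, j, k, l), (j, i, k, l), (i, j, l, k), (j, i, l, k)}"
        unfolding e' by auto
    qed
  qed
  then show "card {y \<in> matched_quads V A. vec4 y = vec4 x} = 4" using ne by auto
qed (rule finite_tuples)

text \<open>The families are told apart by coordinates: \<open>vec3\<close> has an entry 2 but none
  equal to -2, its negative the reverse, the other two have entries of absolute value at most 1, and
  only \<open>vec4\<close> has two entries equal to 1.\<close>

lemma disjoint_vecs:
  "vec2 ` P2 \<inter> vec3 ` cherries V A = {}"
  "vec2 ` P2 \<inter> uminus ` vec3 ` cherries V A = {}"
  "vec2 ` P2 \<inter> vec4 ` matched_quads V A = {}"
  "vec3 ` cherries V A \<inter> uminus ` vec3 ` cherries V A = {}"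
  "vec3 ` cherries V A \<inter> vec4 ` matched_quads V A = {}"
  "uminus ` vec3 ` cherries V A \<inter> vec4 ` matched_quads V A = {}"
proof -
  have l2: "\<bar>lk x c\<bar> \<le> 1" if x: "x \<in> vec2 ` P2" for x c
    using x by (auto simp: vec2_def lookup_unit_simps)
  have l4: "\<bar>lk x c\<bar> \<le> 1" if x: "x \<in> vec4 ` matched_quads V A" for x c
    using x by (auto simp: vec4_def lookup_unit_simps matched_quads_def quads_def)
  have l3: "\<exists>c. lk x c = 2" "lk x c > -2" if x: "x \<in> vec3 ` cherries V A" for x c
  proof -
    obtain i j k where e: "x = vec3 (i, j, k)" "(i, j, k) \<in> cherries V A" using x by auto
    then have ne: "i \<noteq> j" "i \<noteq> k" "j \<noteq> k" using cherry_ne by auto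
    have "lk x i = 2" using ne unfolding e vec3_def by (auto simp: lookup_unit_simps)
    then show "\<exists>c. lk x c = 2" by blast
    show "lk x c > -2" using ne unfolding e vec3_def by (auto simp: lookup_unit_simps)
  qed
  have no: False if x: "x \<in> vec3 ` cherries V A" "\<And>c. \<bar>lk x c\<bar> \<le> 1" for x
  proof -
    obtain c where "lk x c = 2" using l3(1)[OF x(1)] by blast
    then show False using x(2)[of c] by simp
  qed
  show "vec2 ` P2 \<inter> vec3 ` cherries V A = {}" using l2 no by blast
  show "vec3 ` cherries V A \<inter> vec4 ` matched_quads V A = {}" using l4 no by blast
  show "vec3 ` cherries V A \<inter> uminus ` vec3 ` cherries V A = {}"
  proof (rule ccontr)
    assume "\<not> ?thesis"
    then obtain x z where xz: "x \<in> vec3 ` cherries V A" "z \<in> vec3 ` cherries V A" "x = - z" by blast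
    moreover obtain c where "lk z c = 2" using l3(1)[OF xz(2)] by blast
    ultimately show False using l3(2)[of x c] by simp
  qed
  show "vec2 ` P2 \<inter> uminus ` vec3 ` cherries V A = {}"
  proof (rule ccontr)
    assume "\<not> ?thesis"
    then obtain x z where xz: "x \<in> vec2 ` P2" "z \<in> vec3 ` cherries V A" "x = - z" by blast
    then obtain c where "lk z c = 2" using l3(1) by blast
    then show False using l2[OF xz(1), of c] xz(3) by simp
  qed
  show "uminus ` vec3 ` cherries V A \<inter> vec4 ` matched_quads V A = {}"
  proof (rule ccontr)
    assume "\<not> ?thesis"
    then obtain x z where xz: "x \<in> vec4 ` matched_quads V A" "z \<in> vec3 ` cherries V A" "x = - z" by blast
    then obtain c where "lk z c = 2" using l3(1) by blast
    then show False using l4[OF xz(1), of c] xz(3) by simp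
  qed
  show "vec2 ` P2 \<inter> vec4 ` matched_quads V A = {}"
  proof (rule ccontr)
    assume "\<not> ?thesis"
    then obtain a b i j k l where e: "vec2 (a, b) = vec4 (i, j, k, l)" "(i, j, k, l) \<in> matched_quads V A" by force
    have ne: "distinct [i, j, k, l]" using e(2) by (auto simp: matched_quads_def quads_def)
    have "lk (vec2 (a, b)) v = lk (vec4 (i, j, k, l)) v" for v using e(1) by simp
    from this[of i] this[of j] show False
      using ne by (auto simp: vec2_def vec4_def lookup_unit_simps split: if_splits)
  qed
qed

definition edge_points :: "'v coords set" where
  "edge_points = vec2 ` P2 \<union> vec3 ` cherries V A \<union> uminus ` vec3 ` cherries V A \<union> vec4 ` matched_quads V A"

lemma card_edge_points:
  "real (card edge_points) = real (card (adjacent_pairs A)) + real (card (distance2_pairs V A))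
    + real (card (cherries V A)) + real (card (matched_quads V A)) / 4"
proof -
  have fin: "finite (vec2 ` P2)" "finite (vec3 ` cherries V A)" "finite (uminus ` vec3 ` cherries V A)"
    "finite (vec4 ` matched_quads V A)"
    using finite_tuples by (auto simp: P2_def)
  have "card edge_points = card (vec2 ` P2) + card (vec3 ` cherries V A)
      + card (uminus ` vec3 ` cherries V A) + card (vec4 ` matched_quads V A)"
    unfolding edge_points_def using fin disjoint_vecs
    by (simp add: card_Un_disjoint Int_Un_distrib2)
  moreover have "card (uminus ` vec3 ` cherries V A) = card (vec3 ` cherries V A)"
    by (intro card_image inj_onI) simp
  ultimately show ?thesis using card_vec2 card_vec3 card_vec4 by simp
qed

lemma not_double:
  assumes "\<bar>lk x c\<bar> = 1" "v \<in> int_lattice V"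
  shows "x \<noteq> v + v"
proof
  assume "x = v + v"
  then have "lk x c = 2 * lk v c" by (simp add: lookup_add)
  moreover have "lk v c \<in> \<int>" using assms(2) by (auto simp: int_lattice_def)
  then obtain z :: int where "lk v c = real_of_int z" by (auto elim: Ints_cases)
  ultimately have "\<bar>real_of_int (2 * z)\<bar> = 1" using assms(1) by simp
  then have "\<bar>2 * z\<bar> = 1" by linarith
  then show False by presburger
qed

text \<open>A sum of two directed arcs is classified by coincidences of their ends: opposite arcs
  give 0 and equal arcs a doubled point, both removed; consecutive arcs give a pair at distance at
  most two, arcs with a common tail or head a cherry, and disjoint arcs a matched quadruple.
  Conversely every point of \<open>edge_points\<close> has a coordinate of absolute value 1 and
  hence is not doubled.\<close>

lemma edge_points_eq:
  "(darcs A \<union> {a + b |a b. a \<in> darcs A \<and> b \<in> darcs A})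
     - (\<lambda>v. v + v) ` (symmetric_edge_polytope A \<inter> int_lattice V) = edge_points" (is "?S - ?D = _")
proof
  have sumI: "x \<in> ?S" if "x = (unit_vec a - unit_vec b) + (unit_vec c - unit_vec d)" "{a, b} \<in> A" "{c, d} \<in> A" for x a b c d
    using that darcsI[of a b A] darcsI[of c d A] by blast
  have nD: "x \<notin> ?D" if "\<bar>lk x c\<bar> = 1" for x c
    using not_double[OF that] by auto
  show "edge_points \<subseteq> ?S - ?D"
  proof
    fix x assume "x \<in> edge_points"
    then consider (2) i j where "(i, j) \<in> P2" "x = unit_vec i - unit_vec j"
      | (3) i j k where "(i, j, k) \<in> cherries V A" "x = vec3 (i, j, k)"
      | (5) i j k where "(i, j, k) \<in> cherries V A" "x = - vec3 (i, j, k)"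
      | (4) i j k l where "(i, j, k, l) \<in> matched_quads V A" "x = vec4 (i, j, k, l)"
      unfolding edge_points_def vec2_def by fast
    then show "x \<in> ?S - ?D"
    proof cases
      case 2
      have "\<bar>lk x i\<bar> = 1" using P2_ne[OF 2(1)] unfolding 2(2) by (simp add: lookup_unit_simps)
      moreover have "x \<in> ?S"
      proof (cases "{i, j} \<in> A")
        case True then show ?thesis unfolding 2(2) by (intro UnI1 darcsI)
      next
        case False
        then obtain k where "{i, k} \<in> A" "{k, j} \<in> A"
          using 2(1) by (auto simp: P2_def adjacent_pairs_def distance2_pairs_def)
        then show ?thesis by (intro sumI[of x i k k j]) (auto simp: 2(2))
      qed
      ultimately show ?thesis using nD by blast
    next
      case 3
      have ne: "i \<noteq> j" "i \<noteq> k" "j \<noteq> k" using cherry_ne[OF 3(1)] by auto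
      have "\<bar>lk x j\<bar> = 1" using ne unfolding 3(2) vec3_def by (simp add: lookup_unit_simps)
      moreover have "x \<in> ?S" using 3
        by (intro sumI[of x i j i k]) (auto simp: cherries_def vec3_def)
      ultimately show ?thesis using nD by blast
    next
      case 5
      have ne: "i \<noteq> j" "i \<noteq> k" "j \<noteq> k" using cherry_ne[OF 5(1)] by auto
      have "\<bar>lk x j\<bar> = 1" using ne unfolding 5(2) vec3_def by (simp add: lookup_unit_simps)
      moreover have "x \<in> ?S" using 5
        by (intro sumI[of x j i k i]) (auto simp: cherries_def vec3_def insert_commute)
      ultimately show ?thesis using nD by blast
    next
      case 4
      have ne: "distinct [i, j, k, l]" using 4(1) by (auto simp: matched_quads_def quads_def)
      have "\<bar>lk x i\<bar> = 1" using ne unfolding 4(2) vec4_def by (auto simp: lookup_unit_simps)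
      moreover have "x \<in> ?S"
      proof (cases "{i, k} \<in> A \<and> {j, l} \<in> A")
        case True
        then show ?thesis by (intro sumI[of x i k j l]) (auto simp: 4(2) vec4_def)
      next
        case False
        then have "{i, l} \<in> A" "{j, k} \<in> A" using 4(1) by (auto simp: matched_quads_def)
        then show ?thesis by (intro sumI[of x i l j k]) (auto simp: 4(2) vec4_def)
      qed
      ultimately show ?thesis using nD by blast
    qed
  qed
next
  show "?S - ?D \<subseteq> edge_points"
  proof
    fix x assume x: "x \<in> ?S - ?D"
    have adj: "unit_vec a - unit_vec b \<in> edge_points" if "{a, b} \<in> A" for a b
      using that unfolding edge_points_def P2_def adjacent_pairs_def vec2_def by force
    have path: "unit_vec a - unit_vec b \<in> edge_points" if "{a, c} \<in> A" "{c, b} \<in> A" "a \<noteq> b" for a b c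
    proof (cases "{a, b} \<in> A")
      case False
      then have "(a, b) \<in> P2" using that arcD by (auto simp: P2_def distance2_pairs_def)
      then show ?thesis unfolding edge_points_def vec2_def by force
    qed (rule adj)
    have dbl: "v + v \<in> ?D" if "v \<in> darcs A \<union> (if A = {} then {} else {0})" for v
      using that unfolding lattice_points[OF finV arcs] by blast
    from x have "x \<in> ?S" "x \<notin> ?D" by auto
    from this(1) show "x \<in> edge_points"
    proof
      assume "x \<in> darcs A"
      then show ?thesis using adj unfolding darcs_def by blast
    next
      assume "x \<in> {a + b |a b. a \<in> darcs A \<and> b \<in> darcs A}"
      then obtain i k j l where ij: "{i, k} \<in> A" "{j, l} \<in> A"
        and xe: "x = (unit_vec i - unit_vec k) + (unit_vec j - unit_vec l)"
        unfolding darcs_def by blast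
      have ne: "i \<noteq> k" "j \<noteq> l" and V: "i \<in> V" "k \<in> V" "j \<in> V" "l \<in> V" using arcD ij by blast+
      consider "i = l" "j = k" | "i = l" "j \<noteq> k" | "j = k" "i \<noteq> l" | "i = j" "k = l"
        | "i \<noteq> l" "j \<noteq> k" "i = j" "k \<noteq> l" | "i \<noteq> l" "j \<noteq> k" "i \<noteq> j" "k = l"
        | "i \<noteq> l" "j \<noteq> k" "i \<noteq> j" "k \<noteq> l" by blast
      then show ?thesis
      proof cases
        case 1
        then have "x = 0 + 0" using xe by simp
        moreover have "0 + 0 \<in> ?D" using ij(1) by (intro dbl) auto
        ultimately show ?thesis using \<open>x \<notin> ?D\<close> by simp
      next
        case 2
        then have "x = unit_vec j - unit_vec k" using xe by simp
        then show ?thesis using path[of j i k] ij 2 by simp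
      next
        case 3
        then have "x = unit_vec i - unit_vec l" using xe by simp
        then show ?thesis using path[of i k l] ij 3 by simp
      next
        case 4
        then have "x = (unit_vec i - unit_vec k) + (unit_vec i - unit_vec k)" using xe by simp
        moreover have "(unit_vec i - unit_vec k) + (unit_vec i - unit_vec k) \<in> ?D"
          using darcsI[OF ij(1)] by (intro dbl) auto
        ultimately show ?thesis using \<open>x \<notin> ?D\<close> by simp
      next
        case 5
        have "(i, k, l) \<in> cherries V A" using 5 ij V by (auto simp: cherries_def)
        moreover have "x = vec3 (i, k, l)" using 5 xe by (simp add: vec3_def)
        ultimately show ?thesis unfolding edge_points_def by blast
      next
        case 6
        have "(k, i, j) \<in> cherries V A" using 6 ij V by (auto simp: cherries_def insert_commute)
        moreover have "x = - vec3 (k, i, j)" using 6 xe by (simp add: vec3_def)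
        ultimately show ?thesis unfolding edge_points_def by blast
      next
        case 7
        have "(i, j, k, l) \<in> matched_quads V A" using 7 ij V ne by (auto simp: matched_quads_def quads_def)
        moreover have "x = vec4 (i, j, k, l)" using xe by (simp add: vec4_def)
        ultimately show ?thesis unfolding edge_points_def by blast
      qed
    qed
  qed
qed

end

definition correction :: "'v set \<Rightarrow> 'v set set \<Rightarrow> real" where
  "correction V A = real (card (distance2_pairs V A)) - real (card (cherries V A))"

lemma real_card_eq_sum: "finite S \<Longrightarrow> real (card {x \<in> S. P x}) = (\<Sum>x\<in>S. of_bool (P x))"
  by (simp add: of_bool_def sum.If_cases Int_def)

section \<open>Expressing the counts by arcs, degrees and 4-cycles\<close>

context finite_graph
begin

definition adj :: "'v \<Rightarrow> 'v \<Rightarrow> real" where "adj i j = of_bool ({i, j} \<in> A)"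

definition deg :: "'v \<Rightarrow> real" where "deg i = (\<Sum>j\<in>V. adj i j)"

lemma adj_commute: "adj i j = adj j i"
  by (simp add: adj_def insert_commute)

lemma adj_idem: "adj i j * adj i j = adj i j"
  by (simp add: adj_def)

lemma card_adjacent_pairs_sum: "real (card (adjacent_pairs A)) = (\<Sum>i\<in>V. \<Sum>j\<in>V. adj i j)"
proof -
  have "adjacent_pairs A = {x \<in> V \<times> V. {fst x, snd x} \<in> A}"
    using arcD by (auto simp: adjacent_pairs_def)
  then have "real (card (adjacent_pairs A)) = (\<Sum>x\<in>V \<times> V. of_bool ({fst x, snd x} \<in> A))"
    using finV by (simp only: real_card_eq_sum finite_cartesian_product)
  then show ?thesis
    by (simp only: sum.cartesian_product adj_def case_prod_unfold)
qed

lemma card_adjacent_pairs: "real (card (adjacent_pairs A)) = 2 * arc_count V A"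
proof -
  have "card (adjacent_pairs A) = 2 * card ((\<lambda>(i, j). {i, j}) ` adjacent_pairs A)"
  proof (rule card_eq_fiber_mult)
    fix x assume x: "x \<in> adjacent_pairs A"
    obtain i j where e: "x = (i, j)" by (cases x)
    have "{y \<in> adjacent_pairs A. (\<lambda>(i, j). {i, j}) y = (\<lambda>(i, j). {i, j}) x} = {(i, j), (j, i)}"
    proof (rule set_eqI)
      fix y :: "'v \<times> 'v"
      obtain u v where y: "y = (u, v)" by (cases y)
      have m: "{i, j} \<in> A" using x unfolding e adjacent_pairs_def by simp
      have "({u, v} \<in> A \<and> {u, v} = {i, j}) = (u = i \<and> v = j \<or> u = j \<and> v = i)"
        using m by (simp only: doubleton_eq_iff) (metis insert_commute)
      then show "(y \<in> {y \<in> adjacent_pairs A. (\<lambda>(i, j). {i, j}) y = (\<lambda>(i, j). {i, j}) x}) = (y \<in> {(i, j), (j, i)})"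
        unfolding e y adjacent_pairs_def by simp
    qed
    moreover have "i \<noteq> j" using x arcD unfolding e adjacent_pairs_def by auto
    ultimately show "card {y \<in> adjacent_pairs A. (\<lambda>(i, j). {i, j}) y = (\<lambda>(i, j). {i, j}) x} = 2" by simp
  qed (rule finite_tuples)
  moreover have "(\<lambda>(i, j). {i, j}) ` adjacent_pairs A = A"
  proof
    show "A \<subseteq> (\<lambda>(i, j). {i, j}) ` adjacent_pairs A"
    proof
      fix e assume "e \<in> A"
      moreover then obtain a b where "e = {a, b}" using arcs all_arcs_pairD by blast
      ultimately show "e \<in> (\<lambda>(i, j). {i, j}) ` adjacent_pairs A"
        by (intro image_eqI[of _ _ "(a, b)"]) (auto simp: adjacent_pairs_def)
    qed
  qed (auto simp: adjacent_pairs_def)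
  moreover have "arc_count V A = real (card A)"
  proof -
    have "arc_count V A = real (card {e \<in> all_arcs V. e \<in> A})"
      unfolding arc_count_def using finite_all_arcs[OF finV] by (simp add: real_card_eq_sum)
    also have "{e \<in> all_arcs V. e \<in> A} = A" using arcs by auto
    finally show ?thesis .
  qed
  ultimately show ?thesis by simp
qed

lemma card_cherries: "real (card (cherries V A)) = (\<Sum>i\<in>V. (deg i)\<^sup>2) - real (card (adjacent_pairs A))"
proof -
  have "cherries V A = {x \<in> V \<times> V \<times> V. fst (snd x) \<noteq> snd (snd x) \<and> {fst x, fst (snd x)} \<in> A \<and> {fst x, snd (snd x)} \<in> A}"
    by (auto simp: cherries_def)
  then have "real (card (cherries V A)) = (\<Sum>i\<in>V. \<Sum>j\<in>V. \<Sum>k\<in>V. of_bool (j \<noteq> k \<and> {i, j} \<in> A \<and> {i, k} \<in> A))"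
    using finV by (simp only: real_card_eq_sum finite_cartesian_product sum.cartesian_product case_prod_unfold)
  also have "\<dots> = (\<Sum>i\<in>V. (deg i)\<^sup>2 - deg i)"
  proof (intro sum.cong refl)
    fix i assume "i \<in> V"
    have "(\<Sum>j\<in>V. \<Sum>k\<in>V. of_bool (j \<noteq> k \<and> {i, j} \<in> A \<and> {i, k} \<in> A))
        = (\<Sum>j\<in>V. \<Sum>k\<in>V. adj i j * adj i k - (if j = k then adj i j else 0))"
      by (intro sum.cong refl) (auto simp: adj_def)
    also have "\<dots> = (\<Sum>j\<in>V. \<Sum>k\<in>V. adj i j * adj i k) - deg i"
      using finV by (simp add: sum_subtractf deg_def)
    finally show "(\<Sum>j\<in>V. \<Sum>k\<in>V. of_bool (j \<noteq> k \<and> {i, j} \<in> A \<and> {i, k} \<in> A)) = (deg i)\<^sup>2 - deg i"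
      by (simp add: power2_eq_square deg_def sum_product)
  qed
  finally show ?thesis by (simp add: sum_subtractf card_adjacent_pairs_sum deg_def)
qed

definition parallel_quads :: "('v \<times> 'v \<times> 'v \<times> 'v) set" where
  "parallel_quads = {(i, j, k, l). (i, j, k, l) \<in> quads V \<and> {i, k} \<in> A \<and> {j, l} \<in> A}"

definition crossed_quads :: "('v \<times> 'v \<times> 'v \<times> 'v) set" where
  "crossed_quads = {(i, j, k, l). (i, j, k, l) \<in> quads V \<and> {i, l} \<in> A \<and> {j, k} \<in> A}"

text \<open>Ordered pairs of directed arcs number \<open>M^2\<close>, with \<open>M\<close> the
  number of adjacent ordered pairs; inclusion and exclusion removes those that share a node.\<close>

lemma card_parallel_quads:
  "real (card parallel_quads) = (real (card (adjacent_pairs A)))\<^sup>2 - 4 * (\<Sum>i\<in>V. (deg i)\<^sup>2)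
     + 2 * real (card (adjacent_pairs A))"
proof -
  let ?m = "real (card (adjacent_pairs A))"
  have "parallel_quads = {x \<in> V \<times> V \<times> V \<times> V. case x of (i, j, k, l) \<Rightarrow> distinct [i, j, k, l] \<and> {i, k} \<in> A \<and> {j, l} \<in> A}"
    by (auto simp: parallel_quads_def quads_def)
  then have "real (card parallel_quads)
      = (\<Sum>i\<in>V. \<Sum>j\<in>V. \<Sum>k\<in>V. \<Sum>l\<in>V. of_bool (distinct [i, j, k, l] \<and> {i, k} \<in> A \<and> {j, l} \<in> A))"
    using finV by (simp only: real_card_eq_sum finite_cartesian_product sum.cartesian_product case_prod_unfold)
  also have "\<dots> = (\<Sum>i\<in>V. \<Sum>k\<in>V. \<Sum>j\<in>V. \<Sum>l\<in>V. of_bool (distinct [i, j, k, l] \<and> {i, k} \<in> A \<and> {j, l} \<in> A))"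
    by (intro sum.cong refl sum.swap)
  also have "\<dots> = (\<Sum>i\<in>V. \<Sum>k\<in>V. adj i k * (?m - 2 * deg i - 2 * deg k + 2 * adj i k))"
  proof (intro sum.cong refl)
    fix i k assume ik: "i \<in> V" "k \<in> V"
    \<comment> \<open>Of the four coincidences of \<open>j\<close> or \<open>l\<close> with
      \<open>i\<close> or \<open>k\<close>, two can hold at once only when the second arc equals the
      first, in either direction; this accounts for the two correction terms.\<close>
    have "(\<Sum>j\<in>V. \<Sum>l\<in>V. of_bool (distinct [i, j, k, l] \<and> {i, k} \<in> A \<and> {j, l} \<in> A))
      = (\<Sum>j\<in>V. \<Sum>l\<in>V. adj i k * (adj j l - (if j = i then adj j l else 0) - (if l = i then adj j l else 0)
          - (if j = k then adj j l else 0) - (if l = k then adj j l else 0)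
          + (if j = i then if l = k then adj j l else 0 else 0) + (if j = k then if l = i then adj j l else 0 else 0)))"
    proof (intro sum.cong refl)
      fix j l
      show "of_bool (distinct [i, j, k, l] \<and> {i, k} \<in> A \<and> {j, l} \<in> A)
        = adj i k * (adj j l - (if j = i then adj j l else 0) - (if l = i then adj j l else 0)
          - (if j = k then adj j l else 0) - (if l = k then adj j l else 0)
          + (if j = i then if l = k then adj j l else 0 else 0) + (if j = k then if l = i then adj j l else 0 else 0))"
      proof (cases "{i, k} \<in> A \<and> {j, l} \<in> A")
        case True
        then have "i \<noteq> k" "j \<noteq> l" "adj i k = 1" "adj j l = 1" using arcD by (auto simp: adj_def)
        then show ?thesis using True by auto
      next
        case False
        then show ?thesis by (auto simp: adj_def)
      qed
    qed
    also have "\<dots> = adj i k * (\<Sum>j\<in>V. \<Sum>l\<in>V. (adj j l - (if j = i then adj j l else 0) - (if l = i then adj j l else 0)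
          - (if j = k then adj j l else 0) - (if l = k then adj j l else 0)
          + (if j = i then if l = k then adj j l else 0 else 0) + (if j = k then if l = i then adj j l else 0 else 0)))"
      by (simp only: sum_distrib_left)
    also have "(\<Sum>j\<in>V. \<Sum>l\<in>V. (adj j l - (if j = i then adj j l else 0) - (if l = i then adj j l else 0)
          - (if j = k then adj j l else 0) - (if l = k then adj j l else 0)
          + (if j = i then if l = k then adj j l else 0 else 0) + (if j = k then if l = i then adj j l else 0 else 0)))
       = ?m - deg i - deg i - deg k - deg k + adj i k + adj k i"
    proof -
      have r: "(\<Sum>j\<in>V. \<Sum>l\<in>V. if j = c then adj j l else 0) = deg c" if "c \<in> V" for c
      proof -
        have "(\<Sum>j\<in>V. \<Sum>l\<in>V. if j = c then adj j l else 0) = (\<Sum>j\<in>V. if j = c then deg c else 0)"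
          by (intro sum.cong refl) (auto simp: deg_def)
        then show ?thesis using that finV by simp
      qed
      have c: "(\<Sum>j\<in>V. \<Sum>l\<in>V. if l = c then adj j l else 0) = deg c" if "c \<in> V" for c
        using that finV by (simp add: deg_def adj_commute)
      have rc: "(\<Sum>j\<in>V. \<Sum>l\<in>V. if j = a then if l = b then adj j l else 0 else 0) = adj a b"
        if "a \<in> V" "b \<in> V" for a b
      proof -
        have "(\<Sum>j\<in>V. \<Sum>l\<in>V. if j = a then if l = b then adj j l else 0 else 0) = (\<Sum>j\<in>V. if j = a then adj a b else 0)"
          using that finV by (intro sum.cong refl) auto
        then show ?thesis using that finV by simp
      qed
      show ?thesis
        unfolding sum_subtractf sum.distrib r[OF ik(1)] r[OF ik(2)] c[OF ik(1)] c[OF ik(2)] rc[OF ik] rc[OF ik(2,1)]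
          card_adjacent_pairs_sum ..
    qed
    finally show "(\<Sum>j\<in>V. \<Sum>l\<in>V. of_bool (distinct [i, j, k, l] \<and> {i, k} \<in> A \<and> {j, l} \<in> A))
        = adj i k * (?m - 2 * deg i - 2 * deg k + 2 * adj i k)"
      by (simp add: adj_commute[of k i])
  qed
  also have "\<dots> = (\<Sum>i\<in>V. \<Sum>k\<in>V. (?m + 2) * adj i k - 2 * (deg i * adj i k) - 2 * (deg k * adj i k))"
  proof (intro sum.cong refl)
    fix i k
    have "adj i k * (?m - 2 * deg i - 2 * deg k + 2 * adj i k)
        = ?m * adj i k - 2 * (deg i * adj i k) - 2 * (deg k * adj i k) + 2 * (adj i k * adj i k)"
      by (simp add: algebra_simps)
    then show "adj i k * (?m - 2 * deg i - 2 * deg k + 2 * adj i k)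
        = (?m + 2) * adj i k - 2 * (deg i * adj i k) - 2 * (deg k * adj i k)"
      by (simp add: adj_idem algebra_simps)
  qed
  also have "\<dots> = (?m + 2) * ?m - 2 * (\<Sum>i\<in>V. (deg i)\<^sup>2) - 2 * (\<Sum>k\<in>V. (deg k)\<^sup>2)"
  proof -
    have 1: "(\<Sum>i\<in>V. \<Sum>k\<in>V. deg i * adj i k) = (\<Sum>i\<in>V. (deg i)\<^sup>2)"
      by (simp add: sum_distrib_left[symmetric] power2_eq_square deg_def)
    have 2: "(\<Sum>i\<in>V. \<Sum>k\<in>V. deg k * adj i k) = (\<Sum>i\<in>V. (deg i)\<^sup>2)"
      unfolding 1[symmetric] by (subst sum.swap) (simp only: adj_commute)
    have 0: "(\<Sum>i\<in>V. \<Sum>k\<in>V. c * f i k) = c * (\<Sum>i\<in>V. \<Sum>k\<in>V. f i k)" for c :: real and f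
      by (simp only: sum_distrib_left)
    show ?thesis
      unfolding sum_subtractf 0 1 2 card_adjacent_pairs_sum ..
  qed
  finally show ?thesis by (simp add: power2_eq_square algebra_simps)
qed

text \<open>Exchanging the last two entries maps parallel to crossed quadruples. A quadruple that is
  both carries all four arcs of a 4-cycle, with cyclic order \<open>(i, k, j, l)\<close>.\<close>

lemma card_matched_quads:
  "real (card (matched_quads V A)) = 2 * real (card parallel_quads) - cycles4 V A"
proof -
  have fin: "finite parallel_quads" "finite crossed_quads"
    by (rule finite_subset[OF _ finite_quads[OF finV]], auto simp: parallel_quads_def crossed_quads_def)+
  have "matched_quads V A = parallel_quads \<union> crossed_quads"
    by (auto simp: matched_quads_def parallel_quads_def crossed_quads_def)
  then have "card (matched_quads V A) + card (parallel_quads \<inter> crossed_quads) = card parallel_quads + card crossed_quads"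
    using card_Un_Int[OF fin] by simp
  moreover have "card crossed_quads = card parallel_quads"
    by (rule bij_betw_same_card[of "\<lambda>(i, j, k, l). (i, j, l, k)"],
        rule bij_betw_byWitness[where f' = "\<lambda>(i, j, k, l). (i, j, l, k)"])
       (auto simp: crossed_quads_def parallel_quads_def quads_def)
  moreover have "card (parallel_quads \<inter> crossed_quads) = card {t \<in> quads V. cycle_arcs t \<subseteq> A}"
    by (rule bij_betw_same_card[of "\<lambda>(i, j, k, l). (i, k, j, l)"],
        rule bij_betw_byWitness[where f' = "\<lambda>(i, j, k, l). (i, k, j, l)"])
       (auto simp: crossed_quads_def parallel_quads_def quads_def insert_commute)
  moreover have "cycles4 V A = real (card {t \<in> quads V. cycle_arcs t \<subseteq> A})"
    unfolding cycles4_def using finite_quads[OF finV] by (simp add: real_card_eq_sum)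
  ultimately show ?thesis by linarith
qed

text \<open>The matched quadruples contribute \<open>2 m^2 - T / 4\<close> minus twice the sum of
  squared degrees plus \<open>2 m\<close>. Together with the \<open>2 m\<close> adjacent pairs this
  turns the single positive occurrence of the cherries into a single negative one, which is the sign
  in \<open>correction\<close>.\<close>

theorem card_triangulation_edges_eq:
  assumes "unimodular_triangulation (int_lattice V) (symmetric_edge_polytope A) \<T>"
  shows "real (card (triangulation_edges \<T>)) = main_part V A + correction V A"
proof -
  have "card (triangulation_edges \<T>) = card edge_points"
    unfolding card_triangulation_edges[OF assms] double_lattice_points[OF finV arcs] edge_points_eq ..
  then show ?thesis
    unfolding card_edge_points card_matched_quads card_parallel_quads card_cherries card_adjacent_pairs
      main_part_def correction_def
    by (simp add: card_edge_points card_matched_quads card_parallel_quads card_cherries card_adjacent_pairs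
        power2_eq_square field_simps)
qed

end

section \<open>The effect of a single arc on the correction term\<close>

lemma abs_card_diff_le:
  assumes "finite S" "finite S'" "S - S' \<subseteq> W" "S' - S \<subseteq> W" "finite W"
  shows "\<bar>real (card S) - real (card S')\<bar> \<le> real (card W)"
proof -
  have 1: "card S \<le> card S' + card W" if "finite S'" "S - S' \<subseteq> W" for S S'
  proof -
    have "S \<subseteq> S' \<union> W" using that by auto
    then have "card S \<le> card (S' \<union> W)" using that assms(5) by (intro card_mono) auto
    also have "\<dots> \<le> card S' + card W" by (rule card_Un_le)
    finally show ?thesis .
  qed
  show ?thesis using 1[OF assms(2,3)] 1[OF assms(1,4)] by linarith
qed

lemma card_Union_list_le_sum: "card (\<Union>(set Bs)) \<le> sum_list (map card Bs)"
proof (induction Bs)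
  case (Cons B Bs)
  have "card (\<Union>(set (B # Bs))) \<le> card B + card (\<Union>(set Bs))" using card_Un_le by simp
  then show ?case using Cons by simp
qed simp

text \<open>Apart from the pair \<open>e\<close> itself, a pair or cherry whose status depends on
  \<open>e\<close> uses \<open>e\<close> in its path, and its remaining node is a neighbour of an
  end of \<open>e\<close>. This gives at most \<open>2 + 2 * arc_degree\<close> pairs and
  \<open>2 * arc_degree\<close> cherries.\<close>

lemma abs_dd_correction_le:
  assumes V: "finite V" and e: "e \<in> all_arcs V" and A: "A \<subseteq> all_arcs V"
  shows "\<bar>dd e (correction V) A\<bar> \<le> 4 * (1 + arc_degree V e A)"
proof -
  obtain a b where ab: "e = {a, b}" "a \<noteq> b" "a \<in> V" "b \<in> V" using all_arcs_pairD[OF e] by blast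
  define N where "N v = {w \<in> V. {v, w} \<in> A}" for v
  have finN: "finite (N v)" for v using V by (simp add: N_def)
  have deg: "degree_in V A v = real (card (N v))" for v
    unfolding degree_in_def N_def using V by (simp add: real_card_eq_sum)
  let ?B = "A - {e}" and ?B' = "insert e A"
  interpret B: finite_graph V ?B using V A by unfold_locales auto
  interpret B': finite_graph V ?B' using V A e by unfold_locales auto
  have c1: "card ({u} \<times> M) = card M" "card (M \<times> {u}) = card M" "card ({u} \<times> {v} \<times> M) = card M"
    "card ({u} \<times> M \<times> {v}) = card M" for u v :: 'a and M :: "'a set"
    by (simp_all add: card_cartesian_product)
  have c2: "card {(a, b), (b, a)} \<le> 2" by (rule order.trans[OF card_insert_le_m1[of 2]]) auto
  define W2 where "W2 = [{(a, b), (b, a)}, {a} \<times> N b, {b} \<times> N a, N b \<times> {a}, N a \<times> {b}]"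
  have "\<bar>real (card (distance2_pairs V ?B')) - real (card (distance2_pairs V ?B))\<bar> \<le> real (card (\<Union>(set W2)))"
  proof (rule abs_card_diff_le)
    show "distance2_pairs V ?B' - distance2_pairs V ?B \<subseteq> \<Union>(set W2)"
    proof
      fix x assume x: "x \<in> distance2_pairs V ?B' - distance2_pairs V ?B"
      obtain i j where ij: "x = (i, j)" by (cases x)
      obtain k where k: "{i, k} \<in> ?B'" "{k, j} \<in> ?B'" and ne: "i \<noteq> j" "i \<in> V" "j \<in> V" "{i, j} \<notin> ?B'"
        using x unfolding ij distance2_pairs_def by blast
      have "{i, j} \<notin> ?B" using ne(4) by blast
      then have "\<not> ({i, k} \<in> ?B \<and> {k, j} \<in> ?B)"
        using x ne(1-3) unfolding ij distance2_pairs_def by blast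
      then have "{i, k} = e \<or> {k, j} = e" using k by blast
      moreover have "\<not> ({i, k} = e \<and> {k, j} = e)" using ne(1) by (auto simp: doubleton_eq_iff)
      ultimately have "({i, k} = {a, b} \<and> {k, j} \<in> A) \<or> ({k, j} = {a, b} \<and> {i, k} \<in> A)"
        using k unfolding ab(1) by blast
      then have "(i = a \<and> {b, j} \<in> A) \<or> (i = b \<and> {a, j} \<in> A) \<or> (j = b \<and> {a, i} \<in> A) \<or> (j = a \<and> {b, i} \<in> A)"
        unfolding doubleton_eq_iff by (elim disjE conjE) (simp_all add: insert_commute)
      then show "x \<in> \<Union>(set W2)"
        unfolding ij using ne by (elim disjE conjE) (simp_all add: W2_def N_def)
    qed
    show "distance2_pairs V ?B - distance2_pairs V ?B' \<subseteq> \<Union>(set W2)"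
    proof
      fix x assume x: "x \<in> distance2_pairs V ?B - distance2_pairs V ?B'"
      obtain i j where ij: "x = (i, j)" by (cases x)
      have "{i, j} = e" using x unfolding ij distance2_pairs_def by blast
      then show "x \<in> \<Union>(set W2)" unfolding ij ab(1) doubleton_eq_iff by (auto simp: W2_def)
    qed
    show "finite (\<Union>(set W2))" by (auto simp: W2_def finN)
  qed (rule B'.finite_tuples B.finite_tuples)+
  moreover have "card (\<Union>(set W2)) \<le> 2 + 2 * card (N a) + 2 * card (N b)"
  proof -
    have "card (\<Union>(set W2)) \<le> sum_list (map card W2)" by (rule card_Union_list_le_sum)
    also have "\<dots> = card {(a, b), (b, a)} + (card (N b) + (card (N a) + (card (N b) + (card (N a) + 0))))"
      by (simp only: W2_def list.map sum_list.Cons sum_list.Nil c1)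
    finally show ?thesis using c2 by linarith
  qed
  ultimately have 2: "\<bar>real (card (distance2_pairs V ?B')) - real (card (distance2_pairs V ?B))\<bar>
      \<le> real (2 + 2 * card (N a) + 2 * card (N b))" by linarith
  define W3 where "W3 = [{a} \<times> {b} \<times> N a, {b} \<times> {a} \<times> N b, {a} \<times> N a \<times> {b}, {b} \<times> N b \<times> {a}]"
  have "\<bar>real (card (cherries V ?B')) - real (card (cherries V ?B))\<bar> \<le> real (card (\<Union>(set W3)))"
  proof (rule abs_card_diff_le)
    show "cherries V ?B' - cherries V ?B \<subseteq> \<Union>(set W3)"
    proof
      fix x assume x: "x \<in> cherries V ?B' - cherries V ?B"
      obtain i j k where ij: "x = (i, j, k)" by (cases x)
      have k: "{i, j} \<in> ?B'" "{i, k} \<in> ?B'" "j \<noteq> k" "i \<in> V" "j \<in> V" "k \<in> V" "\<not> ({i, j} \<in> ?B \<and> {i, k} \<in> ?B)"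
        using x unfolding ij cherries_def by blast+
      have "\<not> ({i, j} = e \<and> {i, k} = e)" using k(3) by (auto simp: doubleton_eq_iff)
      then have "({i, j} = {a, b} \<and> {i, k} \<in> A) \<or> ({i, k} = {a, b} \<and> {i, j} \<in> A)"
        using k(1,2,7) unfolding ab(1) by blast
      then show "x \<in> \<Union>(set W3)"
        unfolding ij doubleton_eq_iff using k(4-6) by (elim disjE conjE) (simp_all add: W3_def N_def)
    qed
    show "cherries V ?B - cherries V ?B' \<subseteq> \<Union>(set W3)" by (auto simp: cherries_def)
    show "finite (\<Union>(set W3))" by (auto simp: W3_def finN)
  qed (rule B'.finite_tuples B.finite_tuples)+
  moreover have "card (\<Union>(set W3)) \<le> 2 * card (N a) + 2 * card (N b)"
  proof -
    have "card (\<Union>(set W3)) \<le> sum_list (map card W3)" by (rule card_Union_list_le_sum)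
    also have "\<dots> = card (N a) + (card (N b) + (card (N a) + (card (N b) + 0)))"
      by (simp only: W3_def list.map sum_list.Cons sum_list.Nil c1)
    finally show ?thesis by linarith
  qed
  ultimately have 3: "\<bar>real (card (cherries V ?B')) - real (card (cherries V ?B))\<bar>
      \<le> real (2 * card (N a) + 2 * card (N b))" by linarith
  have "arc_degree V e A = real (card (N a)) + real (card (N b))"
    using ab by (simp add: arc_degree_def deg)
  then show ?thesis using 2 3 unfolding dd_def correction_def by simp
qed

section \<open>The central limit theorem\<close>

lemma erdos_renyi_eq: "erdos_renyi n p = random_subset (all_arcs {1..n}) p"
  by (simp add: erdos_renyi_def random_subset_def)

text \<open>The numbers are those of \<open>graph_normal_approximation\<close> with
  \<open>c0 = 4\<close>: \<open>24 = 8 + 16\<close>, \<open>8 = 2 * 4\<close> and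
  \<open>127 = 111 + 16\<close>. The additional 1 in the bound on \<open>n^2 p\<close> provides the
  density condition of the locale.\<close>

theorem edge_count_normal_approximation:
  fixes n :: nat and p \<delta> z :: real and K :: "nat set set \<Rightarrow> nat"
  assumes p: "0 < p" "p < 1" and \<delta>: "0 < \<delta>" "p \<le> 1 - \<delta>"
    and n_large: "24 / \<delta> \<le> real n" and s_large: "1 + 8 / \<delta> \<le> (real n)\<^sup>2 * p"
    and K: "\<And>E. E \<subseteq> all_arcs {1..n} \<Longrightarrow>
      \<exists>\<T>. unimodular_triangulation (int_lattice {1..n}) (symmetric_edge_polytope E) \<T> \<and>
        K E = card (triangulation_edges \<T>)"
  shows "\<bar>cdf (standardized_law (erdos_renyi n p) (\<lambda>E. real (K E))) z - Phi z\<bar>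
    \<le> ((2 * 127 + 10 * 127\<^sup>2) / (\<delta> ^ 3 / 4) + 7 * 127 / sqrt (\<delta> ^ 3 / 4)) / (real n * sqrt p)"
proof -
  define V where "V = {1..n}"
  interpret dense_random_graph V p
  proof
    show "1 \<le> (real (card V))\<^sup>2 * p" using s_large \<delta> by (simp add: V_def) (smt (verit) divide_nonneg_pos)
  qed (use p in \<open>auto simp: V_def\<close>)
  define F where "F A = main_part V A + correction V A" for A
  have KF: "real (K A) = F A" if A: "A \<subseteq> all_arcs V" for A
  proof -
    interpret finite_graph V A using A by unfold_locales (auto simp: V_def)
    obtain \<T> where "unimodular_triangulation (int_lattice V) (symmetric_edge_polytope A) \<T>"
      "K A = card (triangulation_edges \<T>)" using K[of A] A unfolding V_def by blast
    then show ?thesis using card_triangulation_edges_eq[of \<T>] by (simp add: F_def)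
  qed
  let ?M = "erdos_renyi n p" and ?X = "\<lambda>A. real (K A)"
  have M: "?M = random_subset (all_arcs V) p" by (simp add: erdos_renyi_eq V_def)
  have EK: "measure_pmf.expectation ?M ?X = E F" unfolding M by (rule E_cong) (rule KF)
  have VK: "measure_pmf.expectation ?M (\<lambda>A. (?X A - E F)\<^sup>2) = Var F"
    unfolding M Var_eq by (rule E_cong) (simp add: KF)
  have "cdf (standardized_law ?M ?X) z = measure_pmf.prob ?M {A. standardized ?M ?X A \<le> z}"
    unfolding cdf_def standardized_law_def by (subst measure_distr) (auto simp: vimage_def)
  also have "\<dots> = measure_pmf.expectation ?M (indicator {A. standardized ?M ?X A \<le> z})"
    by simp
  also have "\<dots> = E (\<lambda>A. of_bool ((F A - E F) / sqrt (Var F) \<le> z))"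
    unfolding standardized_def EK VK unfolding M
    by (rule E_cong) (simp add: KF indicator_def)
  finally have "cdf (standardized_law ?M ?X) z = E (\<lambda>A. of_bool ((F A - E F) / sqrt (Var F) \<le> z))" .
  moreover have "\<bar>E (\<lambda>A. of_bool ((F A - E F) / sqrt (Var F) \<le> z)) - Phi z\<bar>
    \<le> ((2 * (111 + 4 * 4) + 10 * (111 + 4 * 4)\<^sup>2) / (\<delta> ^ 3 / 4) + 7 * (111 + 4 * 4) / sqrt (\<delta> ^ 3 / 4))
      / (real (card V) * sqrt p)"
  proof (rule graph_normal_approximation[where Z = "correction V"])
    show "\<bar>dd e (correction V) A\<bar> \<le> 4 * (1 + arc_degree V e A)" if "e \<in> all_arcs V" "A \<subseteq> all_arcs V" for e A
      using that by (intro abs_dd_correction_le) (auto simp: V_def)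
    show "(8 + 4 * 4) / \<delta> \<le> real (card V)" using n_large by (simp add: V_def)
    show "2 * 4 / \<delta> \<le> (real (card V))\<^sup>2 * p" using s_large by (simp add: V_def)
  qed (use \<delta> in \<open>auto simp: F_def\<close>)
  ultimately show ?thesis by (simp add: V_def)
qed

lemma limsup_less_1_eventually_le:
  fixes f :: "nat \<Rightarrow> real"
  assumes "limsup (\<lambda>n. ereal (f n)) < 1"
  obtains \<delta> where "0 < \<delta>" "eventually (\<lambda>n. f n \<le> 1 - \<delta>) sequentially"
proof -
  obtain c where c: "limsup (\<lambda>n. ereal (f n)) < ereal c" "ereal c < 1"
    using ereal_dense2[OF assms] by blast
  have "eventually (\<lambda>n. ereal (f n) < ereal c) sequentially"
    using c(1) by (rule Limsup_lessD)
  then have "eventually (\<lambda>n. f n \<le> 1 - (1 - c)) sequentially"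
    by eventually_elim simp
  then show thesis using c(2) by (intro that[of "1 - c"]) auto
qed

theorem theorem4p6:
  fixes p :: "nat \<Rightarrow> real"
    and K :: "nat \<Rightarrow> nat set set \<Rightarrow> nat"
  assumes p_range: "\<And>n. 0 < p n \<and> p n < 1"
    and K: "\<And>n E. E \<subseteq> all_arcs {1..n} \<Longrightarrow>
              \<exists>\<T>. unimodular_triangulation (int_lattice {1..n}) (symmetric_edge_polytope E) \<T> \<and>
                   K n E = card (triangulation_edges \<T>)"
    and p_large: "asymp_dominates p (\<lambda>n. 1 / real n ^ 2)"
    and p_limsup: "limsup (\<lambda>n. ereal (p n)) < 1"
  shows "asymp_bounded
           (\<lambda>n. kolmogorov_dist
                (standardized_law (erdos_renyi n (p n)) (\<lambda>E. real (K n E)))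
                std_normal_distribution)
           (\<lambda>n. 1 / (real n * sqrt (p n)))
         \<and> weak_conv_m (\<lambda>n. standardized_law (erdos_renyi n (p n)) (\<lambda>E. real (K n E)))
           std_normal_distribution"
proof -
  let ?\<mu> = "\<lambda>n. standardized_law (erdos_renyi n (p n)) (\<lambda>E. real (K n E))"
  obtain \<delta> where \<delta>: "0 < \<delta>" "eventually (\<lambda>n. p n \<le> 1 - \<delta>) sequentially"
    using limsup_less_1_eventually_le[OF p_limsup] by blast
  define C where "C = (2 * 127 + 10 * 127\<^sup>2) / (\<delta> ^ 3 / 4) + 7 * 127 / sqrt (\<delta> ^ 3 / 4)"
  have C: "0 \<le> C" using \<delta>(1) by (simp add: C_def)
  have "(\<lambda>n. ereal \<bar>p n / (1 / real n ^ 2)\<bar>) \<longlonglongrightarrow> \<infinity>"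
    using p_large unfolding asymp_dominates_def
    by (simp add: Liminf_PInfty)
  then have "filterlim (\<lambda>n. \<bar>p n / (1 / real n ^ 2)\<bar>) at_top sequentially"
    by (simp add: tendsto_PInfty_eq_at_top)
  moreover have "\<bar>p n / (1 / real n ^ 2)\<bar> = (real n)\<^sup>2 * p n" for n
    using p_range[of n] by (simp add: abs_mult)
  ultimately have s: "filterlim (\<lambda>n. (real n)\<^sup>2 * p n) at_top sequentially" by simp
  have ev: "eventually (\<lambda>n. 0 < n \<and> (\<forall>z. \<bar>cdf (?\<mu> n) z - Phi z\<bar> \<le> C / (real n * sqrt (p n)))) sequentially"
  proof -
    have "eventually (\<lambda>n. 24 / \<delta> \<le> real n) sequentially"
      using filterlim_real_sequentially by (simp add: filterlim_at_top)
    moreover have "eventually (\<lambda>n. 1 + 8 / \<delta> \<le> (real n)\<^sup>2 * p n) sequentially"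
      using s by (simp add: filterlim_at_top)
    ultimately show ?thesis
      using \<delta>(2) eventually_gt_at_top[of 0]
    proof eventually_elim
      case (elim n)
      then show ?case
        unfolding C_def using p_range[of n] \<delta>(1) K[of _ n]
        by (intro conjI allI edge_count_normal_approximation) auto
    qed
  qed
  have bounded: "eventually (\<lambda>n. ereal \<bar>kolmogorov_dist (?\<mu> n) std_normal_distribution / (1 / (real n * sqrt (p n)))\<bar> \<le> ereal C) sequentially"
    using ev
  proof eventually_elim
    case (elim n)
    let ?D = "kolmogorov_dist (?\<mu> n) std_normal_distribution" and ?b = "real n * sqrt (p n)"
    have b: "0 < ?b" using elim p_range[of n] by simp
    have "?D \<le> C / ?b"
      unfolding kolmogorov_dist_def using elim by (intro cSUP_least) auto
    moreover have "0 \<le> ?D"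
    proof -
      \<comment> \<open>A value can be compared with a real supremum only once the range is known to
        be bounded, which the estimate uniform in \<open>z\<close> provides.\<close>
      have "bdd_above (range (\<lambda>z. \<bar>cdf (?\<mu> n) z - Phi z\<bar>))"
        using elim by (intro bdd_aboveI2[where M = "C / ?b"]) auto
      then have "\<bar>cdf (?\<mu> n) 0 - Phi 0\<bar> \<le> ?D"
        unfolding kolmogorov_dist_def by (intro cSUP_upper) auto
      then show ?thesis by linarith
    qed
    moreover have "\<bar>?D / (1 / ?b)\<bar> = ?D * ?b" using b \<open>0 \<le> ?D\<close> by simp
    ultimately show ?case using b by (simp only: ereal_less_eq pos_le_divide_eq)
  qed
  have "limsup (\<lambda>n. ereal \<bar>kolmogorov_dist (?\<mu> n) std_normal_distribution / (1 / (real n * sqrt (p n)))\<bar>) \<le> ereal C"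
    by (rule Limsup_bounded) (rule bounded)
  then have "asymp_bounded (\<lambda>n. kolmogorov_dist (?\<mu> n) std_normal_distribution) (\<lambda>n. 1 / (real n * sqrt (p n)))"
    unfolding asymp_bounded_def by (rule order.strict_trans1) simp
  moreover have "weak_conv_m ?\<mu> std_normal_distribution"
    unfolding weak_conv_m_def weak_conv_def
  proof (intro allI impI)
    fix z
    \<comment> \<open>The rate \<open>n * sqrt p\<close> is the square root of \<open>n^2 p\<close>,
      which tends to infinity by the assumed domination; hence the distribution functions converge
      at every point.\<close>
    have "filterlim (\<lambda>n. sqrt ((real n)\<^sup>2 * p n)) at_top sequentially"
      by (rule filterlim_compose[OF sqrt_at_top s])
    then have "((\<lambda>n. C / sqrt ((real n)\<^sup>2 * p n)) \<longlongrightarrow> 0) sequentially"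
      by (intro tendsto_divide_0[OF tendsto_const] filterlim_at_top_imp_at_infinity)
    then have "(\<lambda>n. cdf (?\<mu> n) z - Phi z) \<longlonglongrightarrow> 0"
    proof (rule Lim_null_comparison[rotated])
      show "eventually (\<lambda>n. norm (cdf (?\<mu> n) z - Phi z) \<le> C / sqrt ((real n)\<^sup>2 * p n)) sequentially"
        using ev by eventually_elim (simp add: real_sqrt_mult)
    qed
    then show "(\<lambda>n. cdf (?\<mu> n) z) \<longlonglongrightarrow> Phi z" by (simp add: LIM_zero_iff)
  qed
  ultimately show ?thesis by blast
qed

end
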